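(* Let $(F_j)_{j\in\mathbb Z}$ be an admissible family and let $p\in(0,+\infty)$. Then there exists a unique real number $\lambda$ for which there exists a hull function $((h_j)_{j\in\mathbb Z},(g_j)_{j\in\mathbb Z})$ (depending on $p$) associated with $(F_j)_j$, $p$ and $\lambda$. Moreover, the real number $\lambda=\overline F(p)$, seen as a function of $p$, is continuous on $(0,+\infty)$.
   Context: Fix integers $n\ge1$, $m\in\mathbb N$ and a real $\alpha_0>0$. For a family $v=(v_j)_{j\in\mathbb Z}$ of functions, $[v]_{j,m}(z)=(v_{j-m}(z),\dots,v_{j+m}(z))$. A family of functions $F_j:\mathbb R\times\mathbb R^{2m+1}\to\mathbb R$, $(\tau,V)\mapsto F_j(\tau,V)$, $V=(V_{-m},\dots,V_m)$, $j\in\mathbb Z$, is called admissible if: (A1) $F_j$ is continuous, and Lipschitz continuous in $V$ uniformly in $\tau$ and $j$; (A2) $F_j(\tau,V)$ is non-decreasing in $V_i$ for each $i\ne0$; (A3) $\alpha_0+2\,\partial F_j/\partial V_0\ge0$ for all $j$, i.e. $V_0\mapsto 2F_j(\tau,V)+\alpha_0V_0$ is non-decreasing; (A4) $F_j(\tau,V_{-m}+1,\dots,V_m+1)=F_j(\tau,V_{-m},\dots,V_m)$ and $F_j(\tau+1,V)=F_j(\tau,V)$; (A5) $F_{j+n}=F_j$ for all $j\in\mathbb Z$; (A6) for all $(V_{-m},\dots,V_m,V_{m+1})\in\mathbb R^{2m+2}$ with $V_{i+1}\ge V_i$ for all $|i|\le m$, $2F_{j+1}(\tau,V_{-m+1},\dots,V_{m+1})+\alpha_0V_1\ge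 2F_j(\tau,V_{-m},\dots,V_m)+\alpha_0V_0$. Hull function. Given $(F_j)_j$, $p>0$ and $\lambda\in\mathbb R$, a family $((h_j)_{j\in\mathbb Z},(g_j)_{j\in\mathbb Z})$ of locally bounded (possibly discontinuous) functions of $(\tau,z)\in\mathbb R^2$ is a hull function if for all $(\tau,z)\in\mathbb R^2$, $j\in\mathbb Z$, $$(h_j)_\tau+\lambda(h_j)_z=\alpha_0(g_j-h_j),\qquad (g_j)_\tau+\lambda(g_j)_z=2F_j(\tau,[h(\tau,\cdot)]_{j,m}(z))+\alpha_0(h_j-g_j)$$ in the viscosity sense, and for $f=h$ and for $f=g$: $f_j(\tau+1,z)=f_j(\tau,z)$; $f_j(\tau,z+1)=f_j(\tau,z)+1$; $f_{j+n}(\tau,z)=f_j(\tau,z+p)$; $f_{j+1}(\tau,z)\ge f_j(\tau,z)$; $f_j$ is non-decreasing in $z$; and for each $j$ there is a constant $C$ with $|f_j(\tau,z)-z|\le C$ for all $(\tau,z)$. If the $F_j$ do not depend on $\tau$, it is also required that $h_j,g_j$ do not depend on $\tau$. The equations in the viscosity sense mean that $u_j(\tau,y)=h_j(\tau,\lambda\tau+py)$, $\xi_j(\tau,y)=g_j(\tau,\lambda\tau+py)$ form a viscosity solution on $\mathbb R^2$ of $(u_j)_\tau=\alpha_0(\xi_j-u_j)$, $(\xi_j)_\tau=2F_j(\tau,[u(\tau,\cdot)]_{j,m}(y))+\alpha_0(u_j-\xi_j)$, $u_{j+n}(\tau,y)=u_j(\tau,y+1)$, $\xi_{j+n}(\tau,y)=\xi_j(\tau,y+1)$.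 Here a sub-solution (resp. super-solution) is a family of locally bounded upper (resp. lower) semi-continuous functions satisfying the last two relations and such that, for each $C^1$ test function $\phi$: if $u_j-\phi$ has a local maximum (resp. minimum) at $(\tau,y)$ then $\phi_\tau\le$ (resp. $\ge$) $\alpha_0(\xi_j-u_j)$ at that point; if $\xi_j-\phi$ has a local maximum (resp. minimum) at $(\tau,y)$ then $\phi_\tau\le$ (resp. $\ge$) $2F_j(\tau,[u(\tau,\cdot)]_{j,m}(y))+\alpha_0(u_j-\xi_j)$ at that point. A viscosity solution is a family whose upper semi-continuous envelopes form a sub-solution and whose lower semi-continuous envelopes form a super-solution. *)

theory Defs
  imports "HOL-Analysis.Analysis"
begin

text \<open>
  A point of the \<open>(2m+1)\<close>-dimensional space with coordinates \<open>V\<^sub>-\<^sub>m, \<dots>, V\<^sub>m\<close> is represented by a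
  function \<open>V :: int \<Rightarrow> real\<close> of which only the values at \<open>\<bar>i\<bar> \<le> m\<close> matter; the functions \<open>F j\<close>
  are required to ignore the other values (\<open>depends_on_window\<close>).  For such functions, continuity in
  the product topology of \<open>int \<Rightarrow> real\<close> is continuity in the \<open>2m+1\<close> coordinates.
\<close>

definition window :: "nat \<Rightarrow> int set" where
  "window m = {- int m..int m}"

definition depends_on_window :: "nat \<Rightarrow> (real \<Rightarrow> (int \<Rightarrow> real) \<Rightarrow> real) \<Rightarrow> bool" where
  "depends_on_window m f \<longleftrightarrow>
     (\<forall>\<tau> V W. (\<forall>i\<in>window m. V i = W i) \<longrightarrow> f \<tau> V = f \<tau> W)"

definition admissible ::
  "real \<Rightarrow> nat \<Rightarrow> nat \<Rightarrow> (int \<Rightarrow> real \<Rightarrow> (int \<Rightarrow> real) \<Rightarrow> real) \<Rightarrow> bool" where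
  "admissible \<alpha>\<^sub>0 n m F \<longleftrightarrow>
     (\<forall>j. depends_on_window m (F j)) \<and>
     (\<forall>j. continuous_on UNIV (\<lambda>(\<tau>, V). F j \<tau> V)) \<and>
     (\<exists>L. \<forall>j \<tau> V W. \<bar>F j \<tau> V - F j \<tau> W\<bar> \<le> L * L2_set (\<lambda>i. V i - W i) (window m)) \<and>
     (\<forall>j \<tau> V. \<forall>i\<in>window m. i \<noteq> 0 \<longrightarrow> mono (\<lambda>x. F j \<tau> (V(i := x)))) \<and>
     (\<forall>j \<tau> V. mono (\<lambda>x. 2 * F j \<tau> (V(0 := x)) + \<alpha>\<^sub>0 * x)) \<and>
     (\<forall>j \<tau> V. F j \<tau> (\<lambda>i. V i + 1) = F j \<tau> V) \<and>
     (\<forall>j \<tau> V. F j (\<tau> + 1) V = F j \<tau> V) \<and>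
     (\<forall>j. F (j + int n) = F j) \<and>
     (\<forall>j \<tau> V. (\<forall>i\<in>window m. V i \<le> V (i + 1)) \<longrightarrow>
        2 * F j \<tau> V + \<alpha>\<^sub>0 * V 0 \<le> 2 * F (j + 1) \<tau> (\<lambda>i. V (i + 1)) + \<alpha>\<^sub>0 * V 1)"

definition locally_bounded :: "(real \<times> real \<Rightarrow> real) \<Rightarrow> bool" where
  "locally_bounded f \<longleftrightarrow> (\<forall>x. \<exists>e>0. bounded (f ` ball x e))"

definition upper_semicontinuous :: "(real \<times> real \<Rightarrow> real) \<Rightarrow> bool" where
  "upper_semicontinuous f \<longleftrightarrow> (\<forall>x c. f x < c \<longrightarrow> (\<forall>\<^sub>F y in nhds x. f y < c))"

definition lower_semicontinuous :: "(real \<times> real \<Rightarrow> real) \<Rightarrow> bool" where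
  "lower_semicontinuous f \<longleftrightarrow> (\<forall>x c. c < f x \<longrightarrow> (\<forall>\<^sub>F y in nhds x. c < f y))"

text \<open>
  The semi-continuous envelopes are only meaningful for locally bounded functions: then the limits
  below are finite.  The filter \<open>nhds x\<close> includes the point \<open>x\<close> itself.
\<close>

definition usc_envelope :: "(real \<times> real \<Rightarrow> real) \<Rightarrow> real \<times> real \<Rightarrow> real" where
  "usc_envelope f x = real_of_ereal (Limsup (nhds x) (\<lambda>y. ereal (f y)))"

definition lsc_envelope :: "(real \<times> real \<Rightarrow> real) \<Rightarrow> real \<times> real \<Rightarrow> real" where
  "lsc_envelope f x = real_of_ereal (Liminf (nhds x) (\<lambda>y. ereal (f y)))"

definition local_max_at :: "(real \<times> real \<Rightarrow> real) \<Rightarrow> real \<times> real \<Rightarrow> bool" where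
  "local_max_at f x \<longleftrightarrow> (\<forall>\<^sub>F y in nhds x. f y \<le> f x)"

definition local_min_at :: "(real \<times> real \<Rightarrow> real) \<Rightarrow> real \<times> real \<Rightarrow> bool" where
  "local_min_at f x \<longleftrightarrow> (\<forall>\<^sub>F y in nhds x. f x \<le> f y)"

definition C1_function :: "(real \<times> real \<Rightarrow> real) \<Rightarrow> bool" where
  "C1_function \<phi> \<longleftrightarrow>
     (\<exists>D :: real \<times> real \<Rightarrow> (real \<times> real) \<Rightarrow>\<^sub>L real.
        (\<forall>x. (\<phi> has_derivative blinfun_apply (D x)) (at x)) \<and> continuous_on UNIV D)"

definition time_deriv :: "(real \<times> real \<Rightarrow> real) \<Rightarrow> real \<Rightarrow> real \<Rightarrow> real" where
  "time_deriv \<phi> \<tau> y = deriv (\<lambda>s. \<phi> (s, y)) \<tau>"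

definition quasi_periodic :: "nat \<Rightarrow> (int \<Rightarrow> real \<times> real \<Rightarrow> real) \<Rightarrow> bool" where
  "quasi_periodic n u \<longleftrightarrow> (\<forall>j \<tau> y. u (j + int n) (\<tau>, y) = u j (\<tau>, y + 1))"

text \<open>
  The vector \<open>[u(\<tau>,\<cdot>)]\<^sub>j\<^sub>,\<^sub>m(y)\<close> is written \<open>\<lambda>i. u (j + i) (\<tau>, y)\<close>.
\<close>

definition visc_subsolution ::
  "real \<Rightarrow> nat \<Rightarrow> (int \<Rightarrow> real \<Rightarrow> (int \<Rightarrow> real) \<Rightarrow> real) \<Rightarrow>
   (int \<Rightarrow> real \<times> real \<Rightarrow> real) \<Rightarrow> (int \<Rightarrow> real \<times> real \<Rightarrow> real) \<Rightarrow> bool" where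
  "visc_subsolution \<alpha>\<^sub>0 n F u \<xi> \<longleftrightarrow>
     (\<forall>j. locally_bounded (u j) \<and> upper_semicontinuous (u j)) \<and>
     (\<forall>j. locally_bounded (\<xi> j) \<and> upper_semicontinuous (\<xi> j)) \<and>
     quasi_periodic n u \<and> quasi_periodic n \<xi> \<and>
     (\<forall>\<phi> j \<tau> y. C1_function \<phi> \<longrightarrow> local_max_at (\<lambda>x. u j x - \<phi> x) (\<tau>, y) \<longrightarrow>
        time_deriv \<phi> \<tau> y \<le> \<alpha>\<^sub>0 * (\<xi> j (\<tau>, y) - u j (\<tau>, y))) \<and>
     (\<forall>\<phi> j \<tau> y. C1_function \<phi> \<longrightarrow> local_max_at (\<lambda>x. \<xi> j x - \<phi> x) (\<tau>, y) \<longrightarrow>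
        time_deriv \<phi> \<tau> y
          \<le> 2 * F j \<tau> (\<lambda>i. u (j + i) (\<tau>, y)) + \<alpha>\<^sub>0 * (u j (\<tau>, y) - \<xi> j (\<tau>, y)))"

definition visc_supersolution ::
  "real \<Rightarrow> nat \<Rightarrow> (int \<Rightarrow> real \<Rightarrow> (int \<Rightarrow> real) \<Rightarrow> real) \<Rightarrow>
   (int \<Rightarrow> real \<times> real \<Rightarrow> real) \<Rightarrow> (int \<Rightarrow> real \<times> real \<Rightarrow> real) \<Rightarrow> bool" where
  "visc_supersolution \<alpha>\<^sub>0 n F u \<xi> \<longleftrightarrow>
     (\<forall>j. locally_bounded (u j) \<and> lower_semicontinuous (u j)) \<and>
     (\<forall>j. locally_bounded (\<xi> j) \<and> lower_semicontinuous (\<xi> j)) \<and>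
     quasi_periodic n u \<and> quasi_periodic n \<xi> \<and>
     (\<forall>\<phi> j \<tau> y. C1_function \<phi> \<longrightarrow> local_min_at (\<lambda>x. u j x - \<phi> x) (\<tau>, y) \<longrightarrow>
        time_deriv \<phi> \<tau> y \<ge> \<alpha>\<^sub>0 * (\<xi> j (\<tau>, y) - u j (\<tau>, y))) \<and>
     (\<forall>\<phi> j \<tau> y. C1_function \<phi> \<longrightarrow> local_min_at (\<lambda>x. \<xi> j x - \<phi> x) (\<tau>, y) \<longrightarrow>
        time_deriv \<phi> \<tau> y
          \<ge> 2 * F j \<tau> (\<lambda>i. u (j + i) (\<tau>, y)) + \<alpha>\<^sub>0 * (u j (\<tau>, y) - \<xi> j (\<tau>, y)))"

text \<open>
  Local boundedness of the family itself is required so that the envelopes are the genuine ones.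
\<close>

definition visc_solution ::
  "real \<Rightarrow> nat \<Rightarrow> (int \<Rightarrow> real \<Rightarrow> (int \<Rightarrow> real) \<Rightarrow> real) \<Rightarrow>
   (int \<Rightarrow> real \<times> real \<Rightarrow> real) \<Rightarrow> (int \<Rightarrow> real \<times> real \<Rightarrow> real) \<Rightarrow> bool" where
  "visc_solution \<alpha>\<^sub>0 n F u \<xi> \<longleftrightarrow>
     (\<forall>j. locally_bounded (u j) \<and> locally_bounded (\<xi> j)) \<and>
     visc_subsolution \<alpha>\<^sub>0 n F (\<lambda>j. usc_envelope (u j)) (\<lambda>j. usc_envelope (\<xi> j)) \<and>
     visc_supersolution \<alpha>\<^sub>0 n F (\<lambda>j. lsc_envelope (u j)) (\<lambda>j. lsc_envelope (\<xi> j))"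

definition hull_profile :: "nat \<Rightarrow> real \<Rightarrow> (int \<Rightarrow> real \<times> real \<Rightarrow> real) \<Rightarrow> bool" where
  "hull_profile n p f \<longleftrightarrow>
     (\<forall>j. locally_bounded (f j)) \<and>
     (\<forall>j \<tau> z. f j (\<tau> + 1, z) = f j (\<tau>, z)) \<and>
     (\<forall>j \<tau> z. f j (\<tau>, z + 1) = f j (\<tau>, z) + 1) \<and>
     (\<forall>j \<tau> z. f (j + int n) (\<tau>, z) = f j (\<tau>, z + p)) \<and>
     (\<forall>j \<tau> z. f j (\<tau>, z) \<le> f (j + 1) (\<tau>, z)) \<and>
     (\<forall>j \<tau>. mono (\<lambda>z. f j (\<tau>, z))) \<and>
     (\<forall>j. \<exists>C. \<forall>\<tau> z. \<bar>f j (\<tau>, z) - z\<bar> \<le> C)"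

definition time_independent :: "(int \<Rightarrow> real \<times> real \<Rightarrow> real) \<Rightarrow> bool" where
  "time_independent f \<longleftrightarrow> (\<forall>j \<tau> \<tau>' z. f j (\<tau>, z) = f j (\<tau>', z))"

definition hull_function ::
  "real \<Rightarrow> nat \<Rightarrow> (int \<Rightarrow> real \<Rightarrow> (int \<Rightarrow> real) \<Rightarrow> real) \<Rightarrow> real \<Rightarrow> real \<Rightarrow>
   (int \<Rightarrow> real \<times> real \<Rightarrow> real) \<Rightarrow> (int \<Rightarrow> real \<times> real \<Rightarrow> real) \<Rightarrow> bool" where
  "hull_function \<alpha>\<^sub>0 n F p l h g \<longleftrightarrow>
     visc_solution \<alpha>\<^sub>0 n F
       (\<lambda>j (\<tau>, y). h j (\<tau>, l * \<tau> + p * y)) (\<lambda>j (\<tau>, y). g j (\<tau>, l * \<tau> + p * y)) \<and>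
     hull_profile n p h \<and> hull_profile n p g \<and>
     ((\<forall>j \<tau> \<tau>' V. F j \<tau> V = F j \<tau>' V) \<longrightarrow> time_independent h \<and> time_independent g)"

text \<open>
  The value is meaningful only where existence and uniqueness of \<open>l\<close> hold.
\<close>

definition effective_hamiltonian ::
  "real \<Rightarrow> nat \<Rightarrow> (int \<Rightarrow> real \<Rightarrow> (int \<Rightarrow> real) \<Rightarrow> real) \<Rightarrow> real \<Rightarrow> real" where
  "effective_hamiltonian \<alpha>\<^sub>0 n F p = (THE l. \<exists>h g. hull_function \<alpha>\<^sub>0 n F p l h g)"

end

theory Submission
  imports Defs
begin

text \<open>
  No derivative in \<open>y\<close> occurs in the equations, so for fixed \<open>y\<close> they are an infinite system of
  ordinary differential equations for the chain \<open>(u\<^sub>j, \<xi>\<^sub>j)\<close>.  By the monotonicity hypotheses on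
  \<open>F\<^sub>j\<close> this system has the form \<open>x' = Q t x - \<alpha>\<^sub>0 x\<close> with \<open>Q\<close> nondecreasing in every coordinate of \<open>x\<close>.  Its evolution
  therefore exists, preserves the order, commutes with adding an integer and with shifting the index
  by \<open>n\<close>, and, by the hypothesis that compares \<open>F\<^sub>j\<close> with \<open>F\<^sub>j\<^sub>+\<^sub>1\<close>, preserves the set of chains that are
  nondecreasing in \<open>j\<close>.

  Start the chain from the straight line with \<open>j\<close>-th entry \<open>z + p j / n\<close>.  The entry at the origin,
  as a function of \<open>z\<close>, is nondecreasing and commutes with unit translations, so it differs from a
  translation by at most \<open>1\<close>; together with the symmetries this shows that the chain stays within a
  bounded distance, locally uniform in \<open>p\<close>, of a moving line (\<open>evol_line_near\<close>).  Hence the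
  displacement is additive in time up to a bounded error, and it has a mean speed \<open>l\<close> with bounded
  deviation (\<open>rotation_exists\<close>, \<open>rotation_drift\<close>), exactly as for the rotation number of a circle map.

  In the frame moving with speed \<open>l\<close> the evolved lines stay bounded.  Their upper limit is a profile
  that the evolution can only increase, and pushing it forward indefinitely gives an increasing
  bounded family whose limit is invariant (\<open>invariant_profile_exists\<close>).  Along each line
  \<open>z = l \<tau> + p y\<close> the invariant profile is a classical orbit for all times, and so are its
  one-sided limits in \<open>y\<close>, which are its semicontinuous envelopes.  Viscosity tests then
  reduce to the classical equation (\<open>hull_function_from_invariant_profile\<close>).

  Conversely, if a hull function has speed \<open>l'\<close>, its envelopes are squeezed between evolved lines
  for all positive times by comparison between a viscosity subsolution and classical solutions
  (\<open>viscosity_comparison\<close>); since the former move with speed \<open>l'\<close> and the latter with speed \<open>l\<close>, the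
  two speeds agree (\<open>hull_function_rate\<close>).  Finally, the displacement at time \<open>k\<close> divided by \<open>k\<close> is
  continuous in \<open>p\<close> and converges to the speed locally uniformly in \<open>p\<close>, so the speed is continuous
  (\<open>rotation_continuous\<close>).
\<close>

section \<open>The order-preserving evolution of a cooperative system\<close>

text \<open>
  Telescoping against a geometric series; the explicit rate is what makes the limit of the Picard iterates uniform.
\<close>
lemma geometric_steps_limit:
  fixes f :: "nat \<Rightarrow> real"
  assumes "\<And>k. \<bar>f (Suc k) - f k\<bar> \<le> D / 2 ^ k"
  shows "f \<longlonglongrightarrow> lim f" and "\<bar>f k - lim f\<bar> \<le> 2 * D / 2 ^ k"
proof -
  have tail: "\<bar>f (k + l) - f k\<bar> \<le> 2 * D / 2 ^ k - 2 * D / 2 ^ (k + l)" for k l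
  proof (induction l)
    case (Suc l)
    have "2 * D / 2 ^ (k + l) - 2 * D / 2 ^ (k + Suc l) = D / 2 ^ (k + l)"
      by (simp add: field_simps)
    then show ?case using Suc assms[of "k + l"] by simp
  qed simp
  have D: "D \<ge> 0" using assms[of 0] by simp
  have "Cauchy f"
  proof (rule metric_CauchyI)
    fix e :: real assume "e > 0"
    have "(\<lambda>k. 4 * D * (1/2) ^ k) \<longlonglongrightarrow> 4 * D * 0"
      by (intro tendsto_mult tendsto_const LIMSEQ_power_zero) simp
    then obtain N where N: "4 * D * (1/2) ^ N < e"
      using \<open>e > 0\<close> by (metis (no_types, lifting) eventually_sequentially le_refl mult_zero_right order_tendstoD(2))
    have near: "\<bar>f k - f N\<bar> \<le> 2 * D / 2 ^ N" if "k \<ge> N" for k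
    proof -
      have "2 * D / 2 ^ (N + (k - N)) \<ge> 0" using D by simp
      then show ?thesis using tail[of N "k - N"] that by simp
    qed
    have e: "2 * (2 * D / 2 ^ N) < e" using N by (simp add: power_one_over field_simps)
    show "\<exists>M. \<forall>m\<ge>M. \<forall>n\<ge>M. dist (f m) (f n) < e"
    proof (intro exI allI impI)
      fix m n assume "N \<le> m" "N \<le> n"
      then show "dist (f m) (f n) < e" using near[of m] near[of n] e unfolding dist_real_def by linarith
    qed
  qed
  then show lim: "f \<longlonglongrightarrow> lim f" by (simp add: Cauchy_convergent_iff convergent_LIMSEQ_iff)
  have "(\<lambda>l. \<bar>f k - f (k + l)\<bar>) \<longlonglongrightarrow> \<bar>f k - lim f\<bar>"
    using LIMSEQ_ignore_initial_segment[OF lim, of k] 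
    by (intro tendsto_intros) (simp add: add.commute)
  moreover have "\<bar>f k - f (k + l)\<bar> \<le> 2 * D / 2 ^ k" for l
  proof -
    have "2 * D / 2 ^ (k + l) \<ge> 0" using D by simp
    then show ?thesis using tail[of l k] tail[of k l] by linarith
  qed
  ultimately show "\<bar>f k - lim f\<bar> \<le> 2 * D / 2 ^ k" by (meson LIMSEQ_le_const2)
qed

lemma exp_integral:
  fixes c s t :: real
  assumes "c \<noteq> 0" "s \<le> t"
  shows "((\<lambda>r. exp (c * (r - s))) has_integral (exp (c * (t - s)) - 1) / c) {s..t}"
proof -
  have "((\<lambda>r. exp (c * (r - s))) has_integral (exp (c * (t - s)) / c - exp (c * (s - s)) / c)) {s..t}"
    using assms by (intro fundamental_theorem_of_calculus)
      (auto intro!: derivative_eq_intros simp flip: has_real_derivative_iff_has_vector_derivative)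
  then show ?thesis by (simp add: diff_divide_distrib)
qed

text \<open>
  The system is \<open>x' = Q t x - a x\<close>.  Absorbing \<open>a x\<close> into \<open>Q\<close> turns cooperativity (monotone in the
  other coordinates only) into monotonicity in all coordinates.  The weight \<open>w\<close> allows states with
  unbounded entries and tends to infinity, so that bounded pointwise convergence is convergence in
  the weighted norm.  The Lipschitz bound for the constant weight gives in addition control in
  the plain supremum norm.
\<close>
locale cooperative_system =
  fixes Q :: "real \<Rightarrow> ('i \<Rightarrow> real) \<Rightarrow> 'i \<Rightarrow> real" and a K :: real and w :: "'i \<Rightarrow> real"
  assumes a_pos: "a > 0" and K_pos: "K > 0" and w_pos: "\<And>i. w i > 0"
    and w_proper: "\<And>c. finite {i. w i \<le> c}"
    and Q_cont: "\<And>S Y i. (\<And>i. continuous_on S (\<lambda>t. Y t i)) \<Longrightarrow> continuous_on S (\<lambda>t. Q t (Y t) i)"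
    and Q_mono: "\<And>x y t i. (\<And>i. x i \<le> y i) \<Longrightarrow> Q t x i \<le> Q t y i"
    and Q_lip_w: "\<And>x y D t i. (\<And>i. \<bar>x i - y i\<bar> \<le> D * w i) \<Longrightarrow> \<bar>Q t x i - Q t y i\<bar> \<le> K * D * w i"
    and Q_lip_1: "\<And>x y D t i. (\<And>i. \<bar>x i - y i\<bar> \<le> D) \<Longrightarrow> \<bar>Q t x i - Q t y i\<bar> \<le> K * D"
    and Q_zero: "\<exists>B. \<forall>t i. \<bar>Q t (\<lambda>_. 0) i\<bar> \<le> B * w i"
begin

text \<open>
  The weights in whose supremum norm the field is \<open>K\<close>-Lipschitz.
\<close>
definition tame :: "('i \<Rightarrow> real) \<Rightarrow> bool" where
  "tame W \<longleftrightarrow> (\<forall>i. W i > 0) \<and>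
     (\<forall>x y D t i. (\<forall>i. \<bar>x i - y i\<bar> \<le> D * W i) \<longrightarrow> \<bar>Q t x i - Q t y i\<bar> \<le> K * D * W i)"

lemma tame_w: "tame w" and tame_1: "tame (\<lambda>_. 1)"
  using w_pos Q_lip_w Q_lip_1 by (auto simp: tame_def)

definition dominated :: "('i \<Rightarrow> real) \<Rightarrow> bool" where
  "dominated x \<longleftrightarrow> (\<exists>B. \<forall>i. \<bar>x i\<bar> \<le> B * w i)"

definition continuous_from :: "real \<Rightarrow> (real \<Rightarrow> 'i \<Rightarrow> real) \<Rightarrow> bool" where
  "continuous_from s Y \<longleftrightarrow> (\<forall>i T. continuous_on {s..T} (\<lambda>t. Y t i))"

text \<open>
  The integrated equation, with the factor \<open>exp (a t)\<close>: in this form the right-hand side is monotone in the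
  initial state and in the trajectory.
\<close>
definition duhamel :: "real \<Rightarrow> ('i \<Rightarrow> real) \<Rightarrow> (real \<Rightarrow> 'i \<Rightarrow> real) \<Rightarrow> real \<Rightarrow> 'i \<Rightarrow> real" where
  "duhamel s x Y t i =
     exp (- (a * (t - s))) * (x i + integral {s..t} (\<lambda>r. exp (a * (r - s)) * Q r (Y r) i))"

lemma duhamel_start: "duhamel s x Y s i = x i"
  by (simp add: duhamel_def)

lemma integrand_continuous:
  "continuous_from s Y \<Longrightarrow> continuous_on {s..t} (\<lambda>r. exp (a * (r - s)) * Q r (Y r) i)"
  unfolding continuous_from_def by (intro continuous_intros Q_cont) auto

lemma integrand_integrable:
  "continuous_from s Y \<Longrightarrow> (\<lambda>r. exp (a * (r - s)) * Q r (Y r) i) integrable_on {s..t}"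
  by (rule integrable_continuous_real[OF integrand_continuous])

lemma continuous_from_duhamel:
  assumes "continuous_from s Y"
  shows "continuous_from s (duhamel s x Y)"
  unfolding continuous_from_def duhamel_def
  by (intro allI continuous_intros indefinite_integral_continuous_1 integrand_integrable assms)

lemma duhamel_mono:
  assumes "continuous_from s Y" "continuous_from s Y'" "\<And>i. x i \<le> x' i"
    and "\<And>r i. s \<le> r \<Longrightarrow> Y r i \<le> Y' r i"
  shows "duhamel s x Y t i \<le> duhamel s x' Y' t i"
  unfolding duhamel_def
  using assms by (intro mult_left_mono add_mono integral_le integrand_integrable Q_mono) auto

text \<open>
  Measured with the growing factor \<open>exp (2 K t)\<close>, the integral gains a factor \<open>1 / 2\<close>.  This
  estimate gives convergence of the Picard iteration, uniqueness, and, with \<open>D = 2 D\<^sub>0\<close>, a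
  bound that every iterate inherits and hence the Lipschitz dependence on the initial state.
\<close>
lemma duhamel_lipschitz:
  assumes W: "tame W" and Y: "continuous_from s Y" "continuous_from s Y'"
    and x: "\<And>i. \<bar>x i - x' i\<bar> \<le> D\<^sub>0 * W i" and t: "s \<le> t"
    and D: "\<And>r i. s \<le> r \<Longrightarrow> \<bar>Y r i - Y' r i\<bar> \<le> D * exp (2 * K * (r - s)) * W i"
  shows "\<bar>duhamel s x Y t i - duhamel s x' Y' t i\<bar> \<le> (D\<^sub>0 + D / 2) * exp (2 * K * (t - s)) * W i"
proof -
  define E where "E = exp (2 * K * (t - s))"
  let ?I = "\<lambda>Y. integral {s..t} (\<lambda>r. exp (a * (r - s)) * Q r (Y r) i)"
  have Wi: "W i > 0" using W by (auto simp: tame_def)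
  have D0: "D\<^sub>0 \<ge> 0" using x[of i] Wi by (smt (verit) mult_nonneg_nonneg zero_le_mult_iff)
  have D_nonneg: "D \<ge> 0" using D[of s i] Wi by (smt (verit) exp_gt_zero zero_le_mult_iff)
  have E1: "E \<ge> 1" using t K_pos by (simp add: E_def)
  have ptw: "norm (exp (a * (r - s)) * Q r (Y r) i - exp (a * (r - s)) * Q r (Y' r) i)
      \<le> exp (a * (t - s)) * (K * D * W i) * exp (2 * K * (r - s))" if r: "r \<in> {s..t}" for r
  proof -
    have "\<bar>Q r (Y r) i - Q r (Y' r) i\<bar> \<le> K * (D * exp (2 * K * (r - s))) * W i"
      using W D r unfolding tame_def by auto
    moreover have "exp (a * (r - s)) \<le> exp (a * (t - s))" using r a_pos by simp
    ultimately have "exp (a * (r - s)) * \<bar>Q r (Y r) i - Q r (Y' r) i\<bar>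
       \<le> exp (a * (t - s)) * (K * (D * exp (2 * K * (r - s))) * W i)"
      by (intro mult_mono) auto
    moreover have "norm (exp (a * (r - s)) * Q r (Y r) i - exp (a * (r - s)) * Q r (Y' r) i)
        = exp (a * (r - s)) * \<bar>Q r (Y r) i - Q r (Y' r) i\<bar>"
      by (simp add: abs_mult flip: right_diff_distrib)
    ultimately show ?thesis by (simp only: mult_ac)
  qed
  have "((\<lambda>r. exp (a * (t - s)) * (K * D * W i) * exp (2 * K * (r - s))) has_integral
      exp (a * (t - s)) * (K * D * W i) * ((E - 1) / (2 * K))) {s..t}"
    unfolding E_def using K_pos t by (intro has_integral_mult_right exp_integral) auto
  note bound = has_integral_integrable[OF this] integral_unique[OF this]
  have "?I Y - ?I Y' = integral {s..t} (\<lambda>r. exp (a * (r - s)) * Q r (Y r) i - exp (a * (r - s)) * Q r (Y' r) i)"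
    by (intro integral_diff[symmetric] integrand_integrable Y)
  also have "norm \<dots> \<le> exp (a * (t - s)) * (K * D * W i) * ((E - 1) / (2 * K))"
    unfolding bound(2)[symmetric]
    by (intro integral_norm_bound_integral ptw bound(1) integrable_diff integrand_integrable Y)
  finally have "norm (?I Y - ?I Y') \<le> exp (a * (t - s)) * (K * D * W i) * ((E - 1) / (2 * K))" .
  also have "\<dots> = exp (a * (t - s)) * (D / 2 * (E - 1) * W i)"
    using K_pos by (simp add: field_simps)
  finally have "exp (- (a * (t - s))) * \<bar>?I Y - ?I Y'\<bar>
      \<le> exp (- (a * (t - s))) * (exp (a * (t - s)) * (D / 2 * (E - 1) * W i))"
    by (intro mult_left_mono) auto
  also have "\<dots> = (exp (- (a * (t - s))) * exp (a * (t - s))) * (D / 2 * (E - 1) * W i)" by simp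
  also have "\<dots> = D / 2 * (E - 1) * W i" by (simp flip: exp_add)
  finally have I: "exp (- (a * (t - s))) * \<bar>?I Y - ?I Y'\<bar> \<le> D / 2 * (E - 1) * W i" .
  have e1: "exp (- (a * (t - s))) \<le> 1" using t a_pos by simp
  have "exp (- (a * (t - s))) * \<bar>x i - x' i\<bar> \<le> 1 * (D\<^sub>0 * W i)"
    using e1 by (intro mult_mono x) auto
  also have "\<dots> \<le> E * (D\<^sub>0 * W i)"
    using E1 D0 Wi by (intro mult_right_mono) auto
  finally have X: "exp (- (a * (t - s))) * \<bar>x i - x' i\<bar> \<le> E * (D\<^sub>0 * W i)" .
  have "\<bar>duhamel s x Y t i - duhamel s x' Y' t i\<bar>
      = exp (- (a * (t - s))) * \<bar>(x i - x' i) + (?I Y - ?I Y')\<bar>"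
    by (simp only: duhamel_def right_diff_distrib[symmetric] abs_mult add_diff_add abs_exp_cancel)
  also have "\<dots> \<le> exp (- (a * (t - s))) * (\<bar>x i - x' i\<bar> + \<bar>?I Y - ?I Y'\<bar>)"
    by (intro mult_left_mono abs_triangle_ineq) auto
  also have "\<dots> \<le> E * (D\<^sub>0 * W i) + D / 2 * (E - 1) * W i"
    using X I by (simp add: distrib_left)
  also have "\<dots> \<le> (D\<^sub>0 + D / 2) * E * W i"
    using D_nonneg Wi by (simp add: algebra_simps)
  finally show ?thesis unfolding E_def .
qed

primrec picard :: "real \<Rightarrow> ('i \<Rightarrow> real) \<Rightarrow> nat \<Rightarrow> real \<Rightarrow> 'i \<Rightarrow> real" where
  "picard s x 0 = (\<lambda>t. x)"
| "picard s x (Suc k) = duhamel s x (picard s x k)"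

definition evol :: "real \<Rightarrow> real \<Rightarrow> ('i \<Rightarrow> real) \<Rightarrow> 'i \<Rightarrow> real" where
  "evol s t x i = lim (\<lambda>k. picard s x k t i)"

lemma continuous_from_picard: "continuous_from s (picard s x k)"
proof (induction k)
  case 0 then show ?case by (simp add: continuous_from_def)
qed (simp add: continuous_from_duhamel)

lemma Q_dominated: "dominated x \<Longrightarrow> \<exists>B. \<forall>t i. \<bar>Q t x i\<bar> \<le> B * w i"
proof -
  assume "dominated x"
  then obtain B where B: "\<And>i. \<bar>x i\<bar> \<le> B * w i" by (auto simp: dominated_def)
  obtain B' where B': "\<And>t i. \<bar>Q t (\<lambda>_. 0) i\<bar> \<le> B' * w i" using Q_zero by auto
  have "\<bar>Q t x i\<bar> \<le> (K * B + B') * w i" for t i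
    using Q_lip_w[of x "\<lambda>_. 0" B t i] B B'[of t i] by (simp add: algebra_simps)
  then show ?thesis by blast
qed

lemma first_picard_step:
  assumes "dominated x"
  obtains D where "\<And>s t i. s \<le> t \<Longrightarrow> \<bar>picard s x 1 t i - x i\<bar> \<le> D * exp (2 * K * (t - s)) * w i"
proof -
  obtain B where B: "\<And>i. \<bar>x i\<bar> \<le> B * w i" using assms by (auto simp: dominated_def)
  obtain B' where B': "\<And>t i. \<bar>Q t x i\<bar> \<le> B' * w i" using Q_dominated[OF assms] by auto
  have "\<bar>picard s x 1 t i - x i\<bar> \<le> (B + B' / a) * exp (2 * K * (t - s)) * w i" if t: "s \<le> t" for s t i
  proof -
    have Bw: "B * w i \<ge> 0" "B' * w i \<ge> 0" using B[of i] B'[of 0 i] by linarith+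
    let ?I = "integral {s..t} (\<lambda>r. exp (a * (r - s)) * Q r x i)"
    have "((\<lambda>r. (B' * w i) * exp (a * (r - s))) has_integral
        (B' * w i) * ((exp (a * (t - s)) - 1) / a)) {s..t}"
      using a_pos t by (intro has_integral_mult_right exp_integral) auto
    then have "norm ?I \<le> (B' * w i) * ((exp (a * (t - s)) - 1) / a)"
      using B' integrand_integrable[OF continuous_from_picard[of s x 0], of i t]
      by (intro integral_norm_bound_integral[where g = "\<lambda>r. (B' * w i) * exp (a * (r - s))", THEN order_trans])
         (auto simp: has_integral_iff abs_mult mult.commute)
    also have "\<dots> \<le> (B' * w i) * (exp (a * (t - s)) / a)"
      using Bw a_pos by (intro mult_left_mono divide_right_mono) auto
    finally have "exp (- (a * (t - s))) * \<bar>?I\<bar>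
        \<le> exp (- (a * (t - s))) * ((B' * w i) * (exp (a * (t - s)) / a))"
      by (intro mult_left_mono) auto
    also have "\<dots> = (exp (- (a * (t - s))) * exp (a * (t - s))) * (B' / a * w i)" by simp
    also have "\<dots> = B' / a * w i" by (simp flip: exp_add)
    finally have I: "exp (- (a * (t - s))) * \<bar>?I\<bar> \<le> B' / a * w i" .
    have e1: "exp (- (a * (t - s))) \<le> 1" "exp (- (a * (t - s))) > 0" using t a_pos by simp_all
    have "\<bar>picard s x 1 t i - x i\<bar> = \<bar>exp (- (a * (t - s))) * ?I - (1 - exp (- (a * (t - s)))) * x i\<bar>"
      by (simp add: duhamel_def algebra_simps)
    also have "\<dots> \<le> \<bar>exp (- (a * (t - s))) * ?I\<bar> + \<bar>(1 - exp (- (a * (t - s)))) * x i\<bar>"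
      by (rule abs_triangle_ineq4)
    also have "\<dots> = exp (- (a * (t - s))) * \<bar>?I\<bar> + (1 - exp (- (a * (t - s)))) * \<bar>x i\<bar>"
      using e1 by (simp add: abs_mult)
    also have "\<dots> \<le> B' / a * w i + 1 * (B * w i)"
      using e1 by (intro add_mono I mult_mono B) auto
    also have "\<dots> = (B + B' / a) * w i * 1" by (simp add: algebra_simps)
    also have "\<dots> \<le> (B + B' / a) * w i * exp (2 * K * (t - s))"
    proof (rule mult_left_mono)
      show "0 \<le> (B + B' / a) * w i" using Bw a_pos by (simp add: distrib_right)
    qed (use t K_pos in simp)
    finally show ?thesis by (simp add: mult_ac)
  qed
  then show thesis using that by blast
qed

lemma picard_to_evol:
  assumes "dominated x"
  obtains D where
    "\<And>s t i k. s \<le> t \<Longrightarrow> \<bar>picard s x k t i - evol s t x i\<bar> \<le> 2 * (D * exp (2 * K * (t - s)) * w i) / 2 ^ k"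
    and "\<And>s t i. s \<le> t \<Longrightarrow> (\<lambda>k. picard s x k t i) \<longlonglongrightarrow> evol s t x i"
proof -
  obtain D where D: "\<And>s t i. s \<le> t \<Longrightarrow> \<bar>picard s x 1 t i - x i\<bar> \<le> D * exp (2 * K * (t - s)) * w i"
    using first_picard_step[OF assms] by blast
  have steps: "\<bar>picard s x (Suc k) t i - picard s x k t i\<bar> \<le> D / 2 ^ k * exp (2 * K * (t - s)) * w i"
    if "s \<le> t" for s t i k
    using that
  proof (induction k arbitrary: t i)
    case 0 then show ?case using D by auto
  next
    case (Suc k)
    have "\<bar>duhamel s x (picard s x (Suc k)) t i - duhamel s x (picard s x k) t i\<bar>
       \<le> (0 + D / 2 ^ k / 2) * exp (2 * K * (t - s)) * w i"
      using Suc by (intro duhamel_lipschitz continuous_from_picard tame_w) auto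
    then show ?case by (simp add: mult.commute)
  qed
  have "\<bar>picard s x (Suc k) t i - picard s x k t i\<bar> \<le> (D * exp (2 * K * (t - s)) * w i) / 2 ^ k"
    if "s \<le> t" for s t i k
    using steps[OF that, of k i] by simp
  note lim = geometric_steps_limit[OF this]
  show thesis
    by (rule that[of D]; unfold evol_def; rule lim)
qed

lemma evol_limit:
  "dominated x \<Longrightarrow> s \<le> t \<Longrightarrow> (\<lambda>k. picard s x k t i) \<longlonglongrightarrow> evol s t x i"
  using picard_to_evol by metis

lemma evol_bound:
  assumes "dominated x"
  obtains B where "\<And>s t i. s \<le> t \<Longrightarrow> \<bar>evol s t x i\<bar> \<le> B * exp (2 * K * (t - s)) * w i"
proof -
  obtain D where D: "\<And>s t i k. s \<le> t \<Longrightarrow>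
      \<bar>picard s x k t i - evol s t x i\<bar> \<le> 2 * (D * exp (2 * K * (t - s)) * w i) / 2 ^ k"
    using picard_to_evol[OF assms] by metis
  obtain B where B: "\<And>i. \<bar>x i\<bar> \<le> B * w i" using assms by (auto simp: dominated_def)
  have "\<bar>evol s t x i\<bar> \<le> (B + 2 * D) * exp (2 * K * (t - s)) * w i" if t: "s \<le> t" for s t i
  proof -
    have "0 \<le> B * w i" using B[of i] by linarith
    moreover have "exp (2 * K * (t - s)) \<ge> 1" using t K_pos by simp
    ultimately have "B * w i \<le> B * w i * exp (2 * K * (t - s))"
      using mult_left_mono[of 1 "exp (2 * K * (t - s))" "B * w i"] by simp
    then show ?thesis using D[OF t, where k = 0, of i] B[of i] by (simp add: algebra_simps)
  qed
  then show thesis using that by blast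
qed

lemma dominated_evol:
  assumes "dominated x" "s \<le> t"
  shows "dominated (evol s t x)"
  using evol_bound[OF assms(1)] assms(2) unfolding dominated_def by metis

lemma continuous_from_evol:
  assumes "dominated x"
  shows "continuous_from s (\<lambda>t. evol s t x)"
  unfolding continuous_from_def
proof (intro allI)
  fix i T
  obtain D where D: "\<And>s t i k. s \<le> t \<Longrightarrow>
      \<bar>picard s x k t i - evol s t x i\<bar> \<le> 2 * (D * exp (2 * K * (t - s)) * w i) / 2 ^ k"
    using picard_to_evol[OF assms] by metis
  let ?b = "\<lambda>k::nat. 2 * (\<bar>D\<bar> * exp (2 * K * (T - s)) * w i) * (1 / 2) ^ k"
  have b: "?b \<longlonglongrightarrow> 2 * (\<bar>D\<bar> * exp (2 * K * (T - s)) * w i) * 0"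
    by (intro tendsto_mult tendsto_const LIMSEQ_power_zero) simp
  have "uniform_limit {s..T} (\<lambda>k t. picard s x k t i) (\<lambda>t. evol s t x i) sequentially"
  proof (rule uniform_limitI)
    fix e :: real assume "e > 0"
    then have "\<forall>\<^sub>F k in sequentially. ?b k < e"
      using order_tendstoD(2)[OF b] by simp
    then show "\<forall>\<^sub>F k in sequentially. \<forall>t\<in>{s..T}. dist (picard s x k t i) (evol s t x i) < e"
    proof (rule eventually_mono, intro ballI)
      fix k t assume k: "?b k < e" and t: "t \<in> {s..T}"
      have "D * exp (2 * K * (t - s)) * w i \<le> \<bar>D\<bar> * exp (2 * K * (T - s)) * w i"
        using t K_pos w_pos[of i] by (intro mult_mono) auto
      then have "2 * (D * exp (2 * K * (t - s)) * w i) / 2 ^ k \<le> ?b k"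
        by (simp add: power_one_over field_simps)
      then show "dist (picard s x k t i) (evol s t x i) < e"
        using D[of s t k i] t k by (auto simp: dist_real_def)
    qed
  qed
  then show "continuous_on {s..T} (\<lambda>t. evol s t x i)"
    using continuous_from_picard[of s x] unfolding continuous_from_def
    by (rule_tac uniform_limit_theorem) (auto intro: always_eventually)
qed

lemma vanishing_by_halving:
  fixes d :: real
  assumes "\<And>k::nat. \<bar>d\<bar> \<le> C / 2 ^ k"
  shows "d = 0"
proof -
  have "(\<lambda>k::nat. C * (1 / 2) ^ k) \<longlonglongrightarrow> C * 0"
    by (intro tendsto_mult tendsto_const LIMSEQ_power_zero) simp
  then have "\<bar>d\<bar> \<le> C * 0"
    using assms by (intro LIMSEQ_le_const) (auto simp: power_one_over field_simps)
  then show ?thesis by simp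
qed

lemma evol_fixpoint:
  assumes "dominated x" "s \<le> t"
  shows "evol s t x i = duhamel s x (\<lambda>r. evol s r x) t i"
proof -
  obtain D where D: "\<And>s t i k. s \<le> t \<Longrightarrow>
      \<bar>picard s x k t i - evol s t x i\<bar> \<le> 2 * (D * exp (2 * K * (t - s)) * w i) / 2 ^ k"
    using picard_to_evol[OF assms(1)] by metis
  have "\<bar>evol s t x i - duhamel s x (\<lambda>r. evol s r x) t i\<bar>
      \<le> 2 * (D * exp (2 * K * (t - s)) * w i) / 2 ^ k" for k
  proof -
    have "\<bar>duhamel s x (picard s x k) t i - duhamel s x (\<lambda>r. evol s r x) t i\<bar>
        \<le> (0 + (2 * D / 2 ^ k) / 2) * exp (2 * K * (t - s)) * w i"
      using D by (intro duhamel_lipschitz continuous_from_picard continuous_from_evol tame_w assms)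
                 (auto simp: mult.assoc)
    moreover have "\<bar>duhamel s x (picard s x k) t i - evol s t x i\<bar> \<le> 2 * (D * exp (2 * K * (t - s)) * w i) / 2 ^ Suc k"
      using D[OF assms(2), where k = "Suc k"] by simp
    moreover have "2 * (D * exp (2 * K * (t - s)) * w i) / 2 ^ Suc k + (0 + (2 * D / 2 ^ k) / 2) * exp (2 * K * (t - s)) * w i
       = 2 * (D * exp (2 * K * (t - s)) * w i) / 2 ^ k"
      by (simp add: field_simps)
    ultimately show ?thesis by linarith
  qed
  from vanishing_by_halving[OF this] show ?thesis by simp
qed

lemma evol_start: "dominated x \<Longrightarrow> evol s s x = x"
  using evol_fixpoint[of x s s] by (auto simp: duhamel_start)

lemma evol_unique:
  assumes x: "dominated x" and Y: "continuous_from s Y" and t: "s \<le> t"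
    and fix_Y: "\<And>t i. s \<le> t \<Longrightarrow> Y t i = duhamel s x Y t i"
    and bound: "\<And>t i. s \<le> t \<Longrightarrow> \<bar>Y t i\<bar> \<le> B * exp (2 * K * (t - s)) * w i"
  shows "Y t = evol s t x"
proof
  fix i
  obtain B' where B': "\<And>s t i. s \<le> t \<Longrightarrow> \<bar>evol s t x i\<bar> \<le> B' * exp (2 * K * (t - s)) * w i"
    using evol_bound[OF x] by metis
  have halving: "\<bar>Y t i - evol s t x i\<bar> \<le> (B + B') / 2 ^ k * exp (2 * K * (t - s)) * w i"
    if "s \<le> t" for k t i
    using that
  proof (induction k arbitrary: t i)
    case 0 then show ?case using bound[of t i] B'[of s t i] by (simp add: algebra_simps)
  next
    case (Suc k)
    have "\<bar>duhamel s x Y t i - duhamel s x (\<lambda>r. evol s r x) t i\<bar>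
        \<le> (0 + ((B + B') / 2 ^ k) / 2) * exp (2 * K * (t - s)) * w i"
      using Suc by (intro duhamel_lipschitz Y continuous_from_evol tame_w x) auto
    then show ?case using Suc.prems fix_Y[of t i] evol_fixpoint[OF x, of s t i] by (simp add: mult.commute)
  qed
  have "\<bar>Y t i - evol s t x i\<bar> \<le> ((B + B') * exp (2 * K * (t - s)) * w i) / 2 ^ k" for k
    using halving[OF t, of i k] by simp
  from vanishing_by_halving[OF this] show "Y t i = evol s t x i" by simp
qed

text \<open>
  A solution on \<open>[s, \<infinity>)\<close> is a solution on each later half-line; with uniqueness this is the semigroup
  property.
\<close>
lemma duhamel_restart:
  assumes Y: "continuous_from s Y" and st: "s \<le> r" "r \<le> t"
    and fix_Y: "\<And>t. s \<le> t \<Longrightarrow> Y t i = duhamel s x Y t i"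
  shows "Y t i = duhamel r (Y r) Y t i"
proof -
  have "integral {r..t} (\<lambda>q. exp (a * (q - r)) * Q q (Y q) i)
      = integral {r..t} (\<lambda>q. exp (- (a * (r - s))) * (exp (a * (q - s)) * Q q (Y q) i))"
    by (intro integral_cong) (simp add: algebra_simps flip: exp_add)
  also have "\<dots> = exp (- (a * (r - s))) * integral {r..t} (\<lambda>q. exp (a * (q - s)) * Q q (Y q) i)"
    by simp
  finally have shift: "integral {r..t} (\<lambda>q. exp (a * (q - r)) * Q q (Y q) i)
      = exp (- (a * (r - s))) * integral {r..t} (\<lambda>q. exp (a * (q - s)) * Q q (Y q) i)" .
  have split: "integral {s..t} (\<lambda>q. exp (a * (q - s)) * Q q (Y q) i)
     = integral {s..r} (\<lambda>q. exp (a * (q - s)) * Q q (Y q) i)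
       + integral {r..t} (\<lambda>q. exp (a * (q - s)) * Q q (Y q) i)"
    using Henstock_Kurzweil_Integration.integral_combine[OF st integrand_integrable[OF Y]] by simp
  have e: "exp (- (a * (t - s))) = exp (- (a * (t - r))) * exp (- (a * (r - s)))"
    by (simp add: algebra_simps flip: exp_add)
  have "Y t i = exp (- (a * (t - r))) * (exp (- (a * (r - s))) *
     (x i + integral {s..r} (\<lambda>q. exp (a * (q - s)) * Q q (Y q) i))
      + exp (- (a * (r - s))) * integral {r..t} (\<lambda>q. exp (a * (q - s)) * Q q (Y q) i))"
    using fix_Y[of t] st unfolding duhamel_def split e by (simp add: algebra_simps)
  also have "\<dots> = duhamel r (Y r) Y t i"
    using fix_Y[of r] st unfolding duhamel_def shift by simp
  finally show ?thesis .
qed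

lemma continuous_from_mono: "continuous_from s Y \<Longrightarrow> s \<le> r \<Longrightarrow> continuous_from r Y"
  unfolding continuous_from_def
  by (meson atLeastatMost_subset_iff continuous_on_subset order_refl)

lemma evol_semigroup:
  assumes x: "dominated x" and st: "s \<le> r" "r \<le> t"
  shows "evol r t (evol s r x) = evol s t x"
proof -
  obtain B where B: "\<And>s t i. s \<le> t \<Longrightarrow> \<bar>evol s t x i\<bar> \<le> B * exp (2 * K * (t - s)) * w i"
    using evol_bound[OF x] by metis
  show ?thesis
  proof (rule evol_unique[symmetric, where B = "B * exp (2 * K * (r - s))"])
    show "evol s q x i = duhamel r (evol s r x) (\<lambda>t. evol s t x) q i" if "r \<le> q" for q i
      using that st evol_fixpoint[OF x] by (intro duhamel_restart[OF continuous_from_evol[OF x]]) auto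
    show "\<bar>evol s q x i\<bar> \<le> B * exp (2 * K * (r - s)) * exp (2 * K * (q - r)) * w i" if "r \<le> q" for q i
    proof -
      have "exp (2 * K * (r - s)) * exp (2 * K * (q - r)) = exp (2 * K * (q - s))"
        by (simp add: algebra_simps flip: exp_add)
      then show ?thesis using B[of s q i] that st by (simp add: mult.assoc)
    qed
  qed (use st x in \<open>auto intro: dominated_evol continuous_from_mono[OF continuous_from_evol]\<close>)
qed

text \<open>
  Each Picard iterate is monotone in the initial state.  The symmetries below are obtained in the same way:
  they hold for every iterate.
\<close>
lemma evol_mono:
  assumes "dominated x" "dominated y" "s \<le> t" "\<And>i. x i \<le> y i"
  shows "evol s t x i \<le> evol s t y i"
proof -
  have "picard s x k t i \<le> picard s y k t i" if "s \<le> t" for k t i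
    using that
  proof (induction k arbitrary: t i)
    case (Suc k)
    then show ?case by (simp add: duhamel_mono[OF continuous_from_picard continuous_from_picard] assms(4))
  qed (simp add: assms)
  then show ?thesis using assms by (intro LIMSEQ_le[OF evol_limit evol_limit]) auto
qed

lemma evol_lipschitz:
  assumes "dominated x" "dominated y" "s \<le> t" "tame W" "\<And>i. \<bar>x i - y i\<bar> \<le> D * W i"
  shows "\<bar>evol s t x i - evol s t y i\<bar> \<le> 2 * D * exp (2 * K * (t - s)) * W i"
proof -
  have pos: "W i > 0" for i using assms(4) by (auto simp: tame_def)
  have "D \<ge> 0" using assms(5)[of i] pos[of i] by (smt (verit) zero_le_mult_iff)
  have "\<bar>picard s x k t i - picard s y k t i\<bar> \<le> 2 * D * exp (2 * K * (t - s)) * W i" if "s \<le> t" for k t i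
    using that
  proof (induction k arbitrary: t i)
    case 0
    have "D * W i * 1 \<le> D * W i * (2 * exp (2 * K * (t - s)))"
    proof (rule mult_left_mono)
      have "exp (2 * K * (t - s)) \<ge> 1" using 0 K_pos by simp
      then show "1 \<le> 2 * exp (2 * K * (t - s))" by linarith
    qed (use \<open>D \<ge> 0\<close> pos[of i] in simp)
    then show ?case using assms(5)[of i] by (simp add: mult_ac)
  next
    case (Suc k)
    have "\<bar>duhamel s x (picard s x k) t i - duhamel s y (picard s y k) t i\<bar>
        \<le> (D + (2 * D) / 2) * exp (2 * K * (t - s)) * W i"
      using Suc by (intro duhamel_lipschitz continuous_from_picard assms) auto
    then show ?case by simp
  qed
  then show ?thesis
    using assms by (intro LIMSEQ_le_const2[OF tendsto_rabs[OF tendsto_diff[OF evol_limit evol_limit]]]) auto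
qed

text \<open>
  Used with an index shift and \<open>c = 0\<close>, and with the identity and an integer \<open>c\<close>.
\<close>
lemma evol_equivariant:
  assumes x: "dominated x" "dominated (\<lambda>i. x (\<sigma> i) + c)" and t: "s \<le> t"
    and Q: "\<And>t x i. Q t (\<lambda>i. x (\<sigma> i) + c) i = Q t x (\<sigma> i) + a * c"
  shows "evol s t (\<lambda>i. x (\<sigma> i) + c) i = evol s t x (\<sigma> i) + c"
proof -
  have "picard s (\<lambda>i. x (\<sigma> i) + c) k t i = picard s x k t (\<sigma> i) + c" if "s \<le> t" for k t i
    using that
  proof (induction k arbitrary: t i)
    case (Suc k)
    have "integral {s..t} (\<lambda>r. exp (a * (r - s)) * Q r (picard s (\<lambda>i. x (\<sigma> i) + c) k r) i)
        = integral {s..t} (\<lambda>r. exp (a * (r - s)) * Q r (picard s x k r) (\<sigma> i) + (a * c) * exp (a * (r - s)))"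
    proof (rule integral_cong)
      fix r assume "r \<in> {s..t}"
      then have eq: "picard s (\<lambda>i. x (\<sigma> i) + c) k r = (\<lambda>i. picard s x k r (\<sigma> i) + c)"
        using Suc.IH by auto
      show "exp (a * (r - s)) * Q r (picard s (\<lambda>i. x (\<sigma> i) + c) k r) i
          = exp (a * (r - s)) * Q r (picard s x k r) (\<sigma> i) + (a * c) * exp (a * (r - s))"
        unfolding eq Q by (simp add: distrib_left)
    qed
    also have "\<dots> = integral {s..t} (\<lambda>r. exp (a * (r - s)) * Q r (picard s x k r) (\<sigma> i))
        + c * (exp (a * (t - s)) - 1)"
      using a_pos Suc.prems has_integral_mult_right[OF exp_integral[of a s t], of "a * c"]
      by (subst integral_add) (auto intro!: integrand_integrable continuous_from_picard simp: has_integral_iff)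
    finally have I: "integral {s..t} (\<lambda>r. exp (a * (r - s)) * Q r (picard s (\<lambda>i. x (\<sigma> i) + c) k r) i)
        = integral {s..t} (\<lambda>r. exp (a * (r - s)) * Q r (picard s x k r) (\<sigma> i))
          + c * (exp (a * (t - s)) - 1)" .
    have "e * (X + c + (J + c * (E - 1))) = e * (X + J) + c" if "e * E = 1" for e E X J :: real
      using that by algebra
    then show ?case
      unfolding picard.simps duhamel_def I by (simp flip: exp_add)
  qed simp
  then have "(\<lambda>k. picard s (\<lambda>i. x (\<sigma> i) + c) k t i) = (\<lambda>k. picard s x k t (\<sigma> i) + c)"
    using t by auto
  then show ?thesis
    using evol_limit[OF x(2) t, of i] tendsto_add[OF evol_limit[OF x(1) t, of "\<sigma> i"] tendsto_const[of c]]
    by (simp add: LIMSEQ_unique)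
qed

lemma evol_index_mono:
  assumes x: "dominated x" "\<And>i. x i \<le> x (\<sigma> i)" and t: "s \<le> t"
    and Q: "\<And>t x i. (\<And>i. x i \<le> x (\<sigma> i)) \<Longrightarrow> Q t x i \<le> Q t x (\<sigma> i)"
  shows "evol s t x i \<le> evol s t x (\<sigma> i)"
proof -
  have "picard s x k t i \<le> picard s x k t (\<sigma> i)" if "s \<le> t" for k t i
    using that
  proof (induction k arbitrary: t i)
    case (Suc k)
    then show ?case unfolding picard.simps duhamel_def
      by (intro mult_left_mono add_mono x integral_le integrand_integrable continuous_from_picard Q) auto
  qed (simp add: x)
  then show ?thesis using x t by (intro LIMSEQ_le[OF evol_limit evol_limit]) auto
qed

lemma evol_time_shift:
  assumes x: "dominated x" and t: "s \<le> t" and Q: "\<And>t. Q (t + r) = Q t"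
  shows "evol (s + r) (t + r) x = evol s t x"
proof
  fix i
  have "picard (s + r) x k (t + r) i = picard s x k t i" if "s \<le> t" for k t i
    using that
  proof (induction k arbitrary: t i)
    case (Suc k)
    let ?g = "\<lambda>q. exp (a * (q - (s + r))) * Q q (picard (s + r) x k q) i"
    have "integral {s + r..t + r} ?g = integral {s..t} (\<lambda>q. ?g (q + r))"
    proof -
      have "(?g has_integral integral {s + r..t + r} ?g) (cbox (s + r) (t + r))"
        using integrand_integrable[OF continuous_from_picard, of "s + r" x k i "t + r"] by (simp add: integrable_integral)
      from has_integral_affinity'[OF this, of 1 r] show ?thesis by (simp add: integral_unique)
    qed
    also have "\<dots> = integral {s..t} (\<lambda>q. exp (a * (q - s)) * Q q (picard s x k q) i)"
    proof (rule integral_cong)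
      fix q assume "q \<in> {s..t}"
      then have "picard (s + r) x k (q + r) = picard s x k q" using Suc.IH by auto
      then show "?g (q + r) = exp (a * (q - s)) * Q q (picard s x k q) i" by (simp add: Q)
    qed
    finally show ?case by (simp add: duhamel_def)
  qed simp
  then have "(\<lambda>k. picard (s + r) x k (t + r) i) = (\<lambda>k. picard s x k t i)" using t by auto
  then show "evol (s + r) (t + r) x i = evol s t x i" by (simp add: evol_def)
qed

lemma evol_derivative:
  assumes x: "dominated x" and t: "s < t"
  shows "((\<lambda>t. evol s t x i) has_real_derivative (Q t (evol s t x) i - a * evol s t x i)) (at t)"
proof -
  let ?g = "\<lambda>r. exp (a * (r - s)) * Q r (evol s r x) i"
  have "((\<lambda>u. integral {s..u} ?g) has_real_derivative ?g t) (at t within {s..t + 1})"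
    using t by (intro integral_has_real_derivative integrand_continuous continuous_from_evol x) auto
  then have I: "((\<lambda>u. integral {s..u} ?g) has_real_derivative ?g t) (at t)"
    using t at_within_Icc_at[of s t "t + 1"] by simp
  have "((\<lambda>t. duhamel s x (\<lambda>r. evol s r x) t i) has_real_derivative
      exp (- (a * (t - s))) * ?g t
       + - a * exp (- (a * (t - s))) * (x i + integral {s..t} ?g)) (at t)"
    unfolding duhamel_def
    by (auto intro!: derivative_eq_intros I)
  also have "exp (- (a * (t - s))) * ?g t + - a * exp (- (a * (t - s))) * (x i + integral {s..t} ?g)
     = Q t (evol s t x) i - a * evol s t x i"
    using evol_fixpoint[OF x, of s t i] t by (simp add: duhamel_def exp_minus)
  finally show ?thesis
  proof (rule DERIV_cong_ev[OF refl _ refl, THEN iffD1, rotated])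
    have "\<forall>\<^sub>F u in nhds t. u > s" using t eventually_nhds_in_open[of "{s<..}" t] by simp
    then show "\<forall>\<^sub>F u in nhds t. duhamel s x (\<lambda>r. evol s r x) u i = evol s u x i"
      by (rule eventually_mono) (use evol_fixpoint[OF x] in force)
  qed
qed

text \<open>
  Outside a finite set of indices the weight exceeds any multiple of the bound \<open>C\<close>, so bounded pointwise
  convergence is convergence in the weighted norm, in which the evolution is continuous.
\<close>
lemma evol_pointwise_limit:
  assumes X: "\<And>k. dominated (X k)" and x: "dominated x" and t: "s \<le> t"
    and lim: "\<And>i. (\<lambda>k. X k i) \<longlonglongrightarrow> x i" and C: "\<And>k i. \<bar>X k i - x i\<bar> \<le> C"
  shows "(\<lambda>k. evol s t (X k) i) \<longlonglongrightarrow> evol s t x i"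
proof (rule LIMSEQ_I)
  fix e :: real assume e: "e > 0"
  define E where "E = 2 * exp (2 * K * (t - s)) * w i"
  have E: "E > 0" using w_pos[of i] by (simp add: E_def)
  define d where "d = e / (2 * E)"
  have d: "d > 0" using e E by (simp add: d_def)
  define A where "A = {i. w i \<le> C / d}"
  have "\<forall>i\<in>A. \<forall>\<^sub>F k in sequentially. \<bar>X k i - x i\<bar> < d * w i"
    using lim d w_pos by (auto simp: tendsto_iff dist_real_def)
  then have "\<forall>\<^sub>F k in sequentially. \<forall>i\<in>A. \<bar>X k i - x i\<bar> < d * w i"
    using w_proper unfolding A_def by (intro eventually_ball_finite) auto
  then obtain N where N: "\<And>k j. k \<ge> N \<Longrightarrow> j \<in> A \<Longrightarrow> \<bar>X k j - x j\<bar> < d * w j"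
    by (auto simp: eventually_sequentially)
  have "norm (evol s t (X k) i - evol s t x i) < e" if k: "k \<ge> N" for k
  proof -
    have "\<bar>X k j - x j\<bar> \<le> d * w j" for j
    proof (cases "j \<in> A")
      case True then show ?thesis using N[OF k] by force
    next
      case False
      then have "C < d * w j" using d by (simp add: A_def field_simps)
      then show ?thesis using C[of k j] by linarith
    qed
    from evol_lipschitz[OF X x t tame_w this]
    have "\<bar>evol s t (X k) i - evol s t x i\<bar> \<le> d * E" by (simp add: E_def mult_ac)
    also have "\<dots> < e" using e E by (simp add: d_def)
    finally show ?thesis by simp
  qed
  then show "\<exists>N. \<forall>k\<ge>N. norm (evol s t (X k) i - evol s t x i) < e" by blast
qed

end

section \<open>The particle chain as a cooperative system\<close>

lemma integer_multiples_of_period: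
  fixes g :: "'a::ring_1 \<Rightarrow> 'b"
  assumes "\<And>x. g (x + p) = g x"
  shows "g (x + of_int k * p) = g x"
proof (induction k rule: int_induct[where k = 0])
  case (step1 k) then show ?case using assms[of "x + of_int k * p"] by (simp add: algebra_simps)
next
  case (step2 k) then show ?case using assms[of "x + of_int (k - 1) * p"] by (simp add: algebra_simps)
qed simp

text \<open>
  The function \<open>exp (c r) (d r - g)\<close> is nonincreasing.
\<close>
lemma derivative_barrier:
  fixes d :: "real \<Rightarrow> real"
  assumes cont: "continuous_on {s..t} d" and t: "s \<le> t" and start: "d s \<le> g"
    and deriv: "\<And>r. s < r \<Longrightarrow> r < t \<Longrightarrow> \<exists>d'. (d has_real_derivative d') (at r) \<and> d' \<le> c * (g - d r)"
  shows "d t \<le> g"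
proof (cases "s = t")
  case False
  let ?\<phi> = "\<lambda>r. exp (c * r) * (d r - g)"
  have "?\<phi> t \<le> ?\<phi> s"
  proof -
    have st: "s < t" using False t by simp
    have dphi: "\<exists>l. (?\<phi> has_real_derivative l) (at r) \<and> l \<le> 0" if r: "s < r" "r < t" for r
    proof -
      obtain d' where d': "(d has_real_derivative d') (at r)" "d' \<le> c * (g - d r)"
        using deriv[OF r] by blast
      have "(?\<phi> has_real_derivative c * exp (c * r) * (d r - g) + d' * exp (c * r)) (at r)"
        by (auto intro!: derivative_eq_intros d')
      moreover have "c * exp (c * r) * (d r - g) + d' * exp (c * r) = exp (c * r) * (d' - c * (g - d r))"
        by (simp add: algebra_simps)
      ultimately show ?thesis using d'(2) by (intro exI conjI) (auto simp: mult_le_0_iff)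
    qed
    have "continuous_on {s..t} ?\<phi>" by (intro continuous_intros cont)
    then obtain l z where z: "s < z" "z < t" "(?\<phi> has_real_derivative l) (at z)" "?\<phi> t - ?\<phi> s = (t - s) * l"
      using MVT[OF st, of ?\<phi>] dphi unfolding real_differentiable_def by blast
    moreover have "l \<le> 0" using dphi[OF z(1,2)] DERIV_unique[OF z(3)] by blast
    ultimately show ?thesis using st by (smt (verit) mult_nonneg_nonpos)
  qed
  also have "\<dots> \<le> 0" using start by (simp add: mult_le_0_iff)
  finally show ?thesis by (simp add: mult_le_0_iff)
qed (use start in simp)

locale chain =
  fixes n m :: nat and \<alpha> :: real and F :: "int \<Rightarrow> real \<Rightarrow> (int \<Rightarrow> real) \<Rightarrow> real"
  assumes n_pos: "n \<ge> 1" and \<alpha>_pos: "\<alpha> > 0" and adm: "admissible \<alpha> n m F"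
begin

lemmas adm_unfolded = adm[unfolded admissible_def depends_on_window_def]

lemma F_window: "(\<And>i. i \<in> window m \<Longrightarrow> V i = W i) \<Longrightarrow> F j \<tau> V = F j \<tau> W"
  using adm_unfolded[THEN conjunct1] by blast

lemma F_cont: "continuous_on UNIV (\<lambda>(\<tau>, V). F j \<tau> V)"
  using adm_unfolded[THEN conjunct2, THEN conjunct1] by blast

lemma F_lip: "\<exists>L. \<forall>j \<tau> V W. \<bar>F j \<tau> V - F j \<tau> W\<bar> \<le> L * L2_set (\<lambda>i. V i - W i) (window m)"
  using adm_unfolded[THEN conjunct2, THEN conjunct2, THEN conjunct1] .

lemma F_mono_coordinate: "i \<in> window m \<Longrightarrow> i \<noteq> 0 \<Longrightarrow> mono (\<lambda>x. F j \<tau> (V(i := x)))"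
  and F_mono_centre: "mono (\<lambda>x. 2 * F j \<tau> (V(0 := x)) + \<alpha> * x)"
  and F_shift_one: "F j \<tau> (\<lambda>i. V i + 1) = F j \<tau> V"
  and F_period_index: "F (j + int n) = F j"
  using adm_unfolded by blast+

lemma F_period_time: "F j (\<tau> + 1) = F j \<tau>"
  using adm_unfolded by (intro ext) blast

lemma F_ordered:
  "(\<And>i. i \<in> window m \<Longrightarrow> V i \<le> V (i + 1)) \<Longrightarrow>
     2 * F j \<tau> V + \<alpha> * V 0 \<le> 2 * F (j + 1) \<tau> (\<lambda>i. V (i + 1)) + \<alpha> * V 1"
  using adm_unfolded[THEN conjunct2, THEN conjunct2, THEN conjunct2, THEN conjunct2, THEN conjunct2,
    THEN conjunct2, THEN conjunct2, THEN conjunct2] by blast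

lemma zero_in_window: "0 \<in> window m" and finite_window: "finite (window m)"
  and card_window: "card (window m) = 2 * m + 1"
  by (auto simp: window_def)

lemma F_shift_int: "F j \<tau> (\<lambda>i. V i + of_int k) = F j \<tau> V"
  using integer_multiples_of_period[where g = "\<lambda>c. F j \<tau> (\<lambda>i. V i + c)" and p = 1 and x = 0]
    F_shift_one[of j \<tau> "\<lambda>i. V i + c" for c] by (simp add: add.assoc)

lemma F_frac: "F j (frac \<tau>) = F j \<tau>"
  using integer_multiples_of_period[where g = "F j" and p = 1 and x = "frac \<tau>" and k = "\<lfloor>\<tau>\<rfloor>"] F_period_time
  by (simp add: frac_def)

lemma F_period_index_int: "F (j + k * int n) = F j"
  using integer_multiples_of_period[where g = F and p = "int n" and x = j and k = k] F_period_index by simp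

lemma F_mod: "F (j mod int n) = F j"
  using F_period_index_int[of "j mod int n" "j div int n"] by simp

lemma F_lipschitz_exists:
  "\<exists>L\<ge>0. \<forall>j \<tau> V W D. (\<forall>i\<in>window m. \<bar>V i - W i\<bar> \<le> D) \<longrightarrow> \<bar>F j \<tau> V - F j \<tau> W\<bar> \<le> L * D"
proof -
  obtain L where L: "\<And>j \<tau> V W. \<bar>F j \<tau> V - F j \<tau> W\<bar> \<le> L * L2_set (\<lambda>i. V i - W i) (window m)"
    using F_lip by blast
  have "\<bar>F j \<tau> V - F j \<tau> W\<bar> \<le> \<bar>L\<bar> * (2 * m + 1) * D"
    if D: "\<forall>i\<in>window m. \<bar>V i - W i\<bar> \<le> D" for j \<tau> V W D
  proof -
    have "L2_set (\<lambda>i. V i - W i) (window m) \<le> (\<Sum>i\<in>window m. \<bar>V i - W i\<bar>)"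
      by (rule L2_set_le_sum_abs)
    also have "\<dots> \<le> (2 * m + 1) * D"
      using sum_bounded_above[of "window m" "\<lambda>i. \<bar>V i - W i\<bar>" D] D card_window by simp
    finally have "\<bar>L\<bar> * L2_set (\<lambda>i. V i - W i) (window m) \<le> \<bar>L\<bar> * ((2 * m + 1) * D)"
      by (intro mult_left_mono) auto
    moreover have "L * L2_set (\<lambda>i. V i - W i) (window m) \<le> \<bar>L\<bar> * L2_set (\<lambda>i. V i - W i) (window m)"
      by (intro mult_right_mono) auto
    ultimately show ?thesis using L[of j \<tau> V W] by (simp add: mult.assoc)
  qed
  then show ?thesis by (intro exI[of _ "\<bar>L\<bar> * (2 * m + 1)"]) auto
qed

definition Lip :: real where
  "Lip = (SOME L. L \<ge> 0 \<and> (\<forall>j \<tau> V W D. (\<forall>i\<in>window m. \<bar>V i - W i\<bar> \<le> D) \<longrightarrow>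
     \<bar>F j \<tau> V - F j \<tau> W\<bar> \<le> L * D))"

lemma Lip_nonneg: "Lip \<ge> 0"
  and F_lipschitz: "(\<And>i. i \<in> window m \<Longrightarrow> \<bar>V i - W i\<bar> \<le> D) \<Longrightarrow> \<bar>F j \<tau> V - F j \<tau> W\<bar> \<le> Lip * D"
  using someI_ex[OF F_lipschitz_exists, folded Lip_def] by blast+

text \<open>
  By the integer translations in \<open>V\<close>, the periodicity in \<open>\<tau>\<close> and in \<open>j\<close>, only \<open>0 \<le> c < 1\<close>, \<open>0 \<le> \<tau> \<le> 1\<close> and finitely many
  \<open>j\<close> matter.
\<close>
lemma F_constant_bound: "\<exists>B. \<forall>j \<tau> c. \<bar>F j \<tau> (\<lambda>_. c)\<bar> \<le> B"
proof -
  have "\<exists>B. \<forall>\<tau>\<in>{0..1}. \<bar>F j \<tau> (\<lambda>_. 0)\<bar> \<le> B" for j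
  proof -
    have "continuous_on {0..1} (\<lambda>\<tau>. (\<tau>, \<lambda>_::int. 0::real))"
      by (intro continuous_intros)
    then have "continuous_on {0..1} (\<lambda>\<tau>. F j \<tau> (\<lambda>_. 0))"
      using continuous_on_compose2[OF F_cont[of j], of "{0..1}" "\<lambda>\<tau>. (\<tau>, \<lambda>_. 0)"] by auto
    then have "compact ((\<lambda>\<tau>. F j \<tau> (\<lambda>_. 0)) ` {0..1})"
      by (intro compact_continuous_image) auto
    then have "bounded ((\<lambda>\<tau>. F j \<tau> (\<lambda>_. 0)) ` {0..1})" by (rule compact_imp_bounded)
    then show ?thesis unfolding bounded_iff by auto
  qed
  then obtain B where B: "\<And>j \<tau>. \<tau> \<in> {0..1} \<Longrightarrow> \<bar>F j \<tau> (\<lambda>_. 0)\<bar> \<le> B j" by metis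
  define B' where "B' = (\<Sum>j\<in>{0..<int n}. \<bar>B j\<bar>)"
  have B0: "\<bar>F j \<tau> (\<lambda>_. 0)\<bar> \<le> B'" for j \<tau>
  proof -
    have "\<bar>F j \<tau> (\<lambda>_. 0)\<bar> = \<bar>F (j mod int n) (frac \<tau>) (\<lambda>_. 0)\<bar>" by (simp add: F_mod F_frac)
    also have "\<dots> \<le> \<bar>B (j mod int n)\<bar>"
      using B[of "frac \<tau>" "j mod int n"] frac_lt_1[of \<tau>] by (auto simp: less_imp_le)
    also have "\<dots> \<le> B'" unfolding B'_def
      using n_pos by (intro member_le_sum) auto
    finally show ?thesis .
  qed
  have "\<bar>F j \<tau> (\<lambda>_. c)\<bar> \<le> B' + Lip" for j \<tau> c
  proof -
    have "F j \<tau> (\<lambda>_. c) = F j \<tau> (\<lambda>_. frac c)"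
      using F_shift_int[of j \<tau> "\<lambda>_. frac c" "\<lfloor>c\<rfloor>"] by (simp add: frac_def)
    moreover have "\<bar>F j \<tau> (\<lambda>_. frac c) - F j \<tau> (\<lambda>_. 0)\<bar> \<le> Lip * 1"
      by (rule F_lipschitz) (simp add: frac_lt_1 less_imp_le)
    ultimately show ?thesis using B0[of j \<tau>] by linarith
  qed
  then show ?thesis by blast
qed

definition F_bd :: real where "F_bd = (SOME B. \<forall>j \<tau> c. \<bar>F j \<tau> (\<lambda>_. c)\<bar> \<le> B)"

lemma F_bd: "\<bar>F j \<tau> (\<lambda>_. c)\<bar> \<le> F_bd"
  using someI_ex[OF F_constant_bound, folded F_bd_def] by blast

text \<open>
  The coordinates are changed one at a time.
\<close>
lemma F_mono:
  assumes "\<And>i. i \<in> window m \<Longrightarrow> V i \<le> W i"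
  shows "2 * F j \<tau> V + \<alpha> * V 0 \<le> 2 * F j \<tau> W + \<alpha> * W 0"
proof -
  define G where "G = (\<lambda>V. 2 * F j \<tau> V + \<alpha> * V 0)"
  have G_coordinate: "G V \<le> G (V(k := x))" if "k \<in> window m" "V k \<le> x" for V k x
  proof (cases "k = 0")
    case True
    then show ?thesis using monoD[OF F_mono_centre[of j \<tau> V], of "V 0" x] that by (simp add: G_def)
  next
    case False
    then show ?thesis using monoD[OF F_mono_coordinate[of k j \<tau> V], of "V k" x] that by (simp add: G_def)
  qed
  have "G V \<le> G (\<lambda>i. if i \<in> A then W i else V i)" if "finite A" "A \<subseteq> window m" for A
    using that
  proof (induction A rule: finite_induct)
    case (insert k A)
    let ?V = "\<lambda>i. if i \<in> A then W i else V i"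
    have "G V \<le> G ?V" using insert by simp
    also have "\<dots> \<le> G (?V(k := W k))" using insert assms by (intro G_coordinate) auto
    also have "?V(k := W k) = (\<lambda>i. if i \<in> insert k A then W i else V i)" by auto
    finally show ?case .
  qed simp
  from this[OF finite_window order_refl]
  have "G V \<le> G (\<lambda>i. if i \<in> window m then W i else V i)" .
  also have "\<dots> = G W"
    unfolding G_def using zero_in_window F_window[of "\<lambda>i. if i \<in> window m then W i else V i" W j \<tau>] by simp
  finally show ?thesis by (simp add: G_def)
qed

text \<open>
  The right-hand side of the chain plus \<open>\<alpha> x\<close>.  The entries \<open>(j, True)\<close> and \<open>(j, False)\<close> are the components
  \<open>u\<^sub>j\<close> and \<open>\<xi>\<^sub>j\<close>.
\<close>
definition shifted_field :: "real \<Rightarrow> (int \<times> bool \<Rightarrow> real) \<Rightarrow> int \<times> bool \<Rightarrow> real" where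
  "shifted_field t x = (\<lambda>(j, b). if b then \<alpha> * x (j, False)
     else 2 * F j t (\<lambda>i. x (j + i, True)) + \<alpha> * x (j, True))"

text \<open>
  The exponential growth dominates the straight lines and changes only by a bounded factor within
  a window.
\<close>
definition weight :: "int \<times> bool \<Rightarrow> real" where
  "weight = (\<lambda>(j, b). 2 ^ nat \<bar>j\<bar>)"

lemma weight_ge_1: "weight i \<ge> 1"
  by (auto simp: weight_def split: prod.splits)

lemma weight_neighbour:
  assumes "i \<in> window m"
  shows "weight (j + i, b) \<le> 2 ^ m * weight (j, b')"
proof -
  have "nat \<bar>j + i\<bar> \<le> m + nat \<bar>j\<bar>" using assms by (auto simp: window_def)
  then have "(2::real) ^ nat \<bar>j + i\<bar> \<le> 2 ^ (m + nat \<bar>j\<bar>)" by (intro power_increasing) auto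
  then show ?thesis by (simp add: weight_def power_add)
qed

lemma shifted_field_lipschitz:
  assumes x: "\<And>i. \<bar>x i - y i\<bar> \<le> D * W i" and W: "\<And>i. W i > 0"
    and nb: "\<And>j i b b'. i \<in> window m \<Longrightarrow> W (j + i, b) \<le> 2 ^ m * W (j, b')"
  shows "\<bar>shifted_field t x i - shifted_field t y i\<bar> \<le> (2 * Lip * 2 ^ m + \<alpha>) * 2 ^ m * D * W i"
proof -
  obtain j b where i: "i = (j, b)" by force
  have D: "D \<ge> 0" using x[of i] W[of i] by (smt (verit) zero_le_mult_iff)
  have DW: "D * W i \<ge> 0" for i using D W[of i] by simp
  have near: "\<bar>x (j + k, c) - y (j + k, c)\<bar> \<le> 2 ^ m * (D * W (j, b'))" if "k \<in> window m" for k c b'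
    using x[of "(j + k, c)"] mult_left_mono[OF nb[OF that, of j c b'] D] by (simp add: algebra_simps)
  have \<alpha>near: "\<alpha> * \<bar>x (j, c) - y (j, c)\<bar> \<le> \<alpha> * (2 ^ m * (D * W i))" for c
    using near[OF zero_in_window, of c b] \<alpha>_pos by (simp add: i)
  have LipW: "0 \<le> 2 * Lip * 2 ^ m * 2 ^ m * (D * W i)" using DW[of i] Lip_nonneg by simp
  show ?thesis
  proof (cases b)
    case True
    then have "\<bar>shifted_field t x i - shifted_field t y i\<bar> = \<alpha> * \<bar>x (j, False) - y (j, False)\<bar>"
      using \<alpha>_pos by (simp add: shifted_field_def i abs_mult flip: right_diff_distrib)
    also have "\<dots> \<le> 2 * Lip * 2 ^ m * 2 ^ m * (D * W i) + \<alpha> * (2 ^ m * (D * W i))"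
      using \<alpha>near[of False] LipW by linarith
    also have "\<dots> = (2 * Lip * 2 ^ m + \<alpha>) * 2 ^ m * D * W i" by (simp add: algebra_simps)
    finally show ?thesis .
  next
    case False
    have "\<bar>F j t (\<lambda>k. x (j + k, True)) - F j t (\<lambda>k. y (j + k, True))\<bar> \<le> Lip * (2 ^ m * (D * W i))"
      unfolding i by (rule F_lipschitz) (use near in simp)
    moreover have "Lip * (2 ^ m * (D * W i)) * 1 \<le> Lip * (2 ^ m * (D * W i)) * 2 ^ m"
      using DW[of i] Lip_nonneg by (intro mult_left_mono) auto
    ultimately have f: "\<bar>F j t (\<lambda>k. x (j + k, True)) - F j t (\<lambda>k. y (j + k, True))\<bar>
        \<le> Lip * (2 ^ m * (D * W i)) * 2 ^ m" by linarith
    have "\<bar>shifted_field t x i - shifted_field t y i\<bar>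
        = \<bar>2 * (F j t (\<lambda>k. x (j + k, True)) - F j t (\<lambda>k. y (j + k, True))) + \<alpha> * (x (j, True) - y (j, True))\<bar>"
      using False by (simp add: shifted_field_def i algebra_simps)
    also have "\<dots> \<le> 2 * \<bar>F j t (\<lambda>k. x (j + k, True)) - F j t (\<lambda>k. y (j + k, True))\<bar>
        + \<alpha> * \<bar>x (j, True) - y (j, True)\<bar>"
    proof -
      have "\<bar>2 * p + \<alpha> * q\<bar> \<le> 2 * \<bar>p\<bar> + \<alpha> * \<bar>q\<bar>" for p q
        using abs_triangle_ineq[of "2 * p" "\<alpha> * q"] \<alpha>_pos by (simp add: abs_mult)
      then show ?thesis .
    qed
    also have "\<dots> \<le> 2 * (Lip * (2 ^ m * (D * W i)) * 2 ^ m) + \<alpha> * (2 ^ m * (D * W i))"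
      by (intro add_mono mult_left_mono f \<alpha>near) auto
    also have "\<dots> = (2 * Lip * 2 ^ m + \<alpha>) * 2 ^ m * D * W i" by (simp add: algebra_simps)
    finally show ?thesis .
  qed
qed

sublocale cooperative_system shifted_field \<alpha> "(2 * Lip * 2 ^ m + \<alpha>) * 2 ^ m" weight
proof
  show "\<alpha> > 0" by (rule \<alpha>_pos)
  show "0 < (2 * Lip * 2 ^ m + \<alpha>) * 2 ^ m" using Lip_nonneg \<alpha>_pos by (simp add: add_nonneg_pos)
  show "0 < weight i" for i using weight_ge_1[of i] by linarith
  show "finite {i. weight i \<le> c}" for c
  proof -
    obtain N :: nat where N: "c < 2 ^ N" using real_arch_pow[of 2 c] by auto
    have "{i. weight i \<le> c} \<subseteq> {- int N..int N} \<times> UNIV"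
    proof
      fix i assume "i \<in> {i. weight i \<le> c}"
      then obtain j b where i: "i = (j, b)" "(2::real) ^ nat \<bar>j\<bar> \<le> c" by (cases i) (auto simp: weight_def)
      then have "(2::real) ^ nat \<bar>j\<bar> < 2 ^ N" using N by linarith
      then have "nat \<bar>j\<bar> < N" by (simp add: power_strict_increasing_iff)
      then show "i \<in> {- int N..int N} \<times> UNIV" by (auto simp: i)
    qed
    then show ?thesis by (rule finite_subset) auto
  qed
  show "continuous_on S (\<lambda>t. shifted_field t (Y t) i)"
    if Y: "\<And>i. continuous_on S (\<lambda>t. Y t i)" for S and Y :: "real \<Rightarrow> int \<times> bool \<Rightarrow> real" and i
  proof -
    obtain j b where i: "i = (j, b)" by force
    \<comment> \<open>Continuity in every entry is continuity in the product topology.\<close>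
    have "continuous_on S (\<lambda>t. (t, \<lambda>k. Y t (j + k, True)))"
      by (intro continuous_intros continuous_on_coordinatewise_then_product Y)
    from continuous_on_compose2[OF F_cont[of j] this]
    have "continuous_on S (\<lambda>t. F j t (\<lambda>k. Y t (j + k, True)))" by simp
    then show ?thesis unfolding shifted_field_def i by (cases b) (auto intro!: continuous_intros Y)
  qed
  show "shifted_field t x i \<le> shifted_field t y i" if "\<And>i. x i \<le> y i" for x y t i
  proof -
    obtain j b where i: "i = (j, b)" by force
    show ?thesis
      using F_mono[of "\<lambda>k. x (j + k, True)" "\<lambda>k. y (j + k, True)" j t] that \<alpha>_pos
      by (auto simp: shifted_field_def i)
  qed
  show "\<bar>shifted_field t x i - shifted_field t y i\<bar> \<le> (2 * Lip * 2 ^ m + \<alpha>) * 2 ^ m * D * weight i"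
    if "\<And>i. \<bar>x i - y i\<bar> \<le> D * weight i" for x y D t i
    using that weight_ge_1 weight_neighbour by (intro shifted_field_lipschitz) (auto intro: less_le_trans[of 0 1])
  show "\<bar>shifted_field t x i - shifted_field t y i\<bar> \<le> (2 * Lip * 2 ^ m + \<alpha>) * 2 ^ m * D"
    if "\<And>i. \<bar>x i - y i\<bar> \<le> D" for x y D t i
    using shifted_field_lipschitz[of x y D "\<lambda>_. 1"] that by simp
  show "\<exists>B. \<forall>t i. \<bar>shifted_field t (\<lambda>_. 0) i\<bar> \<le> B * weight i"
  proof (intro exI allI)
    fix t and i :: "int \<times> bool"
    obtain j b where i: "i = (j, b)" by force
    have "2 * F_bd * 1 \<le> 2 * F_bd * weight i"
      using F_bd[of 0 0 0] weight_ge_1 by (intro mult_left_mono) auto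
    then show "\<bar>shifted_field t (\<lambda>_. 0) i\<bar> \<le> 2 * F_bd * weight i"
      using F_bd[of j t 0] by (cases b) (simp_all add: shifted_field_def i)
  qed
qed

end

section \<open>Mean speed of the chain started from a straight line\<close>

text \<open>
  Comparing \<open>f (k l)\<close> with \<open>k f l\<close> and with \<open>l f k\<close> shows that every quotient \<open>(f k - C) / k\<close> is below
  every quotient \<open>(f l + C) / l\<close>; any number in between is a slope.
\<close>
lemma quasi_additive_slope:
  fixes f :: "nat \<Rightarrow> real"
  assumes quasi: "\<And>k l. \<bar>f (k + l) - f k - f l\<bar> \<le> C"
  obtains l where "\<And>k. \<bar>f k - l * real k\<bar> \<le> C"
proof -
  have upper: "f (k * l) + C \<le> real k * (f l + C)" if "k \<ge> 1" for k l
    using that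
  proof (induction k rule: dec_induct)
    case (step k)
    have "f (Suc k * l) \<le> f (k * l) + f l + C" using quasi[of l "k * l"] by (simp add: algebra_simps)
    then show ?case using step by (simp add: algebra_simps)
  qed simp
  have lower: "real k * (f l - C) \<le> f (k * l) - C" if "k \<ge> 1" for k l
    using that
  proof (induction k rule: dec_induct)
    case (step k)
    have "f (Suc k * l) \<ge> f (k * l) + f l - C" using quasi[of l "k * l"] by (simp add: algebra_simps)
    then show ?case using step by (simp add: algebra_simps)
  qed simp
  have C: "C \<ge> 0" using quasi[of 0 0] by linarith
  have cross: "(f k - C) / real k \<le> (f l + C) / real l" if "k \<ge> 1" "l \<ge> 1" for k l
  proof -
    have "real l * (f k - C) \<le> real k * (f l + C)"
      using lower[OF that(2), of k] upper[OF that(1), of l] C by (simp add: mult.commute)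
    then show ?thesis using that by (simp add: field_simps)
  qed
  define l where "l = (SUP k\<in>{1..}. (f k - C) / real k)"
  have bdd: "bdd_above ((\<lambda>k. (f k - C) / real k) ` {1..})"
    using cross[of _ 1] by (intro bdd_aboveI2[where M = "(f 1 + C) / real 1"]) auto
  have "\<bar>f k - l * real k\<bar> \<le> C" for k
  proof (cases "k \<ge> 1")
    case True
    have "(f k - C) / real k \<le> l"
      unfolding l_def by (rule cSUP_upper[OF _ bdd]) (use True in simp)
    moreover have "l \<le> (f k + C) / real k"
      unfolding l_def using cross True by (intro cSUP_least) auto
    ultimately show ?thesis using True by (simp add: field_simps abs_le_iff)
  next
    case False
    then have "k = 0" by simp
    then show ?thesis using quasi[of 0 0] by simp
  qed
  then show thesis using that by blast
qed

context chain begin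

definition line :: "real \<Rightarrow> real \<Rightarrow> int \<times> bool \<Rightarrow> real" where
  "line p z = (\<lambda>(j, b). z + p * real_of_int j / real n)"

lemma line_add: "line p (z + c) = (\<lambda>i. line p z i + c)"
  by (auto simp: line_def)

lemma line_le_iff [simp]: "line p z i \<le> line p z' i \<longleftrightarrow> z \<le> z'"
  by (auto simp: line_def split: prod.splits)

lemma abs_index_le_weight: "\<bar>real_of_int j\<bar> \<le> weight (j, b)"
proof -
  have "real (nat \<bar>j\<bar>) \<le> 2 ^ nat \<bar>j\<bar>" by (rule less_imp_le[OF of_nat_less_two_power])
  then show ?thesis by (simp add: weight_def)
qed

lemma line_slope_lipschitz: "\<bar>line p z i - line q z i\<bar> \<le> \<bar>p - q\<bar> * weight i"
proof -
  obtain j b where i: "i = (j, b)" by force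
  have "\<bar>line p z i - line q z i\<bar> = \<bar>p - q\<bar> * \<bar>real_of_int j\<bar> / real n"
    by (simp add: line_def i abs_mult flip: left_diff_distrib diff_divide_distrib)
  also have "\<dots> \<le> \<bar>p - q\<bar> * \<bar>real_of_int j\<bar> / 1"
    using n_pos by (intro divide_left_mono) auto
  also have "\<dots> \<le> \<bar>p - q\<bar> * weight i"
    using abs_index_le_weight by (simp add: i mult_left_mono)
  finally show ?thesis .
qed

lemma dominated_near: "dominated y \<Longrightarrow> (\<And>i. \<bar>x i - y i\<bar> \<le> C) \<Longrightarrow> dominated x"
proof -
  assume y: "dominated y" and xy: "\<And>i. \<bar>x i - y i\<bar> \<le> C"
  obtain B where B: "\<And>i. \<bar>y i\<bar> \<le> B * weight i" using y by (auto simp: dominated_def)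
  have "\<bar>x i\<bar> \<le> (B + C) * weight i" for i
  proof -
    have "C * 1 \<le> C * weight i" using xy[of i] weight_ge_1[of i] by (intro mult_left_mono) auto
    then show ?thesis using B[of i] xy[of i] by (simp add: algebra_simps)
  qed
  then show ?thesis by (auto simp: dominated_def)
qed

lemma dominated_line: "dominated (line p z)"
proof -
  have "dominated (line p 0)" unfolding dominated_def
    using line_slope_lipschitz[of p 0 _ 0] by (intro exI[of _ "\<bar>p\<bar>"]) (auto simp: line_def)
  then show ?thesis by (rule dominated_near[where C = "\<bar>z\<bar>"]) (auto simp: line_def)
qed

lemma dominated_near_line: "(\<And>i. \<bar>x i - line p z i\<bar> \<le> C) \<Longrightarrow> dominated x"
  by (rule dominated_near[OF dominated_line])

lemma dominated_add: "dominated x \<Longrightarrow> dominated (\<lambda>i. x i + c)"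
  by (erule dominated_near[where C = "\<bar>c\<bar>"]) simp

lemma evol_add_int:
  assumes "dominated x" "s \<le> t"
  shows "evol s t (\<lambda>i. x i + of_int k) i = evol s t x i + of_int k"
proof (rule evol_equivariant[where \<sigma> = "\<lambda>i. i"])
  fix t x i
  show "shifted_field t (\<lambda>i. x i + real_of_int k) i = shifted_field t x i + \<alpha> * of_int k"
    by (auto simp: shifted_field_def F_shift_int distrib_left split: prod.splits)
qed (use assms dominated_add in auto)

lemma evol_index_shift:
  assumes "dominated x" "dominated (\<lambda>(j, b). x (j + k * int n, b))" "s \<le> t"
  shows "evol s t (\<lambda>(j, b). x (j + k * int n, b)) (j, b) = evol s t x (j + k * int n, b)"
proof -
  let ?\<sigma> = "\<lambda>(j, b::bool). (j + k * int n, b)"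
  have "evol s t (\<lambda>i. x (?\<sigma> i) + 0) (j, b) = evol s t x (?\<sigma> (j, b)) + 0"
  proof (rule evol_equivariant)
    show "shifted_field t (\<lambda>i. x (?\<sigma> i) + 0) i = shifted_field t x (?\<sigma> i) + \<alpha> * 0" for t x i
      by (auto simp: shifted_field_def F_period_index_int add_ac split: prod.splits)
    show "dominated (\<lambda>i. x (?\<sigma> i) + 0)" using assms(2) by (simp add: split_def)
  qed (use assms in auto)
  then show ?thesis by (simp add: split_def)
qed

lemma evol_ordered:
  assumes "dominated x" "\<And>j b. x (j, b) \<le> x (j + 1, b)" "s \<le> t"
  shows "evol s t x (j, b) \<le> evol s t x (j + 1, b)"
proof -
  let ?\<sigma> = "\<lambda>(j, b::bool). (j + 1, b)"
  have "evol s t x (j, b) \<le> evol s t x (?\<sigma> (j, b))"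
  proof (rule evol_index_mono)
    fix t and x :: "int \<times> bool \<Rightarrow> real" and i :: "int \<times> bool"
    assume x: "\<And>i. x i \<le> x (?\<sigma> i)"
    have step: "x (j, b) \<le> x (j + 1, b)" for j b using x[of "(j, b)"] by simp
    obtain j b where i: "i = (j, b)" by force
    have "2 * F j t (\<lambda>i. x (j + i, True)) + \<alpha> * x (j, True)
        \<le> 2 * F (j + 1) t (\<lambda>i. x (j + 1 + i, True)) + \<alpha> * x (j + 1, True)"
    proof -
      have "x (j + i, True) \<le> x (j + (i + 1), True)" for i
        using step[of "j + i" True] by (simp add: add.assoc)
      from F_ordered[of "\<lambda>i. x (j + i, True)" j t, OF this] show ?thesis by (simp add: add_ac)
    qed
    then show "shifted_field t x i \<le> shifted_field t x (?\<sigma> i)"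
      using step \<alpha>_pos by (auto simp: shifted_field_def i)
  qed (use assms in \<open>auto split: prod.splits\<close>)
  then show ?thesis by simp
qed

lemma evol_period: "dominated x \<Longrightarrow> s \<le> t \<Longrightarrow> evol (s + of_int k) (t + of_int k) x = evol s t x"
proof (rule evol_time_shift)
  have "F j (t + of_int k) = F j t" for j t
    using integer_multiples_of_period[where g = "F j" and p = 1 and x = t and k = k] F_period_time by simp
  then show "shifted_field (t + of_int k) = shifted_field t" for t
    by (intro ext) (simp add: shifted_field_def split: prod.splits)
qed

lemma ordered_le:
  fixes x :: "int \<times> bool \<Rightarrow> real"
  assumes "\<And>j b. x (j, b) \<le> x (j + 1, b)" "j \<le> k"
  shows "x (j, b) \<le> x (k, b)"
  using assms(2)
proof (induction k rule: int_ge_induct)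
  case (step k) then show ?case using assms(1)[of k b] by linarith
qed simp

lemma evol_line_index:
  assumes "s \<le> t"
  shows "evol s t (line p z) (j + k * int n, b) = evol s t (line p (z + p * of_int k)) (j, b)"
proof -
  have eq: "(\<lambda>(j, b). line p z (j + k * int n, b)) = line p (z + p * of_int k)"
    using n_pos by (auto simp: line_def field_simps)
  show ?thesis
    using evol_index_shift[of "line p z" k s t j b] assms dominated_line unfolding eq by simp
qed

lemma evol_line_mono: "s \<le> t \<Longrightarrow> z \<le> z' \<Longrightarrow> evol s t (line p z) i \<le> evol s t (line p z') i"
  by (intro evol_mono dominated_line) auto

lemma evol_line_int: "s \<le> t \<Longrightarrow> evol s t (line p (z + of_int k)) i = evol s t (line p z) i + of_int k"
  unfolding line_add by (rule evol_add_int[OF dominated_line])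

definition disp :: "real \<Rightarrow> real \<Rightarrow> real \<Rightarrow> real" where
  "disp p s t = evol s t (line p 0) (0, True)"

text \<open>
  The rotation-number argument: the origin component is nondecreasing in \<open>z\<close> and commutes with integer translations, so
  rounding \<open>z\<close> down and up costs at most \<open>1\<close>.
\<close>
lemma evol_line_origin:
  assumes "s \<le> t"
  shows "\<bar>evol s t (line p z) (0, True) - z - disp p s t\<bar> \<le> 1"
proof -
  have "evol s t (line p z) (0, True) \<le> evol s t (line p (0 + of_int \<lceil>z\<rceil>)) (0, True)"
    by (rule evol_line_mono[OF assms]) simp
  moreover have "evol s t (line p (0 + of_int \<lfloor>z\<rfloor>)) (0, True) \<le> evol s t (line p z) (0, True)"
    by (rule evol_line_mono[OF assms]) simp
  ultimately have "disp p s t + of_int \<lfloor>z\<rfloor> \<le> evol s t (line p z) (0, True)"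
    "evol s t (line p z) (0, True) \<le> disp p s t + of_int \<lceil>z\<rceil>"
    unfolding evol_line_int[OF assms] disp_def by simp_all
  moreover have "real_of_int \<lceil>z\<rceil> \<le> z + 1" "z - 1 \<le> real_of_int \<lfloor>z\<rfloor>" by linarith+
  ultimately show ?thesis by linarith
qed

lemma evol_line_ordered:
  "p \<ge> 0 \<Longrightarrow> s \<le> t \<Longrightarrow> evol s t (line p z) (j, b) \<le> evol s t (line p z) (j + 1, b)"
  by (intro evol_ordered dominated_line) (auto simp: line_def divide_right_mono mult_left_mono)

text \<open>
  Index shifts by \<open>n\<close> are translations of the line, which gives the bound at multiples of \<open>n\<close>; between them
  the chain is nondecreasing in \<open>j\<close>.
\<close>
lemma evol_line_spread:
  assumes p: "p \<ge> 0" and t: "s \<le> t"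
  shows "\<bar>evol s t (line p z) (j, True) - line p (z + disp p s t) (j, True)\<bar> \<le> 1 + p"
proof -
  define k where "k = j div int n"
  have j: "k * int n \<le> j" "j \<le> (k + 1) * int n"
  proof -
    have "k * int n = j - j mod int n" unfolding k_def by (simp add: minus_mod_eq_div_mult)
    moreover have "(k + 1) * int n = k * int n + int n" by (simp add: distrib_right)
    ultimately show "k * int n \<le> j" "j \<le> (k + 1) * int n"
      using n_pos pos_mod_bound[of "int n" j] pos_mod_sign[of "int n" j] by linarith+
  qed
  have jr: "p * of_int k \<le> p * of_int j / real n" "p * of_int j / real n \<le> p * of_int (k + 1)"
  proof -
    have "real_of_int (k * int n) \<le> of_int j" "real_of_int j \<le> of_int ((k + 1) * int n)"
      using j by (simp_all only: of_int_le_iff)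
    then have "of_int k \<le> of_int j / real n" "of_int j / real n \<le> of_int (k + 1)"
      using n_pos by (simp_all add: field_simps)
    then show "p * of_int k \<le> p * of_int j / real n" "p * of_int j / real n \<le> p * of_int (k + 1)"
      using p by (metis mult_left_mono times_divide_eq_right)+
  qed
  note ord = ordered_le[where x = "evol s t (line p z)", OF evol_line_ordered[OF p t]]
  have "evol s t (line p z) (0 + k * int n, True) \<le> evol s t (line p z) (j, True)"
    by (rule ord) (use j in simp)
  moreover have "evol s t (line p z) (j, True) \<le> evol s t (line p z) (0 + (k + 1) * int n, True)"
    by (rule ord) (use j in simp)
  ultimately have
    "evol s t (line p (z + p * of_int k)) (0, True) \<le> evol s t (line p z) (j, True)"
    "evol s t (line p z) (j, True) \<le> evol s t (line p (z + p * of_int (k + 1))) (0, True)"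
    unfolding evol_line_index[OF t] .
  then have "z + p * of_int k + disp p s t - 1 \<le> evol s t (line p z) (j, True)"
    "evol s t (line p z) (j, True) \<le> z + p * of_int (k + 1) + disp p s t + 1"
    using evol_line_origin[OF t, of p "z + p * of_int k"]
      evol_line_origin[OF t, of p "z + p * of_int (k + 1)"] by linarith+
  then show ?thesis using jr by (simp add: line_def distrib_left abs_le_iff)
qed

text \<open>
  A bound for the forces along a chain that has evolved from a line of slope \<open>p\<close>, hence for the velocity of \<open>u\<close>.
\<close>
definition force_bound :: "real \<Rightarrow> real" where
  "force_bound p = F_bd + Lip * (2 + (2 + real m) * p)"

lemma F_along_line:
  assumes p: "p \<ge> 0" and t: "s \<le> t"
  shows "\<bar>F j r (\<lambda>i. evol s t (line p z) (j + i, True))\<bar> \<le> force_bound p"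
proof -
  let ?u = "\<lambda>j. evol s t (line p z) (j, True)"
  have "\<bar>?u (j + i) - ?u j\<bar> \<le> 2 + (2 + real m) * p" if i: "i \<in> window m" for i
  proof -
    have "\<bar>p * real_of_int i / real n\<bar> \<le> p * real m"
    proof -
      have "\<bar>real_of_int i\<bar> / real n \<le> real m / 1"
        using i n_pos by (intro frac_le) (auto simp: window_def)
      then show ?thesis using p by (simp add: abs_mult mult_left_mono flip: times_divide_eq_right)
    qed
    moreover have "line p c (j + i, True) - line p c (j, True) = p * real_of_int i / real n" for c
      by (simp add: line_def add_divide_distrib distrib_left)
    ultimately have "\<bar>line p (z + disp p s t) (j + i, True) - line p (z + disp p s t) (j, True)\<bar> \<le> p * real m" by simp
    moreover have rhs: "2 + (2 + real m) * p = (1 + p) + (1 + p) + p * real m"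
      by (simp add: algebra_simps)
    ultimately show ?thesis
      using evol_line_spread[OF p t, of z "j + i"] evol_line_spread[OF p t, of z j]
      unfolding rhs by linarith
  qed
  then have "\<bar>F j r (\<lambda>i. ?u (j + i)) - F j r (\<lambda>_. ?u j)\<bar> \<le> Lip * (2 + (2 + real m) * p)"
    by (rule F_lipschitz)
  then show ?thesis using F_bd[of j r "?u j"] by (simp add: force_bound_def)
qed

text \<open>
  The difference \<open>d = \<xi>\<^sub>j - u\<^sub>j\<close> satisfies \<open>d' = 2 F - 2 \<alpha> d\<close> with bounded \<open>F\<close> and starts from \<open>0\<close>.
\<close>
lemma evol_line_gap:
  assumes p: "p \<ge> 0" and t: "s \<le> t"
  shows "\<bar>evol s t (line p z) (j, False) - evol s t (line p z) (j, True)\<bar> \<le> force_bound p / \<alpha>"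
proof -
  let ?x = "\<lambda>t. evol s t (line p z)"
  let ?f = "\<lambda>r. F j r (\<lambda>i. ?x r (j + i, True))"
  let ?d = "\<lambda>r. ?x r (j, False) - ?x r (j, True)"
  have cont: "continuous_on {s..t} ?d"
    using continuous_from_evol[OF dominated_line, of s p z] unfolding continuous_from_def
    by (intro continuous_intros) auto
  have der: "(?d has_real_derivative 2 * ?f r - 2 * \<alpha> * ?d r) (at r)" if "s < r" for r
    using evol_derivative[OF dominated_line that, of p z "(j, False)"]
      evol_derivative[OF dominated_line that, of p z "(j, True)"]
    by (auto intro!: derivative_eq_intros simp: shifted_field_def algebra_simps)
  have bound: "\<bar>?f r\<bar> \<le> force_bound p" if "s < r" for r
    using F_along_line[OF p, of s r j r z] that by simp
  have force_bound: "force_bound p \<ge> 0" using F_along_line[OF p, of 0 0 0 0 0] by linarith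
  have start: "?d s = 0" unfolding evol_start[OF dominated_line] by (simp add: line_def)
  have eq: "2 * \<alpha> * (force_bound p / \<alpha> - c) = 2 * force_bound p - 2 * \<alpha> * c" for c
    using \<alpha>_pos by (simp add: field_simps)
  have "?d t \<le> force_bound p / \<alpha>"
  proof (rule derivative_barrier[where c = "2 * \<alpha>", OF cont t])
    fix r assume r: "s < r" "r < t"
    show "\<exists>d'. (?d has_real_derivative d') (at r) \<and> d' \<le> 2 * \<alpha> * (force_bound p / \<alpha> - ?d r)"
      using der[OF r(1)] bound[OF r(1)] unfolding eq by (intro exI conjI) auto
  qed (use start force_bound \<alpha>_pos in simp)
  moreover have "- ?d t \<le> force_bound p / \<alpha>"
  proof (rule derivative_barrier[where c = "2 * \<alpha>" and d = "\<lambda>r. - ?d r", OF _ t])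
    fix r assume r: "s < r" "r < t"
    show "\<exists>d'. ((\<lambda>r. - ?d r) has_real_derivative d') (at r) \<and> d' \<le> 2 * \<alpha> * (force_bound p / \<alpha> - - ?d r)"
      using DERIV_minus[OF der[OF r(1)]] bound[OF r(1)] unfolding eq
      by (intro exI conjI) (auto simp: right_diff_distrib)
  qed (use start force_bound \<alpha>_pos continuous_on_minus[OF cont] in simp_all)
  ultimately show ?thesis by linarith
qed

lemma disp_start: "disp p s s = 0"
  unfolding disp_def evol_start[OF dominated_line] by (simp add: line_def)

lemma force_bound_nonneg: "p \<ge> 0 \<Longrightarrow> force_bound p \<ge> 0"
  using F_along_line[of p 0 0 0 0 0] by linarith

lemma disp_short:
  assumes p: "p \<ge> 0" and t: "s \<le> t" "t \<le> s + 1"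
  shows "\<bar>disp p s t\<bar> \<le> force_bound p"
proof (cases "s = t")
  case False
  let ?x = "\<lambda>t. evol s t (line p 0)"
  have der: "(disp p s has_real_derivative \<alpha> * (?x r (0, False) - ?x r (0, True))) (at r)" if "s < r" for r
    using evol_derivative[OF dominated_line that, of p 0 "(0, True)"]
    unfolding disp_def by (simp add: shifted_field_def right_diff_distrib)
  have "continuous_on {s..t} (disp p s)"
    using continuous_from_evol[OF dominated_line, of s p 0] unfolding continuous_from_def disp_def by auto
  then obtain l z where z: "s < z" "z < t" "(disp p s has_real_derivative l) (at z)"
      "disp p s t - disp p s s = (t - s) * l"
    using MVT[of s t "disp p s"] der t False unfolding real_differentiable_def by fastforce
  have "l = \<alpha> * (?x z (0, False) - ?x z (0, True))" using DERIV_unique[OF z(3) der[OF z(1)]] .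
  moreover have "\<alpha> * \<bar>?x z (0, False) - ?x z (0, True)\<bar> \<le> \<alpha> * (force_bound p / \<alpha>)"
    using evol_line_gap[OF p, of s z 0 0] z \<alpha>_pos by (intro mult_left_mono) auto
  ultimately have "\<bar>l\<bar> \<le> force_bound p" using \<alpha>_pos by (simp add: abs_mult)
  then have "(t - s) * \<bar>l\<bar> \<le> 1 * force_bound p" using t by (intro mult_mono) auto
  then show ?thesis using z(4) disp_start[of p s] t by (simp add: abs_mult)
qed (use force_bound_nonneg[OF p] disp_start in auto)

definition width :: "real \<Rightarrow> real" where
  "width p = 1 + p + force_bound p / \<alpha>"

lemma evol_line_near:
  assumes p: "p \<ge> 0" and t: "s \<le> t"
  shows "\<bar>evol s t (line p z) i - line p (z + disp p s t) i\<bar> \<le> width p"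
proof -
  obtain j b where i: "i = (j, b)" by force
  have "force_bound p / \<alpha> \<ge> 0" using force_bound_nonneg[OF p] \<alpha>_pos by simp
  moreover have "line p (z + disp p s t) (j, b) = line p (z + disp p s t) (j, True)"
    by (simp add: line_def)
  ultimately show ?thesis
    using evol_line_gap[OF p t, of z j] evol_line_spread[OF p t, of z j]
    by (cases b) (auto simp: i width_def)
qed

text \<open>
  After a time \<open>r - s\<close> the chain lies between two lines at bounded distance; restart the evolution from
  these.
\<close>
lemma disp_quasi_additive:
  assumes p: "p \<ge> 0" and t: "s \<le> r" "r \<le> t"
  shows "\<bar>disp p s t - disp p s r - disp p r t\<bar> \<le> 2 * width p"
proof -
  let ?x = "evol s r (line p 0)" and ?z = "disp p s r" and ?C = "width p"
  have near: "line p (?z - ?C) i \<le> ?x i" "?x i \<le> line p (?z + ?C) i" for i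
    using evol_line_near[OF p t(1), of 0 i] line_add[of p ?z "- ?C"] line_add[of p ?z ?C]
    by (auto simp: abs_le_iff)
  have semi: "disp p s t = evol r t ?x (0, True)"
    unfolding disp_def using evol_semigroup[OF dominated_line t] by simp
  have "evol r t ?x (0, True) \<le> evol r t (line p (?z + ?C)) (0, True)"
    by (intro evol_mono dominated_evol dominated_line t near)
  moreover have "evol r t (line p (?z - ?C)) (0, True) \<le> evol r t ?x (0, True)"
    by (intro evol_mono dominated_evol dominated_line t near)
  ultimately show ?thesis
    using evol_line_near[OF p t(2), of "?z + ?C" "(0, True)"] evol_line_near[OF p t(2), of "?z - ?C" "(0, True)"]
    unfolding semi by (simp add: line_def abs_le_iff)
qed

text \<open>
  The mean speed, with the explicit error bound that makes it continuous in \<open>p\<close>.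
\<close>
definition rotation :: "real \<Rightarrow> real \<Rightarrow> bool" where
  "rotation p l \<longleftrightarrow> (\<forall>k::nat. \<bar>disp p 0 (real k) - l * real k\<bar> \<le> 2 * width p)"

lemma disp_period: "s \<le> t \<Longrightarrow> disp p (s + of_int k) (t + of_int k) = disp p s t"
  unfolding disp_def by (simp add: evol_period[OF dominated_line])

lemma rotation_exists:
  assumes p: "p \<ge> 0"
  obtains l where "rotation p l"
proof -
  have "\<bar>disp p 0 (real (k + l)) - disp p 0 (real k) - disp p 0 (real l)\<bar> \<le> 2 * width p" for k l
    using disp_quasi_additive[OF p, of 0 "real k" "real (k + l)"] disp_period[of 0 "real l" p "int k"]
    by (simp add: add.commute)
  from quasi_additive_slope[where f = "\<lambda>k. disp p 0 (real k)", OF this]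
  obtain l where "\<And>k. \<bar>disp p 0 (real k) - l * real k\<bar> \<le> 2 * width p" by blast
  then show thesis using that by (auto simp: rotation_def)
qed

text \<open>
  Reduces arbitrary start and end times to integers: the displacement during a time of length at most \<open>1\<close> is bounded.
\<close>
lemma rotation_drift:
  assumes p: "p \<ge> 0" and l: "rotation p l"
  obtains C where "\<And>s t z i. s \<le> t \<Longrightarrow> \<bar>evol s t (line p z) i - line p (z + l * (t - s)) i\<bar> \<le> C"
proof -
  let ?w = "width p" and ?v = "force_bound p"
  have disp: "\<bar>disp p s t - l * (t - s)\<bar> \<le> 6 * ?w + 2 * ?v + 2 * \<bar>l\<bar>" if t: "s \<le> t" for s t
  proof -
    define k where "k = \<lfloor>s\<rfloor>"
    define N where "N = \<lceil>t\<rceil>"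
    have k: "real_of_int k \<le> s" "s \<le> real_of_int k + 1" "t \<le> real_of_int N" "real_of_int N \<le> t + 1"
      unfolding k_def N_def by linarith+
    define q where "q = nat (N - k)"
    have "k \<le> N" using k t by linarith
    then have q: "real q = real_of_int N - real_of_int k" unfolding q_def by simp
    have Nk: "real_of_int N = real q + real_of_int k" using q by simp
    have "disp p k N = disp p 0 q"
      unfolding Nk using disp_period[of 0 "real q" p k] by simp
    moreover have "\<bar>disp p 0 q - l * real q\<bar> \<le> 2 * ?w" using l by (simp add: rotation_def)
    moreover have "\<bar>disp p k N - disp p k s - disp p s N\<bar> \<le> 2 * ?w"
      using k t by (intro disp_quasi_additive p) auto
    moreover have "\<bar>disp p s N - disp p s t - disp p t N\<bar> \<le> 2 * ?w"
      using k t by (intro disp_quasi_additive p) auto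
    moreover have "\<bar>disp p k s\<bar> \<le> ?v" "\<bar>disp p t N\<bar> \<le> ?v" using k by (auto intro!: disp_short p)
    moreover have "\<bar>l * real q - l * (t - s)\<bar> \<le> 2 * \<bar>l\<bar>"
    proof -
      have "\<bar>real q - (t - s)\<bar> \<le> 2" using k q by linarith
      then have "\<bar>l\<bar> * \<bar>real q - (t - s)\<bar> \<le> \<bar>l\<bar> * 2" by (rule mult_left_mono) simp
      then show ?thesis by (simp add: right_diff_distrib flip: abs_mult)
    qed
    ultimately show ?thesis unfolding abs_le_iff by linarith
  qed
  have "\<bar>evol s t (line p z) i - line p (z + l * (t - s)) i\<bar> \<le> 7 * ?w + 2 * ?v + 2 * \<bar>l\<bar>" if "s \<le> t" for s t z i
    using evol_line_near[OF p that, of z i] disp[OF that] unfolding line_add[of p z] by linarith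
  then show thesis using that by blast
qed

end

section \<open>A profile that is invariant in the moving frame\<close>

context chain begin

definition drift :: "real \<Rightarrow> real \<Rightarrow> real \<Rightarrow> bool" where
  "drift p l D \<longleftrightarrow>
     (\<forall>s t z i. s \<le> t \<longrightarrow> \<bar>evol s t (line p z) i - line p (z + l * (t - s)) i\<bar> \<le> D)"

text \<open>
  The properties of a hull function apart from the equation, with the bound made uniform in the
  index.  Equality of the functions \<open>f \<tau>\<close> and \<open>f \<tau>'\<close> is demanded when the forces do not depend on time.
\<close>
definition profile :: "real \<Rightarrow> real \<Rightarrow> (real \<Rightarrow> real \<Rightarrow> int \<times> bool \<Rightarrow> real) \<Rightarrow> bool" where
  "profile p C f \<longleftrightarrow>
     (\<forall>\<tau> z i. \<bar>f \<tau> z i - line p z i\<bar> \<le> C) \<and>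
     (\<forall>\<tau> z. f (\<tau> + 1) z = f \<tau> z) \<and>
     (\<forall>\<tau> z. f \<tau> (z + 1) = (\<lambda>i. f \<tau> z i + 1)) \<and>
     (\<forall>\<tau> z j b. f \<tau> z (j + int n, b) = f \<tau> (z + p) (j, b)) \<and>
     (\<forall>\<tau> z j b. f \<tau> z (j, b) \<le> f \<tau> z (j + 1, b)) \<and>
     (\<forall>\<tau> z z' i. z \<le> z' \<longrightarrow> f \<tau> z i \<le> f \<tau> z' i) \<and>
     ((\<forall>j \<tau> \<tau>' V. F j \<tau> V = F j \<tau>' V) \<longrightarrow> (\<forall>\<tau> \<tau>'. f \<tau> = f \<tau>'))"

lemma profileD:
  assumes "profile p C f"
  shows "\<bar>f \<tau> z i - line p z i\<bar> \<le> C" and "f (\<tau> + 1) z = f \<tau> z"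
    and "f \<tau> (z + 1) = (\<lambda>i. f \<tau> z i + 1)" and "f \<tau> z (j + int n, b) = f \<tau> (z + p) (j, b)"
    and "f \<tau> z (j, b) \<le> f \<tau> z (j + 1, b)" and "z \<le> z' \<Longrightarrow> f \<tau> z i \<le> f \<tau> z' i"
    and "(\<And>j \<tau> \<tau>' V. F j \<tau> V = F j \<tau>' V) \<Longrightarrow> f \<tau> = f \<tau>'"
proof -
  note parts = assms[unfolded profile_def]
  show "\<bar>f \<tau> z i - line p z i\<bar> \<le> C" using parts[THEN conjunct1] by blast
  note parts = parts[THEN conjunct2]
  show "f (\<tau> + 1) z = f \<tau> z" using parts[THEN conjunct1] by blast
  note parts = parts[THEN conjunct2]
  show "f \<tau> (z + 1) = (\<lambda>i. f \<tau> z i + 1)" using parts[THEN conjunct1] by blast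
  note parts = parts[THEN conjunct2]
  show "f \<tau> z (j + int n, b) = f \<tau> (z + p) (j, b)" using parts[THEN conjunct1] by blast
  note parts = parts[THEN conjunct2]
  show "f \<tau> z (j, b) \<le> f \<tau> z (j + 1, b)" using parts[THEN conjunct1] by blast
  note parts = parts[THEN conjunct2]
  show "f \<tau> z i \<le> f \<tau> z' i" if "z \<le> z'" using parts[THEN conjunct1] that by blast
  note parts = parts[THEN conjunct2]
  show "f \<tau> = f \<tau>'" if "\<And>j \<tau> \<tau>' V. F j \<tau> V = F j \<tau>' V" using parts that by blast
qed

lemma profileI:
  assumes "\<And>\<tau> z i. \<bar>f \<tau> z i - line p z i\<bar> \<le> C" and "\<And>\<tau> z i. f (\<tau> + 1) z i = f \<tau> z i"
    and "\<And>\<tau> z i. f \<tau> (z + 1) i = f \<tau> z i + 1" and "\<And>\<tau> z j b. f \<tau> z (j + int n, b) = f \<tau> (z + p) (j, b)"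
    and "\<And>\<tau> z j b. f \<tau> z (j, b) \<le> f \<tau> z (j + 1, b)" and "\<And>\<tau> z z' i. z \<le> z' \<Longrightarrow> f \<tau> z i \<le> f \<tau> z' i"
    and "\<And>\<tau> \<tau>' z i. (\<And>j \<tau> \<tau>' V. F j \<tau> V = F j \<tau>' V) \<Longrightarrow> f \<tau> z i = f \<tau>' z i"
  shows "profile p C f"
  unfolding profile_def
  by (intro conjI allI impI ext assms(1) assms(2) assms(3) assms(4) assms(5) assms(6) assms(7)) blast+

lemma profile_line: "p \<ge> 0 \<Longrightarrow> profile p 0 (\<lambda>\<tau>. line p)"
  using n_pos by (intro profileI) (auto simp: line_def field_simps split: prod.splits)

lemma profile_sandwich:
  assumes "profile p C f"
  shows "f \<tau> z i \<le> line p (z + C) i" "line p (z - C) i \<le> f \<tau> z i"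
  using profileD(1)[OF assms, of \<tau> z i] line_add[of p z C] line_add[of p z "- C"] by auto

lemma dominated_profile: "profile p C f \<Longrightarrow> dominated (f \<tau> z)"
  by (rule dominated_near_line[OF profileD(1)])

text \<open>
  The evolution during a time \<open>r\<close>, seen in the frame that moves with speed \<open>l\<close>.
\<close>
definition push :: "real \<Rightarrow> real \<Rightarrow> (real \<Rightarrow> real \<Rightarrow> int \<times> bool \<Rightarrow> real) \<Rightarrow> real \<Rightarrow> real \<Rightarrow> int \<times> bool \<Rightarrow> real"
  where "push l r f \<tau> z = evol (\<tau> - r) \<tau> (f (\<tau> - r) (z - l * r))"

lemma push_push:
  assumes "profile p C f" "0 \<le> q" "0 \<le> r"
  shows "push l q (push l r f) = push l (q + r) f"
proof (intro ext)
  fix \<tau> z i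
  have "evol (\<tau> - q) \<tau> (evol (\<tau> - q - r) (\<tau> - q) (f (\<tau> - q - r) (z - l * q - l * r)))
      = evol (\<tau> - q - r) \<tau> (f (\<tau> - q - r) (z - l * q - l * r))"
    using assms by (intro evol_semigroup dominated_profile[OF assms(1)]) auto
  moreover have eq: "\<tau> - (q + r) = \<tau> - q - r" "z - l * (q + r) = z - l * q - l * r"
    by (simp_all add: algebra_simps)
  ultimately show "push l q (push l r f) \<tau> z i = push l (q + r) f \<tau> z i"
    unfolding push_def eq by (simp only:)
qed

lemma push_mono:
  assumes "profile p C f" "profile p C' g" "0 \<le> r" "\<And>\<tau> z i. f \<tau> z i \<le> g \<tau> z i"
  shows "push l r f \<tau> z i \<le> push l r g \<tau> z i"
  unfolding push_def using assms by (intro evol_mono dominated_profile) auto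

lemma push_limit:
  assumes "\<And>k. profile p C (f k)" "profile p C g" "0 \<le> r" "\<And>\<tau> z i. (\<lambda>k. f k \<tau> z i) \<longlonglongrightarrow> g \<tau> z i"
  shows "(\<lambda>k. push l r (f k) \<tau> z i) \<longlonglongrightarrow> push l r g \<tau> z i"
  unfolding push_def
proof (rule evol_pointwise_limit[where C = "2 * C"])
  fix k i
  show "\<bar>f k (\<tau> - r) (z - l * r) i - g (\<tau> - r) (z - l * r) i\<bar> \<le> 2 * C"
    using profileD(1)[OF assms(1), of k "\<tau> - r" "z - l * r" i] profileD(1)[OF assms(2), of "\<tau> - r" "z - l * r" i]
    by linarith
qed (use assms dominated_profile[OF assms(1)] dominated_profile[OF assms(2)] in auto)

text \<open>
  Every condition is an invariance or an order relation that the evolution preserves; the bound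
  follows by comparison with two translated lines.
\<close>
lemma profile_push:
  assumes p: "p \<ge> 0" and l: "drift p l D" and f: "profile p C f" and r: "0 \<le> r"
  shows "profile p (C + D) (push l r f)"
proof (rule profileI)
  note dom = dominated_profile[OF f] and fD = profileD[OF f]
  fix \<tau> z
  have st: "\<tau> - r \<le> \<tau>" using r by simp
  show "\<bar>push l r f \<tau> z i - line p z i\<bar> \<le> C + D" for i
  proof -
    have "push l r f \<tau> z i \<le> evol (\<tau> - r) \<tau> (line p (z - l * r + C)) i"
      unfolding push_def by (intro evol_mono dom dominated_line st profile_sandwich[OF f])
    moreover have "evol (\<tau> - r) \<tau> (line p (z - l * r - C)) i \<le> push l r f \<tau> z i"
      unfolding push_def by (intro evol_mono dom dominated_line st profile_sandwich[OF f])
    moreover have "\<bar>evol (\<tau> - r) \<tau> (line p c) i - line p (c + l * (\<tau> - (\<tau> - r))) i\<bar> \<le> D" for c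
      using l st unfolding drift_def by blast
    from this[of "z - l * r + C"] this[of "z - l * r - C"]
    have "\<bar>evol (\<tau> - r) \<tau> (line p (z - l * r + C)) i - line p (z + C) i\<bar> \<le> D"
      "\<bar>evol (\<tau> - r) \<tau> (line p (z - l * r - C)) i - line p (z - C) i\<bar> \<le> D"
      by (simp_all add: algebra_simps)
    ultimately show ?thesis
      using line_add[of p z C] line_add[of p z "- C"] by (auto simp: abs_le_iff)
  qed
  show "push l r f (\<tau> + 1) z i = push l r f \<tau> z i" for i
  proof -
    have "evol (\<tau> + 1 - r) (\<tau> + 1) (f (\<tau> + 1 - r) (z - l * r))
        = evol (\<tau> - r + of_int 1) (\<tau> + of_int 1) (f (\<tau> - r + 1) (z - l * r))"
      by (simp add: algebra_simps)
    also have "\<dots> = evol (\<tau> - r) \<tau> (f (\<tau> - r) (z - l * r))"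
      unfolding fD(2) by (rule evol_period[OF dom st])
    finally show ?thesis by (simp add: push_def)
  qed
  show "push l r f \<tau> (z + 1) i = push l r f \<tau> z i + 1" for i
  proof -
    have "f (\<tau> - r) (z + 1 - l * r) = (\<lambda>i. f (\<tau> - r) (z - l * r) i + of_int 1)"
      using fD(3)[of "\<tau> - r" "z - l * r"] by (simp add: algebra_simps)
    then show ?thesis
      using evol_add_int[OF dom st, of "\<tau> - r" "z - l * r" 1 i] by (simp add: push_def)
  qed
  show "push l r f \<tau> z (j + int n, b) = push l r f \<tau> (z + p) (j, b)" for j b
  proof -
    have eq: "(\<lambda>(j, b). f (\<tau> - r) (z - l * r) (j + 1 * int n, b)) = f (\<tau> - r) (z + p - l * r)"
      using fD(4)[of "\<tau> - r" "z - l * r"] by (auto simp: algebra_simps)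
    show ?thesis
      using evol_index_shift[OF dom _ st, of "\<tau> - r" "z - l * r" 1 j b] dom unfolding eq
      by (simp add: push_def)
  qed
  show "push l r f \<tau> z (j, b) \<le> push l r f \<tau> z (j + 1, b)" for j b
    unfolding push_def by (intro evol_ordered dom fD(5) st)
  show "push l r f \<tau> z i \<le> push l r f \<tau> z' i" if "z \<le> z'" for z' i
    unfolding push_def using that by (intro evol_mono dom fD(6) st) auto
  show "push l r f \<tau> z i = push l r f \<tau>' z i" if F: "\<And>j \<tau> \<tau>' V. F j \<tau> V = F j \<tau>' V" for \<tau>' i
  proof -
    have "shifted_field (t + (\<tau>' - \<tau>)) = shifted_field t" for t
      unfolding shifted_field_def using F[of _ "t + (\<tau>' - \<tau>)" _ t] by (intro ext) (simp split: prod.splits)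
    then have "evol (\<tau> - r + (\<tau>' - \<tau>)) (\<tau> + (\<tau>' - \<tau>)) x = evol (\<tau> - r) \<tau> x" if "dominated x" for x
      by (intro evol_time_shift that st)
    moreover have "f (\<tau>' - r) = f (\<tau> - r)" by (rule fD(7)[OF F])
    ultimately show ?thesis using dom by (simp add: push_def algebra_simps)
  qed
qed

lemma profile_SUP:
  assumes A: "A \<noteq> {}" and f: "\<And>k. k \<in> A \<Longrightarrow> profile p C (f k)"
  shows "profile p C (\<lambda>\<tau> z i. SUP k\<in>A. f k \<tau> z i)"
    and "\<And>k. k \<in> A \<Longrightarrow> f k \<tau> z i \<le> (SUP k\<in>A. f k \<tau> z i)"
proof -
  have bdd: "bdd_above ((\<lambda>k. f k \<tau> z i) ` A)" for \<tau> z i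
    using profile_sandwich(1)[OF f] by (intro bdd_aboveI2[where M = "line p (z + C) i"])
  note upper = cSUP_upper[OF _ bdd] and least = cSUP_least[OF A]
  show "f k \<tau> z i \<le> (SUP k\<in>A. f k \<tau> z i)" if "k \<in> A" for k
    by (rule upper[OF that])
  show "profile p C (\<lambda>\<tau> z i. SUP k\<in>A. f k \<tau> z i)"
  proof (rule profileI)
    fix \<tau> z
    obtain k where k: "k \<in> A" using A by blast
    show "\<bar>(SUP k\<in>A. f k \<tau> z i) - line p z i\<bar> \<le> C" for i
    proof -
      have "(SUP k\<in>A. f k \<tau> z i) \<le> line p z i + C"
      proof (rule least)
        fix k assume "k \<in> A"
        then show "f k \<tau> z i \<le> line p z i + C" using profileD(1)[OF f, of k \<tau> z i] by linarith
      qed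
      moreover have "f k \<tau> z i \<le> (SUP k\<in>A. f k \<tau> z i)" by (rule upper[OF k])
      ultimately show ?thesis using profileD(1)[OF f[OF k], of \<tau> z i] by linarith
    qed
    show "(SUP k\<in>A. f k (\<tau> + 1) z i) = (SUP k\<in>A. f k \<tau> z i)" for i
      using profileD(2)[OF f] by (intro SUP_cong) auto
    show "(SUP k\<in>A. f k \<tau> (z + 1) i) = (SUP k\<in>A. f k \<tau> z i) + 1" for i
    proof (rule antisym)
      show "(SUP k\<in>A. f k \<tau> (z + 1) i) \<le> (SUP k\<in>A. f k \<tau> z i) + 1"
        using profileD(3)[OF f] upper by (intro least) auto
      have "(SUP k\<in>A. f k \<tau> z i) \<le> (SUP k\<in>A. f k \<tau> (z + 1) i) - 1"
      proof (rule least)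
        fix k assume "k \<in> A"
        then show "f k \<tau> z i \<le> (SUP k\<in>A. f k \<tau> (z + 1) i) - 1"
          using profileD(3)[OF f, of k \<tau> z] upper[of k \<tau> "z + 1" i] by simp
      qed
      then show "(SUP k\<in>A. f k \<tau> z i) + 1 \<le> (SUP k\<in>A. f k \<tau> (z + 1) i)" by simp
    qed
    show "(SUP k\<in>A. f k \<tau> z (j + int n, b)) = (SUP k\<in>A. f k \<tau> (z + p) (j, b))" for j b
      using profileD(4)[OF f] by (intro SUP_cong) auto
    show "(SUP k\<in>A. f k \<tau> z (j, b)) \<le> (SUP k\<in>A. f k \<tau> z (j + 1, b))" for j b
      by (rule least) (auto intro: order_trans[OF profileD(5)[OF f] upper])
    show "(SUP k\<in>A. f k \<tau> z i) \<le> (SUP k\<in>A. f k \<tau> z' i)" if "z \<le> z'" for z' i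
      by (rule least) (auto intro: order_trans[OF profileD(6)[OF f that] upper])
    show "(SUP k\<in>A. f k \<tau> z i) = (SUP k\<in>A. f k \<tau>' z i)" if F: "\<And>j \<tau> \<tau>' V. F j \<tau> V = F j \<tau>' V" for \<tau>' i
    proof (rule SUP_cong[OF refl])
      fix k assume "k \<in> A"
      then show "f k \<tau> z i = f k \<tau>' z i" using profileD(7)[OF f F, of k \<tau> \<tau>'] by simp
    qed
  qed
qed

lemma profile_lim:
  assumes f: "\<And>k. profile p C (f k)" and lim: "\<And>\<tau> z i. (\<lambda>k::nat. f k \<tau> z i) \<longlonglongrightarrow> g \<tau> z i"
  shows "profile p C g"
proof (rule profileI)
  fix \<tau> z
  show "\<bar>g \<tau> z i - line p z i\<bar> \<le> C" for i
    by (rule LIMSEQ_le_const2[OF tendsto_rabs[OF tendsto_diff[OF lim tendsto_const]]])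
      (use profileD(1)[OF f] in auto)
  show "g (\<tau> + 1) z i = g \<tau> z i" for i
    using lim[of "\<tau> + 1" z i] lim[of \<tau> z i] unfolding profileD(2)[OF f] by (rule LIMSEQ_unique)
  show "g \<tau> (z + 1) i = g \<tau> z i + 1" for i
    using lim[of \<tau> "z + 1" i] tendsto_add[OF lim[of \<tau> z i] tendsto_const[of 1]]
    unfolding profileD(3)[OF f] by (rule LIMSEQ_unique)
  show "g \<tau> z (j + int n, b) = g \<tau> (z + p) (j, b)" for j b
    using lim[of \<tau> z "(j + int n, b)"] lim[of \<tau> "z + p" "(j, b)"] unfolding profileD(4)[OF f]
    by (rule LIMSEQ_unique)
  show "g \<tau> z (j, b) \<le> g \<tau> z (j + 1, b)" for j b
    by (rule LIMSEQ_le[OF lim lim]) (use profileD(5)[OF f] in auto)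
  show "g \<tau> z i \<le> g \<tau> z' i" if "z \<le> z'" for z' i
    by (rule LIMSEQ_le[OF lim lim]) (use profileD(6)[OF f that] in auto)
  show "g \<tau> z i = g \<tau>' z i" if F: "\<And>j \<tau> \<tau>' V. F j \<tau> V = F j \<tau>' V" for \<tau>' i
  proof (rule LIMSEQ_unique[OF lim])
    have "f k \<tau> = f k \<tau>'" for k by (rule profileD(7)[OF f F])
    then show "(\<lambda>k. f k \<tau> z i) \<longlonglongrightarrow> g \<tau>' z i" using lim[of \<tau>' z i] by simp
  qed
qed

lemma monotone_profiles_converge:
  assumes f: "\<And>k. profile p C (f k)" and mono: "\<And>\<tau> z i. monoseq (\<lambda>k. f k \<tau> z i)"
  obtains g where "profile p C g" "\<And>\<tau> z i. (\<lambda>k::nat. f k \<tau> z i) \<longlonglongrightarrow> g \<tau> z i"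
proof -
  have "\<bar>f k \<tau> z i\<bar> \<le> \<bar>line p z i\<bar> + C" for k \<tau> z i
    using profileD(1)[OF f, of k \<tau> z i] by linarith
  then have "Bseq (\<lambda>k. f k \<tau> z i)" for \<tau> z i
    by (intro BseqI'[of _ "\<bar>line p z i\<bar> + C"]) simp
  then have "(\<lambda>k. f k \<tau> z i) \<longlonglongrightarrow> lim (\<lambda>k. f k \<tau> z i)" for \<tau> z i
    using Bseq_monoseq_convergent[OF _ mono] convergent_LIMSEQ_iff by blast
  note lim = this
  show thesis by (rule that[OF profile_lim[OF f lim] lim])
qed

text \<open>
  The upper limit \<open>X\<close> of the pushed lines as \<open>r\<close> tends to infinity satisfies \<open>X \<le> push l q X\<close>, since the evolution
  is monotone and continuous along decreasing sequences.  Then \<open>push l q X\<close> increases with \<open>q\<close> and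
  its limit is invariant.  All real \<open>r\<close> are used, not only integers, so that the
  result does not depend on time when the forces do not.
\<close>
lemma invariant_profile_exists:
  assumes p: "p \<ge> 0" and l: "drift p l D"
  obtains C Z where "profile p C Z" "\<And>q. 0 \<le> q \<Longrightarrow> push l q Z = Z"
proof -
  define Y where "Y r = push l r (\<lambda>\<tau>. line p)" for r
  have Y: "profile p D (Y r)" if "0 \<le> r" for r
    using profile_push[OF p l profile_line[OF p] that] by (simp add: Y_def)
  have push_Y: "push l q (Y r) = Y (q + r)" if "0 \<le> q" "0 \<le> r" for q r
    unfolding Y_def by (rule push_push[OF profile_line[OF p] that])
  \<comment> \<open>The suprema decrease in \<open>N\<close>; their limit is the upper limit.\<close>
  define S where "S N = (\<lambda>\<tau> z i. SUP r\<in>{real N..}. Y r \<tau> z i)" for N :: nat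
  have S: "profile p D (S N)" and S_upper: "real N \<le> r \<Longrightarrow> Y r \<tau> z i \<le> S N \<tau> z i" for N r \<tau> z i
    using profile_SUP[of "{real N..}" p D Y] Y unfolding S_def by auto
  have S_least: "S N \<tau> z i \<le> c" if "\<And>r. real N \<le> r \<Longrightarrow> Y r \<tau> z i \<le> c" for N \<tau> z i c
    unfolding S_def using that by (intro cSUP_least) auto
  have S_dec: "decseq (\<lambda>N. S N \<tau> z i)" for \<tau> z i
    by (intro decseq_SucI S_least S_upper) simp
  obtain X where X: "profile p D X" and SX: "\<And>\<tau> z i. (\<lambda>N. S N \<tau> z i) \<longlonglongrightarrow> X \<tau> z i"
    using monotone_profiles_converge[OF S decseq_imp_monoseq[OF S_dec]] by blast
  have X_le_S: "X \<tau> z i \<le> S N \<tau> z i" for N \<tau> z i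
    by (rule decseq_ge[OF S_dec SX])
  have X_sub: "X \<tau> z i \<le> push l q X \<tau> z i" if q: "0 \<le> q" for q \<tau> z i
  proof (rule LIMSEQ_le_const[OF push_limit[OF S X q SX]], intro exI allI impI)
    fix N :: nat
    obtain N' :: nat where N': "real N + q \<le> real N'" using real_arch_simple by blast
    have "X \<tau> z i \<le> S N' \<tau> z i" by (rule X_le_S)
    also have "\<dots> \<le> push l q (S N) \<tau> z i"
    proof (rule S_least)
      fix r assume r: "real N' \<le> r"
      have "Y r = push l q (Y (r - q))" using push_Y[OF q, of "r - q"] r N' by simp
      moreover have "push l q (Y (r - q)) \<tau> z i \<le> push l q (S N) \<tau> z i"
        using r N' q by (intro push_mono[OF Y S]) (auto intro: S_upper)
      ultimately show "Y r \<tau> z i \<le> push l q (S N) \<tau> z i" by simp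
    qed
    finally show "X \<tau> z i \<le> push l q (S N) \<tau> z i" .
  qed
  have PX: "profile p (D + D) (push l q X)" if "0 \<le> q" for q
    by (rule profile_push[OF p l X that])
  have PX_mono: "push l q X \<tau> z i \<le> push l r X \<tau> z i" if qr: "0 \<le> q" "q \<le> r" for q r \<tau> z i
  proof -
    have "push l q X \<tau> z i \<le> push l q (push l (r - q) X) \<tau> z i"
      using qr by (intro push_mono[OF X PX]) (auto intro: X_sub)
    then show ?thesis using push_push[OF X, of q "r - q" l] qr by simp
  qed
  have inc: "incseq (\<lambda>N. push l (real N) X \<tau> z i)" for \<tau> z i
    by (intro incseq_SucI PX_mono) auto
  obtain Z where Z: "profile p (D + D) Z"
    and PZ: "\<And>\<tau> z i. (\<lambda>N. push l (real N) X \<tau> z i) \<longlonglongrightarrow> Z \<tau> z i"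
    using monotone_profiles_converge[where f = "\<lambda>N. push l (real N) X", OF PX[OF of_nat_0_le_iff] incseq_imp_monoseq[OF inc]]
    by blast
  have "push l q Z = Z" if q: "0 \<le> q" for q
  proof (intro ext)
    fix \<tau> z i
    have "(\<lambda>N. push l q (push l (real N) X) \<tau> z i) \<longlonglongrightarrow> push l q Z \<tau> z i"
      by (rule push_limit[OF PX Z q PZ]) simp
    moreover have "push l q (push l (real N) X) = push l (q + real N) X" for N
      by (rule push_push[OF X q]) simp
    ultimately have 1: "(\<lambda>N. push l (q + real N) X \<tau> z i) \<longlonglongrightarrow> push l q Z \<tau> z i" by simp
    obtain k :: nat where k: "q \<le> real k" using real_arch_simple by blast
    have 2: "(\<lambda>N. push l (real (N + k)) X \<tau> z i) \<longlonglongrightarrow> Z \<tau> z i"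
      by (rule LIMSEQ_ignore_initial_segment[OF PZ])
    have "(\<lambda>N. push l (q + real N) X \<tau> z i) \<longlonglongrightarrow> Z \<tau> z i"
      by (rule tendsto_sandwich[OF _ _ PZ[of \<tau> z i] 2]; intro always_eventually allI PX_mono)
         (use q k in auto)
    with 1 show "push l q Z \<tau> z i = Z \<tau> z i" by (rule LIMSEQ_unique)
  qed
  then show thesis using that Z by blast
qed

end

section \<open>Semicontinuous envelopes and existence of a hull function\<close>

text \<open>
  On bounded functions the upper limit is finite and its conversion to a real number loses nothing.
\<close>
lemma usc_envelope_between:
  assumes "\<forall>\<^sub>F y in nhds x. a \<le> f y" "\<forall>\<^sub>F y in nhds x. f y \<le> b"
  shows "a \<le> usc_envelope f x" "usc_envelope f x \<le> b"
    and "ereal (usc_envelope f x) = Limsup (nhds x) (\<lambda>y. ereal (f y))"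
proof -
  let ?L = "Limsup (nhds x) (\<lambda>y. ereal (f y))"
  have "ereal a \<le> Liminf (nhds x) (\<lambda>y. ereal (f y))"
    by (rule Liminf_bounded) (use assms(1) in simp)
  also have "\<dots> \<le> ?L" by (rule Liminf_le_Limsup) simp
  finally have lo: "ereal a \<le> ?L" .
  have up: "?L \<le> ereal b"
    by (rule Limsup_bounded) (use assms(2) in simp)
  show eq: "ereal (usc_envelope f x) = ?L"
    unfolding usc_envelope_def using lo up by (cases ?L) auto
  show "a \<le> usc_envelope f x" "usc_envelope f x \<le> b"
    using lo up unfolding eq[symmetric] by simp_all
qed

lemma lsc_envelope_uminus: "lsc_envelope f x = - usc_envelope (\<lambda>y. - f y) x"
proof -
  have "Limsup (nhds x) (\<lambda>y. ereal (- f y)) = - Liminf (nhds x) (\<lambda>y. ereal (f y))"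
    using ereal_Limsup_uminus[of "nhds x" "\<lambda>y. ereal (f y)"] by simp
  then show ?thesis unfolding lsc_envelope_def usc_envelope_def by simp
qed

lemma locally_bounded_nhds:
  assumes "locally_bounded f"
  obtains M where "\<forall>\<^sub>F y in nhds x. \<bar>f y\<bar> \<le> M"
proof -
  obtain e where e: "e > 0" "bounded (f ` ball x e)" using assms unfolding locally_bounded_def by blast
  then obtain M where "\<And>y. y \<in> ball x e \<Longrightarrow> \<bar>f y\<bar> \<le> M"
    unfolding bounded_iff by (metis imageI real_norm_def)
  then have "\<forall>\<^sub>F y in nhds x. \<bar>f y\<bar> \<le> M"
    using e by (intro eventually_nhds_in_open[THEN eventually_mono, of "ball x e"]) auto
  then show thesis by (rule that)
qed

lemma locally_bounded_uminus: "locally_bounded f \<Longrightarrow> locally_bounded (\<lambda>x. - f x)"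
proof -
  assume "locally_bounded f"
  moreover have "(\<lambda>x. - f x) ` S = uminus ` f ` S" for S by (simp add: image_image)
  ultimately show ?thesis by (simp add: locally_bounded_def)
qed

lemma usc_envelope_properties:
  assumes f: "locally_bounded f"
  shows "locally_bounded (usc_envelope f)" and "upper_semicontinuous (usc_envelope f)"
    and "f x \<le> usc_envelope f x"
proof -
  have bd: "\<exists>M. (\<forall>\<^sub>F y in nhds x. - M \<le> f y) \<and> (\<forall>\<^sub>F y in nhds x. f y \<le> M)" for x
  proof -
    obtain M where "\<forall>\<^sub>F y in nhds x. \<bar>f y\<bar> \<le> M" by (rule locally_bounded_nhds[OF f])
    then show ?thesis by (intro exI[of _ M] conjI; elim eventually_mono) auto
  qed
  have real: "ereal (usc_envelope f x) = Limsup (nhds x) (\<lambda>y. ereal (f y))" for x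
    using bd[of x] usc_envelope_between(3) by blast
  have below: "usc_envelope f x \<le> c" if "\<forall>\<^sub>F y in nhds x. f y \<le> c" for x c
    using bd[of x] usc_envelope_between(2)[OF _ that] by blast
  have above: "\<forall>\<^sub>F y in nhds x. f y < c" if "usc_envelope f x < c" for x c
  proof -
    have "Limsup (nhds x) (\<lambda>y. ereal (f y)) < ereal c" using that by (simp flip: real)
    from Limsup_lessD[OF this] show ?thesis by simp
  qed
  show "upper_semicontinuous (usc_envelope f)"
    unfolding upper_semicontinuous_def
  proof (intro allI impI)
    fix x c assume "usc_envelope f x < c"
    then obtain c' where c': "usc_envelope f x < c'" "c' < c" using dense by blast
    have "\<forall>\<^sub>F z in nhds x. \<forall>\<^sub>F y in nhds z. f y < c'"
      using above[OF c'(1)] by (simp add: eventually_eventually)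
    then show "\<forall>\<^sub>F y in nhds x. usc_envelope f y < c"
    proof (rule eventually_mono)
      fix z assume "\<forall>\<^sub>F y in nhds z. f y < c'"
      then have "usc_envelope f z \<le> c'" by (intro below) (auto elim: eventually_mono)
      then show "usc_envelope f z < c" using c' by simp
    qed
  qed
  show "f x \<le> usc_envelope f x"
  proof (rule ccontr)
    assume "\<not> f x \<le> usc_envelope f x"
    then have "\<forall>\<^sub>F y in nhds x. f y < f x" by (intro above) simp
    then show False using eventually_nhds_x_imp_x by fastforce
  qed
  show "locally_bounded (usc_envelope f)"
    unfolding locally_bounded_def
  proof
    fix x
    obtain e where e: "e > 0" "bounded (f ` ball x e)" using f unfolding locally_bounded_def by blast
    then obtain M where M: "\<And>y. y \<in> ball x e \<Longrightarrow> \<bar>f y\<bar> \<le> M"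
    unfolding bounded_iff by (metis imageI real_norm_def)
    have "\<bar>usc_envelope f z\<bar> \<le> M" if z: "z \<in> ball x e" for z
    proof -
      have ball: "\<forall>\<^sub>F y in nhds z. y \<in> ball x e" using z by (intro eventually_nhds_in_open) auto
      have M': "- M \<le> f y" "f y \<le> M" if "y \<in> ball x e" for y
        using M[OF that] by (simp_all add: abs_le_iff)
      have lo: "\<forall>\<^sub>F y in nhds z. - M \<le> f y" by (rule eventually_mono[OF ball M'(1)])
      have up: "\<forall>\<^sub>F y in nhds z. f y \<le> M" by (rule eventually_mono[OF ball M'(2)])
      show ?thesis using usc_envelope_between(1,2)[OF lo up] by simp
    qed
    then have "bounded (usc_envelope f ` ball x e)"
      unfolding bounded_iff by (intro exI[of _ M]) auto
    then show "\<exists>e>0. bounded (usc_envelope f ` ball x e)" using e(1) by blast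
  qed
qed

lemma lsc_envelope_properties:
  assumes f: "locally_bounded f"
  shows "locally_bounded (lsc_envelope f)" and "lower_semicontinuous (lsc_envelope f)"
proof -
  note env = usc_envelope_properties[OF locally_bounded_uminus[OF f]]
  have eq: "lsc_envelope f = (\<lambda>x. - usc_envelope (\<lambda>y. - f y) x)"
    by (rule ext) (rule lsc_envelope_uminus)
  show "locally_bounded (lsc_envelope f)"
    unfolding eq by (rule locally_bounded_uminus[OF env(1)])
  show "lower_semicontinuous (lsc_envelope f)"
    unfolding lower_semicontinuous_def eq
  proof (intro allI impI)
    fix x c assume "c < - usc_envelope (\<lambda>y. - f y) x"
    then have "usc_envelope (\<lambda>y. - f y) x < - c" by linarith
    then have "\<forall>\<^sub>F y in nhds x. usc_envelope (\<lambda>y. - f y) y < - c"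
      using env(2) unfolding upper_semicontinuous_def by blast
    then show "\<forall>\<^sub>F y in nhds x. c < - usc_envelope (\<lambda>y. - f y) y"
      by (rule eventually_mono) simp
  qed
qed

text \<open>
  If \<open>f\<close> is dominated near \<open>y\<^sub>0\<close> by its values on the lines \<open>y k\<close> and is continuous in time there, the upper
  envelope is the limit along these lines.  Applied to a function nondecreasing in \<open>y\<close>
  with \<open>y k\<close> decreasing, and to its negative with \<open>y k\<close> increasing.
\<close>
lemma usc_envelope_one_sided:
  assumes y: "y \<longlonglongrightarrow> y\<^sub>0" and dom: "\<And>k. \<forall>\<^sub>F y' in nhds y\<^sub>0. \<forall>\<tau>. f (\<tau>, y') \<le> f (\<tau>, y k)"
    and cont: "\<And>k. isCont (\<lambda>\<tau>. f (\<tau>, y k)) \<tau>\<^sub>0"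
    and lim: "(\<lambda>k. f (\<tau>\<^sub>0, y k)) \<longlonglongrightarrow> g" and above: "\<And>k. g \<le> f (\<tau>\<^sub>0, y k)"
    and f: "locally_bounded f"
  shows "usc_envelope f (\<tau>\<^sub>0, y\<^sub>0) = g"
proof (rule antisym)
  obtain M where M: "\<forall>\<^sub>F x in nhds (\<tau>\<^sub>0, y\<^sub>0). \<bar>f x\<bar> \<le> M" by (rule locally_bounded_nhds[OF f])
  then have M': "\<forall>\<^sub>F x in nhds (\<tau>\<^sub>0, y\<^sub>0). - M \<le> f x" by (rule eventually_mono) auto
  show "usc_envelope f (\<tau>\<^sub>0, y\<^sub>0) \<le> g"
  proof (rule field_le_epsilon)
    fix e :: real assume "e > 0"
    then obtain k where k: "f (\<tau>\<^sub>0, y k) < g + e"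
      using order_tendstoD(2)[OF lim, of "g + e"] by (auto dest: eventually_happens)
    have "\<forall>\<^sub>F \<tau> in nhds \<tau>\<^sub>0. f (\<tau>, y k) < g + e"
      using order_tendstoD(2)[OF cont[of k, unfolded isCont_def] k] k
      by (simp add: eventually_nhds_conv_at)
    then have "\<forall>\<^sub>F x in nhds (\<tau>\<^sub>0, y\<^sub>0). f (fst x, y k) < g + e \<and> (\<forall>\<tau>. f (\<tau>, snd x) \<le> f (\<tau>, y k))"
      unfolding nhds_prod by (intro eventually_prodI dom)
    then have "\<forall>\<^sub>F x in nhds (\<tau>\<^sub>0, y\<^sub>0). f x \<le> g + e"
      by (rule eventually_mono) (metis less_eq_real_def order_trans prod.collapse)
    from usc_envelope_between(2)[OF M' this] show "usc_envelope f (\<tau>\<^sub>0, y\<^sub>0) \<le> g + e" .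
  qed
  show "g \<le> usc_envelope f (\<tau>\<^sub>0, y\<^sub>0)"
  proof (rule ccontr)
    assume "\<not> g \<le> usc_envelope f (\<tau>\<^sub>0, y\<^sub>0)"
    then have "\<forall>\<^sub>F x in nhds (\<tau>\<^sub>0, y\<^sub>0). usc_envelope f x < g"
      using usc_envelope_properties(2)[OF f] unfolding upper_semicontinuous_def by simp
    moreover have "(\<lambda>k. (\<tau>\<^sub>0, y k)) \<longlonglongrightarrow> (\<tau>\<^sub>0, y\<^sub>0)" by (intro tendsto_intros y)
    ultimately have "\<forall>\<^sub>F k in sequentially. usc_envelope f (\<tau>\<^sub>0, y k) < g"
      by (auto simp: filterlim_iff)
    then obtain k where "usc_envelope f (\<tau>\<^sub>0, y k) < g" by (auto dest: eventually_happens)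
    then show False using above[of k] usc_envelope_properties(3)[OF f, of "(\<tau>\<^sub>0, y k)"] by linarith
  qed
qed

lemma C1_time_deriv:
  assumes "C1_function \<phi>"
  shows "((\<lambda>s. \<phi> (s, y)) has_real_derivative time_deriv \<phi> \<tau> y) (at \<tau>)"
proof -
  obtain D where D: "\<And>x. (\<phi> has_derivative blinfun_apply (D x)) (at x)"
    using assms by (auto simp: C1_function_def)
  have "((\<lambda>s. \<phi> (s, y)) has_derivative (\<lambda>h. blinfun_apply (D (\<tau>, y)) (h, 0))) (at \<tau>)"
    by (rule has_derivative_compose[where g = \<phi> and f = "\<lambda>s. (s, y)"])
       (auto intro!: derivative_eq_intros D)
  then have "(\<lambda>s. \<phi> (s, y)) differentiable (at \<tau>)" by (auto simp: differentiable_def)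
  then show ?thesis
    unfolding time_deriv_def using DERIV_deriv_iff_real_differentiable by blast
qed

text \<open>
  The difference has a local extremum in time, so its derivative vanishes there.
\<close>
lemma smooth_touching:
  assumes \<phi>: "C1_function \<phi>" and f: "((\<lambda>s. f (s, y)) has_real_derivative d) (at \<tau>)"
    and touch: "local_max_at (\<lambda>x. f x - \<phi> x) (\<tau>, y) \<or> local_min_at (\<lambda>x. f x - \<phi> x) (\<tau>, y)"
  shows "time_deriv \<phi> \<tau> y = d"
proof -
  let ?g = "\<lambda>s. f (s, y) - \<phi> (s, y)"
  have g: "(?g has_real_derivative d - time_deriv \<phi> \<tau> y) (at \<tau>)"
    by (intro DERIV_diff f C1_time_deriv \<phi>)
  have lim: "filterlim (\<lambda>s. (s, y)) (nhds (\<tau>, y)) (nhds \<tau>)"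
    by (intro tendsto_intros filterlim_ident)
  have restrict: "\<exists>e>0. \<forall>s. \<bar>\<tau> - s\<bar> < e \<longrightarrow> P (s, y)" if "eventually P (nhds (\<tau>, y))" for P
  proof -
    have "\<forall>\<^sub>F s in nhds \<tau>. P (s, y)" using lim that by (auto simp: filterlim_iff)
    then show ?thesis unfolding eventually_nhds_metric by (auto simp: dist_real_def abs_minus_commute)
  qed
  have "d - time_deriv \<phi> \<tau> y = 0"
    using touch
  proof
    assume "local_max_at (\<lambda>x. f x - \<phi> x) (\<tau>, y)"
    then show ?thesis using restrict DERIV_local_max[OF g] unfolding local_max_at_def by blast
  next
    assume "local_min_at (\<lambda>x. f x - \<phi> x) (\<tau>, y)"
    then show ?thesis using restrict DERIV_local_min[OF g] unfolding local_min_at_def by blast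
  qed
  then show ?thesis by simp
qed

context chain begin

text \<open>
  The classical solutions defined for all times.
\<close>
definition orbit :: "(real \<Rightarrow> int \<times> bool \<Rightarrow> real) \<Rightarrow> bool" where
  "orbit v \<longleftrightarrow> (\<forall>\<tau>. dominated (v \<tau>)) \<and> (\<forall>s t. s \<le> t \<longrightarrow> evol s t (v s) = v t)"

lemma orbit_derivative:
  assumes "orbit v"
  shows "((\<lambda>t. v t i) has_real_derivative (shifted_field \<tau> (v \<tau>) i - \<alpha> * v \<tau> i)) (at \<tau>)"
proof -
  have v: "dominated (v (\<tau> - 1))" "\<And>t. \<tau> - 1 \<le> t \<Longrightarrow> evol (\<tau> - 1) t (v (\<tau> - 1)) = v t"
    using assms by (auto simp: orbit_def)
  have "((\<lambda>t. evol (\<tau> - 1) t (v (\<tau> - 1)) i) has_real_derivative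
     (shifted_field \<tau> (v \<tau>) i - \<alpha> * v \<tau> i)) (at \<tau>)"
    using evol_derivative[OF v(1), where s = "\<tau> - 1" and t = \<tau> and i = i] v(2)[of \<tau>] by simp
  moreover have ev: "\<forall>\<^sub>F t in nhds \<tau>. evol (\<tau> - 1) t (v (\<tau> - 1)) i = v t i"
    using eventually_nhds_in_open[of "{\<tau> - 1<..}" \<tau>] v(2) by (auto elim!: eventually_mono)
  ultimately show ?thesis using DERIV_cong_ev[OF refl ev refl] by blast
qed

lemma orbit_limit:
  assumes v: "\<And>k. orbit (v k)" and lim: "\<And>\<tau> i. (\<lambda>k. v k \<tau> i) \<longlonglongrightarrow> u \<tau> i"
    and bd: "\<And>k \<tau> i. \<bar>v k \<tau> i - u \<tau> i\<bar> \<le> C" and u: "\<And>\<tau>. dominated (u \<tau>)"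
  shows "orbit u"
  unfolding orbit_def
proof (intro conjI allI impI ext)
  fix s t :: real and i assume st: "s \<le> t"
  have "(\<lambda>k. evol s t (v k s) i) \<longlonglongrightarrow> evol s t (u s) i"
    using v by (intro evol_pointwise_limit[where C = C] u st lim bd) (auto simp: orbit_def)
  moreover have "evol s t (v k s) = v k t" for k using v st by (auto simp: orbit_def)
  ultimately have "(\<lambda>k. v k t i) \<longlonglongrightarrow> evol s t (u s) i" by simp
  then show "evol s t (u s) i = u t i" by (rule LIMSEQ_unique[OF _ lim])
qed (rule u)

lemma invariant_profile_orbit:
  assumes Z: "profile p C Z" "\<And>q. 0 \<le> q \<Longrightarrow> push l q Z = Z"
  shows "orbit (\<lambda>\<tau>. Z \<tau> (l * \<tau> + p * y))"
  unfolding orbit_def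
proof (intro conjI allI impI)
  fix s t :: real assume st: "s \<le> t"
  have "Z t (l * t + p * y) = push l (t - s) Z t (l * t + p * y)" using Z(2)[of "t - s"] st by simp
  also have "\<dots> = evol s t (Z s (l * t + p * y - l * (t - s)))"
    unfolding push_def by simp
  also have "l * t + p * y - l * (t - s) = l * s + p * y" by (simp add: algebra_simps)
  finally show "evol s t (Z s (l * s + p * y)) = Z t (l * t + p * y)" by simp
qed (rule dominated_profile[OF Z(1)])

lemma locally_bounded_near_continuous:
  assumes B: "continuous_on UNIV B" and f: "\<And>x. \<bar>f x - B x\<bar> \<le> C"
  shows "locally_bounded f"
  unfolding locally_bounded_def
proof
  fix x :: "real \<times> real"
  have "compact (B ` cball x 1)"
    by (intro compact_continuous_image continuous_on_subset[OF B]) auto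
  then obtain M where M: "\<And>y. y \<in> cball x 1 \<Longrightarrow> \<bar>B y\<bar> \<le> M"
    using compact_imp_bounded by (fastforce simp: bounded_iff)
  have "\<bar>f y\<bar> \<le> M + C" if "y \<in> ball x 1" for y
    using M[of y] f[of y] that by auto
  then have "bounded (f ` ball x 1)" unfolding bounded_iff by (intro exI[of _ "M + C"]) auto
  then show "\<exists>e>0. bounded (f ` ball x e)" using zero_less_one by blast
qed

text \<open>
  The profile is monotone in \<open>y\<close>, so the limits exist, and limits of orbits at bounded distance are orbits.
\<close>
lemma one_sided_limit_of_orbits:
  assumes p: "p > 0" and Z: "profile p C Z" "\<And>q. 0 \<le> q \<Longrightarrow> push l q Z = Z"
    and e: "monoseq e" "e \<longlonglongrightarrow> 0" "\<And>k. \<bar>e k\<bar> \<le> 1"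
  obtains V where "\<And>y. orbit (\<lambda>\<tau>. V \<tau> y)"
    "\<And>\<tau> y i. (\<lambda>k. Z \<tau> (l * \<tau> + p * (y + e k)) i) \<longlonglongrightarrow> V \<tau> y i"
proof -
  have conv: "convergent (\<lambda>k. Z \<tau> (l * \<tau> + p * (y + e k)) i)" for \<tau> y i
  proof (rule Bseq_monoseq_convergent)
    have mono: "Z \<tau> (l * \<tau> + p * (y + c)) i \<le> Z \<tau> (l * \<tau> + p * (y + d)) i" if "c \<le> d" for c d
      using p that by (intro profileD(6)[OF Z(1)]) simp
    show "monoseq (\<lambda>k. Z \<tau> (l * \<tau> + p * (y + e k)) i)"
      using e(1) mono unfolding monoseq_def by meson
    have "- 1 \<le> e k" "e k \<le> 1" for k using e(3)[of k] by linarith+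
    then have "\<bar>Z \<tau> (l * \<tau> + p * (y + e k)) i\<bar>
        \<le> \<bar>Z \<tau> (l * \<tau> + p * (y + 1)) i\<bar> + \<bar>Z \<tau> (l * \<tau> + p * (y + - 1)) i\<bar>" for k
      using mono[of "e k" 1] mono[of "-1" "e k"] by (smt (verit))
    then show "Bseq (\<lambda>k. Z \<tau> (l * \<tau> + p * (y + e k)) i)" by (intro BseqI') simp
  qed
  define V where "V \<tau> y i = lim (\<lambda>k. Z \<tau> (l * \<tau> + p * (y + e k)) i)" for \<tau> y i
  have lim: "(\<lambda>k. Z \<tau> (l * \<tau> + p * (y + e k)) i) \<longlonglongrightarrow> V \<tau> y i" for \<tau> y i
    using conv by (simp add: V_def convergent_LIMSEQ_iff)
  have near_line: "\<bar>Z \<tau> (l * \<tau> + p * (y + e k)) i - line p (l * \<tau> + p * y) i\<bar> \<le> C + p" for k \<tau> y i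
  proof -
    have "line p (l * \<tau> + p * (y + e k)) i = line p (l * \<tau> + p * y) i + p * e k"
      using line_add[of p "l * \<tau> + p * y" "p * e k"] by (simp add: algebra_simps)
    moreover have "\<bar>p * e k\<bar> \<le> p * 1" using p e(3)[of k] by (simp add: abs_mult)
    ultimately show ?thesis using profileD(1)[OF Z(1), of \<tau> "l * \<tau> + p * (y + e k)" i] by linarith
  qed
  then have V_near_line: "\<bar>V \<tau> y i - line p (l * \<tau> + p * y) i\<bar> \<le> C + p" for \<tau> y i
    by (intro LIMSEQ_le_const2[OF tendsto_rabs[OF tendsto_diff[OF lim tendsto_const]]]) auto
  have "orbit (\<lambda>\<tau>. V \<tau> y)" for y
  proof (rule orbit_limit[where v = "\<lambda>k \<tau>. Z \<tau> (l * \<tau> + p * (y + e k))" and C = "2 * (C + p)", OF _ lim])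
    show "orbit (\<lambda>\<tau>. Z \<tau> (l * \<tau> + p * (y + e k)))" for k by (rule invariant_profile_orbit[OF Z])
    show "\<bar>Z \<tau> (l * \<tau> + p * (y + e k)) i - V \<tau> y i\<bar> \<le> 2 * (C + p)" for k \<tau> i
      using near_line[of \<tau> y k i] V_near_line[of \<tau> y i] unfolding abs_le_iff by auto
    show "dominated (V \<tau> y)" for \<tau> by (rule dominated_near_line[OF V_near_line])
  qed
  then show thesis using that lim by blast
qed

text \<open>
  The envelopes are the one-sided limits \<open>V\<close> and \<open>W\<close> in \<open>y\<close>, which are classical orbits; both families of viscosity
  inequalities hold with equality.
\<close>
lemma hull_function_from_invariant_profile:
  assumes p: "p > 0" and Z: "profile p C Z" "\<And>q. 0 \<le> q \<Longrightarrow> push l q Z = Z"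
  shows "hull_function \<alpha> n F p l (\<lambda>j (\<tau>, z). Z \<tau> z (j, True)) (\<lambda>j (\<tau>, z). Z \<tau> z (j, False))"
proof -
  note ZD = profileD[OF Z(1)]
  define U where "U b j = (\<lambda>(\<tau>, y). Z \<tau> (l * \<tau> + p * y) (j, b))" for b j
  define e where "e k = inverse (real (Suc k))" for k
  have e: "e \<longlonglongrightarrow> 0" "decseq e" "\<And>k. \<bar>e k\<bar> \<le> 1" "\<And>k. e k > 0"
    unfolding e_def using LIMSEQ_inverse_real_of_nat
    by (auto simp: decseq_def le_imp_inverse_le inverse_le_1_iff)
  have ne: "(\<lambda>k. - e k) \<longlonglongrightarrow> 0" "incseq (\<lambda>k. - e k)" "\<And>k. \<bar>- e k\<bar> \<le> 1"
    using tendsto_minus[OF e(1)] e(2,3) by (auto simp: decseq_def incseq_def)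
  obtain V where V: "\<And>y. orbit (\<lambda>\<tau>. V \<tau> y)"
    and V_lim: "\<And>\<tau> y i. (\<lambda>k. Z \<tau> (l * \<tau> + p * (y + e k)) i) \<longlonglongrightarrow> V \<tau> y i"
    using one_sided_limit_of_orbits[OF p Z decseq_imp_monoseq[OF e(2)] e(1,3)] by blast
  obtain W where W: "\<And>y. orbit (\<lambda>\<tau>. W \<tau> y)"
    and W_lim: "\<And>\<tau> y i. (\<lambda>k. Z \<tau> (l * \<tau> + p * (y + - e k)) i) \<longlonglongrightarrow> W \<tau> y i"
    using one_sided_limit_of_orbits[OF p Z incseq_imp_monoseq[OF ne(2)] ne(1,3)] by blast
  have U_mono: "U b j (\<tau>, y) \<le> U b j (\<tau>, y')" if "y \<le> y'" for b j \<tau> y y'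
    unfolding U_def using p that by (auto intro!: ZD(6))
  have U_bd: "locally_bounded (U b j)" for b j
  proof (rule locally_bounded_near_continuous)
    show "continuous_on UNIV (\<lambda>(\<tau>, y). line p (l * \<tau> + p * y) (j, b))"
      unfolding line_def split_def by (auto intro!: continuous_intros) 
    show "\<bar>U b j x - (\<lambda>(\<tau>, y). line p (l * \<tau> + p * y) (j, b)) x\<bar> \<le> C" for x
      using ZD(1) by (auto simp: U_def split: prod.splits)
  qed
  have U_cont: "isCont (\<lambda>\<tau>. U b j (\<tau>, y)) \<tau>" for b j \<tau> y
    using DERIV_isCont[OF orbit_derivative[OF invariant_profile_orbit[OF Z, of y], of "(j, b)" \<tau>]]
    by (simp add: U_def)
  have usc: "usc_envelope (U b j) (\<tau>, y) = V \<tau> y (j, b)" for b j \<tau> y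
  proof (rule usc_envelope_one_sided[where y = "\<lambda>k. y + e k"])
    show "(\<lambda>k. y + e k) \<longlonglongrightarrow> y" using tendsto_add[OF tendsto_const e(1), of y] by simp
    show "\<forall>\<^sub>F y' in nhds y. \<forall>\<tau>. U b j (\<tau>, y') \<le> U b j (\<tau>, y + e k)" for k
      using eventually_nhds_in_open[of "{..<y + e k}" y] e(4)[of k]
      by (auto elim!: eventually_mono intro!: U_mono)
    show lim: "(\<lambda>k. U b j (\<tau>, y + e k)) \<longlonglongrightarrow> V \<tau> y (j, b)"
      using V_lim by (simp add: U_def)
    show "V \<tau> y (j, b) \<le> U b j (\<tau>, y + e k)" for k
      by (rule decseq_ge[OF _ lim]) (use e(2) in \<open>auto simp: decseq_def intro!: U_mono\<close>)
  qed (rule U_cont U_bd)+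
  have lsc: "lsc_envelope (U b j) (\<tau>, y) = W \<tau> y (j, b)" for b j \<tau> y
  proof -
    have "usc_envelope (\<lambda>x. - U b j x) (\<tau>, y) = - W \<tau> y (j, b)"
    proof (rule usc_envelope_one_sided[where y = "\<lambda>k. y + - e k"])
      show "(\<lambda>k. y + - e k) \<longlonglongrightarrow> y" using tendsto_add[OF tendsto_const ne(1), of y] by simp
      show "\<forall>\<^sub>F y' in nhds y. \<forall>\<tau>. - U b j (\<tau>, y') \<le> - U b j (\<tau>, y + - e k)" for k
        using eventually_nhds_in_open[of "{y + - e k<..}" y] e(4)[of k]
        by (auto elim!: eventually_mono intro!: U_mono)
      show lim: "(\<lambda>k. - U b j (\<tau>, y + - e k)) \<longlonglongrightarrow> - W \<tau> y (j, b)"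
        using tendsto_minus[OF W_lim] by (simp add: U_def)
      show "- W \<tau> y (j, b) \<le> - U b j (\<tau>, y + - e k)" for k
        by (rule decseq_ge[OF _ lim]) (use e(2) in \<open>auto simp: decseq_def intro!: U_mono\<close>)
    qed (auto intro!: U_cont locally_bounded_uminus U_bd continuous_minus)
    then show ?thesis by (simp add: lsc_envelope_uminus)
  qed
  have shift: "Z \<tau> (l * \<tau> + p * (y + d)) (j + int n, b) = Z \<tau> (l * \<tau> + p * (y + 1 + d)) (j, b)" for \<tau> y d j b
    unfolding ZD(4) by (simp add: algebra_simps)
  have V_shift: "V \<tau> y (j + int n, b) = V \<tau> (y + 1) (j, b)" for \<tau> y j b
    using V_lim[of \<tau> y "(j + int n, b)"] V_lim[of \<tau> "y + 1" "(j, b)"] unfolding shift by (rule LIMSEQ_unique)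
  have W_shift: "W \<tau> y (j + int n, b) = W \<tau> (y + 1) (j, b)" for \<tau> y j b
    using W_lim[of \<tau> y "(j + int n, b)"] W_lim[of \<tau> "y + 1" "(j, b)"] unfolding shift by (rule LIMSEQ_unique)
  have V_touch: "time_deriv \<phi> \<tau> y = shifted_field \<tau> (V \<tau> y) (j, b) - \<alpha> * V \<tau> y (j, b)"
    if "C1_function \<phi>" "local_max_at (\<lambda>x. usc_envelope (U b j) x - \<phi> x) (\<tau>, y)" for \<phi> \<tau> y j b
    using that orbit_derivative[OF V, of y "(j, b)" \<tau>] by (intro smooth_touching) (auto simp: usc)
  have W_touch: "time_deriv \<phi> \<tau> y = shifted_field \<tau> (W \<tau> y) (j, b) - \<alpha> * W \<tau> y (j, b)"
    if "C1_function \<phi>" "local_min_at (\<lambda>x. lsc_envelope (U b j) x - \<phi> x) (\<tau>, y)" for \<phi> \<tau> y j b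
    using that orbit_derivative[OF W, of y "(j, b)" \<tau>] by (intro smooth_touching) (auto simp: lsc)
  have sub: "visc_subsolution \<alpha> n F (\<lambda>j. usc_envelope (U True j)) (\<lambda>j. usc_envelope (U False j))"
    unfolding visc_subsolution_def quasi_periodic_def
    using usc_envelope_properties(1,2)[OF U_bd] V_touch V_shift
    by (auto simp: usc shifted_field_def right_diff_distrib)
  have super: "visc_supersolution \<alpha> n F (\<lambda>j. lsc_envelope (U True j)) (\<lambda>j. lsc_envelope (U False j))"
    unfolding visc_supersolution_def quasi_periodic_def
    using lsc_envelope_properties(1,2)[OF U_bd] W_touch W_shift
    by (auto simp: lsc shifted_field_def right_diff_distrib)
  have sol: "visc_solution \<alpha> n F (U True) (U False)"
    unfolding visc_solution_def using sub super U_bd by simp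
  have hull: "hull_profile n p (\<lambda>j (\<tau>, z). Z \<tau> z (j, b))" for b
    unfolding hull_profile_def
  proof (intro conjI allI)
    fix j \<tau> z
    show "locally_bounded (\<lambda>(\<tau>, z). Z \<tau> z (j, b))"
    proof (rule locally_bounded_near_continuous)
      show "continuous_on UNIV (\<lambda>(\<tau>::real, z). line p z (j, b))"
        unfolding line_def split_def by (auto intro!: continuous_intros)
      show "\<bar>(\<lambda>(\<tau>, z). Z \<tau> z (j, b)) x - (\<lambda>(\<tau>, z). line p z (j, b)) x\<bar> \<le> C" for x
        using ZD(1) by (auto split: prod.splits)
    qed
    show "\<exists>C. \<forall>\<tau> z. \<bar>(\<lambda>(\<tau>, z). Z \<tau> z (j, b)) (\<tau>, z) - z\<bar> \<le> C"
    proof (intro exI allI)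
      show "\<bar>(\<lambda>(\<tau>, z). Z \<tau> z (j, b)) (\<tau>, z) - z\<bar> \<le> C + \<bar>p * real_of_int j / real n\<bar>" for \<tau> z
        using ZD(1)[of \<tau> z "(j, b)"] unfolding line_def by (simp only: prod.case)
    qed
    show "mono (\<lambda>z. (\<lambda>(\<tau>, z). Z \<tau> z (j, b)) (\<tau>, z))" by (rule monoI) (simp add: ZD(6))
  qed (auto simp: ZD(2,3,4,5))
  have indep: "time_independent (\<lambda>j (\<tau>, z). Z \<tau> z (j, b))" if "\<forall>j \<tau> \<tau>' V. F j \<tau> V = F j \<tau>' V" for b
    unfolding time_independent_def using ZD(7) that by (metis prod.case)
  have "U b = (\<lambda>j (\<tau>, y). Z \<tau> (l * \<tau> + p * y) (j, b))" for b
    by (rule ext) (rule U_def)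
  then show ?thesis
    unfolding hull_function_def using sol hull indep by auto
qed

end

section \<open>Comparison of viscosity subsolutions with smooth families of orbits\<close>

text \<open>
  Otherwise the open sets \<open>u < u z\<close> with \<open>z\<close> in \<open>S\<close> cover \<open>S\<close>, and the largest \<open>u z\<close> of a finite subcover
  is not covered.
\<close>
lemma upper_semicontinuous_attains_max:
  assumes u: "upper_semicontinuous u" and S: "compact S" "S \<noteq> {}"
  obtains x where "x \<in> S" "\<And>z. z \<in> S \<Longrightarrow> u z \<le> u x"
proof (rule ccontr)
  assume no_max: "\<not> thesis"
  define W where "W z = {y. u y < u z}" for z
  have W_open: "open (W z)" for z
    using u unfolding W_def upper_semicontinuous_def
    by (subst open_subopen) (fastforce simp: eventually_nhds)
  have "\<exists>z\<in>S. u x < u z" if "x \<in> S" for x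
    using that no_max \<open>\<And>x. \<lbrakk>x \<in> S; \<And>z. z \<in> S \<Longrightarrow> u z \<le> u x\<rbrakk> \<Longrightarrow> thesis\<close> by (meson not_le)
  then have "S \<subseteq> (\<Union>z\<in>S. W z)" by (auto simp: W_def)
  then obtain C where C: "C \<subseteq> S" "finite C" "S \<subseteq> (\<Union>z\<in>C. W z)"
    using compactE_image[OF S(1), of S W] W_open by auto
  then have "C \<noteq> {}" using S(2) by auto
  then have "Max (u ` C) \<in> u ` C" using C(2) by (intro Max_in) auto
  then obtain z where z: "z \<in> C" "Max (u ` C) = u z" by auto
  then have "u w \<le> u z" if "w \<in> C" for w
    using C(2) that Max_ge[of "u ` C" "u w"] by simp
  moreover obtain w where "w \<in> C" "u z < u w" using C z(1) by (force simp: W_def)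
  ultimately show False by (meson not_le)
qed

lemma upper_semicontinuous_diff_continuous:
  assumes u: "upper_semicontinuous u" and \<phi>: "continuous_on UNIV \<phi>"
  shows "upper_semicontinuous (\<lambda>x. u x - \<phi> x)"
  unfolding upper_semicontinuous_def
proof (intro allI impI)
  fix x c assume c: "u x - \<phi> x < c"
  define e where "e = (c - (u x - \<phi> x)) / 2"
  have e: "e > 0" using c by (simp add: e_def)
  have "\<forall>\<^sub>F y in nhds x. u y < u x + e"
    by (rule u[unfolded upper_semicontinuous_def, rule_format]) (use e in simp)
  moreover have "\<forall>\<^sub>F y in nhds x. \<phi> x - e < \<phi> y"
  proof -
    have "(\<phi> \<longlongrightarrow> \<phi> x) (at x)"
      using \<phi> unfolding continuous_on_eq_continuous_at[OF open_UNIV] isCont_def by blast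
    then have "\<forall>\<^sub>F y in at x. \<phi> x - e < \<phi> y" by (rule order_tendstoD(1)) (use e in simp)
    then show ?thesis using e by (simp add: eventually_nhds_conv_at)
  qed
  ultimately show "\<forall>\<^sub>F y in nhds x. u y - \<phi> y < c"
  proof eventually_elim
    case (elim y)
    moreover have "2 * e = c - (u x - \<phi> x)" by (simp add: e_def)
    ultimately show ?case by linarith
  qed
qed

lemma C1_function_separable:
  assumes f: "\<And>\<tau>. (f has_real_derivative f' \<tau>) (at \<tau>)" "continuous_on UNIV f'"
    and g: "\<And>y. (g has_real_derivative g' y) (at y)" "continuous_on UNIV g'"
  shows "C1_function (\<lambda>(\<tau>, y). f \<tau> + g y)" and "time_deriv (\<lambda>(\<tau>, y). f \<tau> + g y) \<tau> y = f' \<tau>"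
proof -
  define D :: "real \<times> real \<Rightarrow> (real \<times> real) \<Rightarrow>\<^sub>L real"
    where "D x = f' (fst x) *\<^sub>R fst_blinfun + g' (snd x) *\<^sub>R snd_blinfun" for x
  have D_apply: "blinfun_apply (D x) = (\<lambda>h. f' (fst x) * fst h + g' (snd x) * snd h)" for x
    by (rule ext) (simp add: D_def plus_blinfun.rep_eq scaleR_blinfun.rep_eq)
  have f_der: "(f has_derivative (\<lambda>h. f' \<tau> * h)) (at \<tau>)" for \<tau>
    using f(1) by (simp add: has_field_derivative_def mult_commute_abs)
  have g_der: "(g has_derivative (\<lambda>h. g' y * h)) (at y)" for y
    using g(1) by (simp add: has_field_derivative_def mult_commute_abs)
  have "((\<lambda>x. f (fst x) + g (snd x)) has_derivative blinfun_apply (D x)) (at x)" for x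
    unfolding D_apply
    by (intro has_derivative_add has_derivative_compose[OF has_derivative_fst[OF has_derivative_ident] f_der]
        has_derivative_compose[OF has_derivative_snd[OF has_derivative_ident] g_der])
  moreover have "continuous_on UNIV D"
    unfolding D_def
    by (intro continuous_intros continuous_on_compose2[OF f(2)] continuous_on_compose2[OF g(2)]) auto
  ultimately show "C1_function (\<lambda>(\<tau>, y). f \<tau> + g y)"
    unfolding C1_function_def split_def by blast
  have "((\<lambda>s. f s + g y) has_real_derivative f' \<tau>) (at \<tau>)"
    by (auto intro!: derivative_eq_intros f(1))
  then show "time_deriv (\<lambda>(\<tau>, y). f \<tau> + g y) \<tau> y = f' \<tau>"
    unfolding time_deriv_def by (simp add: DERIV_imp_deriv)
qed

text \<open>
  Test functions must be defined on the whole plane, whereas the solutions of interest start at time \<open>0\<close>.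
  Integrating the derivative frozen at its initial value for negative times extends them.
\<close>
lemma C1_extension_to_negative_times:
  fixes f f' :: "real \<Rightarrow> real"
  assumes f: "continuous_on {0..} f" "\<And>\<tau>. \<tau> > 0 \<Longrightarrow> (f has_real_derivative f' \<tau>) (at \<tau>)"
    and f': "continuous_on {0..} f'"
  obtains h where "\<And>\<tau>. (h has_real_derivative f' (max 0 \<tau>)) (at \<tau>)"
    "continuous_on UNIV (\<lambda>\<tau>. f' (max 0 \<tau>))" "\<And>\<tau>. 0 \<le> \<tau> \<Longrightarrow> h \<tau> = f \<tau>"
proof -
  have cont: "continuous_on UNIV (\<lambda>\<tau>. f' (max 0 \<tau>))"
    by (intro continuous_on_compose2[OF f'] continuous_intros) auto
  then obtain G where G: "\<And>\<tau>. (G has_real_derivative f' (max 0 \<tau>)) (at \<tau>)"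
    using einterval_antiderivative[of "- \<infinity>" \<infinity> "\<lambda>\<tau>. f' (max 0 \<tau>)"]
    by (auto simp: continuous_on_eq_continuous_at has_real_derivative_iff_has_vector_derivative)
  have "G \<tau> + (f 0 - G 0) = f \<tau>" if \<tau>: "0 \<le> \<tau>" for \<tau>
  proof (cases "\<tau> = 0")
    case False
    have "f \<tau> - G \<tau> = f 0 - G 0"
    proof (rule DERIV_isconst_end[where f = "\<lambda>\<tau>. f \<tau> - G \<tau>"])
      show "0 < \<tau>" using False \<tau> by simp
      show "continuous_on {0..\<tau>} (\<lambda>\<tau>. f \<tau> - G \<tau>)"
        by (intro continuous_intros continuous_on_subset[OF f(1)] DERIV_continuous_on[OF DERIV_subset[OF G]]) auto
      show "((\<lambda>\<tau>. f \<tau> - G \<tau>) has_real_derivative 0) (at r)" if "0 < r" "r < \<tau>" for r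
        using DERIV_diff[OF f(2)[OF that(1)] G[of r]] that by simp
    qed
    then show ?thesis by simp
  qed simp
  moreover have "((\<lambda>\<tau>. G \<tau> + (f 0 - G 0)) has_real_derivative f' (max 0 \<tau>)) (at \<tau>)" for \<tau>
    using DERIV_add[OF G DERIV_const] by simp
  ultimately show thesis using that cont by blast
qed

text \<open>
  A viscosity subsolution \<open>u\<close> against a family \<open>c\<close> of classical solutions that is Lipschitz in \<open>y\<close>.  The
  growth condition makes the maximum below interior in time.
\<close>
locale viscosity_comparison =
  fixes Q :: "real \<Rightarrow> ('i \<Rightarrow> real) \<Rightarrow> 'i \<Rightarrow> real" and a K N A :: real
    and u :: "'i \<Rightarrow> real \<times> real \<Rightarrow> real" and c :: "'i \<Rightarrow> real \<Rightarrow> real \<Rightarrow> real"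
  assumes a_nonneg: "a \<ge> 0" and K_pos: "K > 0"
    and Q_mono_shift: "\<And>t x y d i. (\<And>k. x k \<le> y k + d) \<Longrightarrow> d \<ge> 0 \<Longrightarrow> Q t x i \<le> Q t y i + K * d"
    and u_usc: "\<And>i. upper_semicontinuous (u i)"
    and u_test: "\<And>i \<phi> \<tau> y. C1_function \<phi> \<Longrightarrow> local_max_at (\<lambda>x. u i x - \<phi> x) (\<tau>, y) \<Longrightarrow>
      time_deriv \<phi> \<tau> y \<le> Q \<tau> (\<lambda>k. u k (\<tau>, y)) i - a * u i (\<tau>, y)"
    and c_cont: "\<And>i y. continuous_on {0..} (\<lambda>\<tau>. c i \<tau> y)"
    and c_deriv: "\<And>i \<tau> y. \<tau> > 0 \<Longrightarrow>
      ((\<lambda>\<tau>. c i \<tau> y) has_real_derivative (Q \<tau> (\<lambda>k. c k \<tau> y) i - a * c i \<tau> y)) (at \<tau>)"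
    and Q_cont: "\<And>i y. continuous_on {0..} (\<lambda>\<tau>. Q \<tau> (\<lambda>k. c k \<tau> y) i)"
    and c_lip: "\<And>i \<tau> y y'. \<tau> \<ge> 0 \<Longrightarrow> \<bar>c i \<tau> y - c i \<tau> y'\<bar> \<le> N * exp (4 * K * \<tau>) * \<bar>y - y'\<bar>"
    and initial: "\<And>i y. u i (0, y) \<le> c i 0 y"
    and growth: "\<And>i \<tau> y. \<tau> \<ge> 0 \<Longrightarrow> u i (\<tau>, y) - c i \<tau> y \<le> A * (1 + \<tau>)"
begin

lemma N_nonneg: "N \<ge> 0"
  using c_lip[of 0 undefined 0 1] by simp

text \<open>
  The comparison is a contraction.  If \<open>u\<close> exceeded \<open>c\<close> by more than half of the assumed bound, consider a
  maximum of \<open>u i - \<phi>\<close> near \<open>y = y\<^sub>0\<close>, where \<open>\<phi>\<close> is the classical solution at \<open>y\<^sub>0\<close> plus the halved bound plus a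
  steep parabola in \<open>y\<close>.  There the halved bound
  has time derivative \<open>2 K M\<close>, whereas the assumed bound lets the fields differ by at most
  \<open>(5/4) K M\<close>, both times \<open>exp (4 K \<tau>)\<close>.
\<close>
lemma halving:
  assumes M: "M > 0" and bound: "\<And>i \<tau> y. \<tau> \<ge> 0 \<Longrightarrow> u i (\<tau>, y) - c i \<tau> y \<le> M * exp (4 * K * \<tau>)"
    and \<tau>\<^sub>1: "\<tau>\<^sub>1 \<ge> 0"
  shows "u i (\<tau>\<^sub>1, y\<^sub>0) - c i \<tau>\<^sub>1 y\<^sub>0 \<le> M / 2 * exp (4 * K * \<tau>\<^sub>1)"
proof (rule ccontr)
  assume contra: "\<not> u i (\<tau>\<^sub>1, y\<^sub>0) - c i \<tau>\<^sub>1 y\<^sub>0 \<le> M / 2 * exp (4 * K * \<tau>\<^sub>1)"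
  define E where "E \<tau> = exp (4 * K * \<tau>)" for \<tau>
  have E_pos: "E \<tau> > 0" for \<tau> by (simp add: E_def)
  \<comment> \<open>On this scale the variation of \<open>c\<close> in \<open>y\<close> costs only a quarter of \<open>M\<close>.\<close>
  define \<delta> where "\<delta> = M / (4 * (N + 1))"
  have \<delta>: "\<delta> > 0" using M N_nonneg by (simp add: \<delta>_def)
  have N\<delta>: "N * \<delta> \<le> M / 4"
  proof -
    have "N * \<delta> = (N / (N + 1)) * (M / 4)" by (simp add: \<delta>_def)
    also have "\<dots> \<le> 1 * (M / 4)" using N_nonneg M by (intro mult_right_mono) auto
    finally show ?thesis by simp
  qed
  have c_near: "c k \<tau> y - c k \<tau> y\<^sub>0 \<le> M / 4 * E \<tau>" if "\<tau> \<ge> 0" "\<bar>y - y\<^sub>0\<bar> \<le> \<delta>" for k \<tau> y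
  proof -
    have "c k \<tau> y - c k \<tau> y\<^sub>0 \<le> N * E \<tau> * \<bar>y - y\<^sub>0\<bar>" using c_lip[OF that(1), of k y y\<^sub>0] by (simp add: E_def)
    also have "\<dots> \<le> N * E \<tau> * \<delta>" using that N_nonneg E_pos[of \<tau>] by (intro mult_left_mono) auto
    also have "\<dots> = N * \<delta> * E \<tau>" by simp
    also have "\<dots> \<le> M / 4 * E \<tau>" using E_pos[of \<tau>] by (intro mult_right_mono N\<delta>) auto
    finally show ?thesis .
  qed
  \<comment> \<open>After this time the linear growth of \<open>u - c\<close> is below the exponential barrier.\<close>
  define T where "T = \<tau>\<^sub>1 + 1 + \<bar>A\<bar> / (M * K\<^sup>2)"
  have "\<bar>A\<bar> / (M * K\<^sup>2) \<ge> 0" using M by simp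
  then have T1: "T > \<tau>\<^sub>1" "T \<ge> 1" "\<bar>A\<bar> / (M * K\<^sup>2) \<le> T" using \<tau>\<^sub>1 unfolding T_def by linarith+
  have T: "A * (1 + T) \<le> M / 4 * E T"
  proof -
    have "A * (1 + T) \<le> \<bar>A\<bar> * (2 * T)" using T1 by (intro mult_mono) auto
    also have "\<dots> \<le> (T * (M * K\<^sup>2)) * (2 * T)"
      using T1 M K_pos by (intro mult_right_mono) (simp_all add: field_simps)
    also have "\<dots> = M / 4 * ((4 * K * T)\<^sup>2 / 2)" by (simp add: power2_eq_square)
    also have "\<dots> \<le> M / 4 * E T"
    proof (rule mult_left_mono)
      have "0 \<le> 4 * K * T" using K_pos T1 by simp
      then show "(4 * K * T)\<^sup>2 / 2 \<le> E T"
        using exp_lower_Taylor_quadratic[of "4 * K * T"] unfolding E_def by linarith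
    qed (use M in simp)
    finally show ?thesis .
  qed
  have T0: "T > 0" using T1 by simp
  \<comment> \<open>So steep that the parabola exceeds every admissible excess at \<open>\<bar>y - y\<^sub>0\<bar> = \<delta>\<close>.\<close>
  define B where "B = 5 / 4 * M * E T / \<delta>\<^sup>2"
  define r where "r = (\<lambda>\<tau>. Q \<tau> (\<lambda>k. c k \<tau> y\<^sub>0) i - a * c i \<tau> y\<^sub>0)"
  obtain h where h: "\<And>\<tau>. (h has_real_derivative r (max 0 \<tau>)) (at \<tau>)"
    "continuous_on UNIV (\<lambda>\<tau>. r (max 0 \<tau>))" "\<And>\<tau>. 0 \<le> \<tau> \<Longrightarrow> h \<tau> = c i \<tau> y\<^sub>0"
    using C1_extension_to_negative_times[of "\<lambda>\<tau>. c i \<tau> y\<^sub>0" r] c_cont c_deriv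
      continuous_on_diff[OF Q_cont continuous_on_mult_left[OF c_cont]]
    unfolding r_def by blast
  define f where "f = (\<lambda>\<tau>. h \<tau> + M / 2 * E \<tau>)"
  define f' where "f' = (\<lambda>\<tau>. r (max 0 \<tau>) + M / 2 * (4 * K * E \<tau>))"
  define g where "g = (\<lambda>y. B * (y - y\<^sub>0)\<^sup>2)"
  define \<phi> where "\<phi> = (\<lambda>(\<tau>, y). f \<tau> + g y)"
  have f_der: "(f has_real_derivative f' \<tau>) (at \<tau>)" for \<tau>
    unfolding f_def f'_def E_def by (auto intro!: derivative_eq_intros h(1))
  have f'_cont: "continuous_on UNIV f'"
    unfolding f'_def E_def by (intro continuous_intros h(2))
  have g_der: "(g has_real_derivative 2 * B * (y - y\<^sub>0)) (at y)" for y
    unfolding g_def by (auto intro!: derivative_eq_intros)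
  have g'_cont: "continuous_on UNIV (\<lambda>y. 2 * B * (y - y\<^sub>0))" by (intro continuous_intros)
  note \<phi>_C1 = C1_function_separable[OF f_der f'_cont g_der g'_cont, folded \<phi>_def]
  have \<phi>_cont: "continuous_on UNIV \<phi>"
    using \<phi>_C1(1) unfolding C1_function_def
    by (metis has_derivative_continuous continuous_at_imp_continuous_on)
  define \<Psi> where "\<Psi> = (\<lambda>x. u i x - \<phi> x)"
  have \<Psi>: "\<Psi> (\<tau>, y) = u i (\<tau>, y) - c i \<tau> y\<^sub>0 - M / 2 * E \<tau> - B * (y - y\<^sub>0)\<^sup>2" if "\<tau> \<ge> 0" for \<tau> y
    using h(3)[OF that] by (simp add: \<Psi>_def \<phi>_def f_def g_def)
  define S where "S = {0..T} \<times> {y\<^sub>0 - \<delta>..y\<^sub>0 + \<delta>}"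
  have S: "compact S" "(\<tau>\<^sub>1, y\<^sub>0) \<in> S"
    using \<tau>\<^sub>1 T1 \<delta> by (auto simp: S_def intro!: compact_Times)
  obtain x where x: "x \<in> S" "\<And>z. z \<in> S \<Longrightarrow> \<Psi> z \<le> \<Psi> x"
    using upper_semicontinuous_attains_max[OF upper_semicontinuous_diff_continuous[OF u_usc[of i] \<phi>_cont] S(1)] S(2)
    unfolding \<Psi>_def by (metis empty_iff)
  obtain \<tau> y where xy: "x = (\<tau>, y)" by force
  have \<tau>y: "0 \<le> \<tau>" "\<tau> \<le> T" "\<bar>y - y\<^sub>0\<bar> \<le> \<delta>" using x(1) by (auto simp: S_def xy abs_le_iff)
  have "\<Psi> (\<tau>\<^sub>1, y\<^sub>0) > 0" using contra \<tau>\<^sub>1 by (simp add: \<Psi> E_def)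
  then have \<Psi>_pos: "\<Psi> (\<tau>, y) > 0" using x(2)[OF S(2)] by (simp add: xy)
  have u_bound: "u k (\<tau>, y) \<le> c k \<tau> y\<^sub>0 + 5 / 4 * M * E \<tau>" for k
    using bound[OF \<tau>y(1), of k y] c_near[OF \<tau>y(1,3), of k] by (simp add: E_def)
  have "B \<ge> 0" using M E_pos[of T] by (simp add: B_def)
  then have By: "B * (y - y\<^sub>0)\<^sup>2 \<ge> 0" by simp
  have ME: "M * E \<tau> > 0" using M E_pos by simp
  have "\<tau> \<noteq> 0"
  proof
    assume "\<tau> = 0"
    then show False
      using \<Psi>_pos \<Psi>[of 0 y] By initial[of i y] c_near[of 0 y i] \<tau>y(3) M by (simp add: E_def)
  qed
  moreover have "\<tau> \<noteq> T"
  proof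
    assume \<tau>T: "\<tau> = T"
    have "u i (T, y) - c i T y\<^sub>0 \<le> A * (1 + T) + M / 4 * E T"
      using growth[of T i y] c_near[of T y i] \<tau>y T0 by simp
    then show False using \<Psi>_pos \<Psi>[of T y] By T ME T0 unfolding \<tau>T by simp
  qed
  moreover have "\<bar>y - y\<^sub>0\<bar> \<noteq> \<delta>"
  proof
    assume "\<bar>y - y\<^sub>0\<bar> = \<delta>"
    then have "(y - y\<^sub>0)\<^sup>2 = \<delta>\<^sup>2" by (metis power2_abs)
    then have "B * (y - y\<^sub>0)\<^sup>2 = 5 / 4 * M * E T" using \<delta> by (simp add: B_def)
    moreover have "5 / 4 * M * E \<tau> \<le> 5 / 4 * M * E T"
      using \<tau>y K_pos M by (intro mult_left_mono) (auto simp: E_def)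
    ultimately show False using \<Psi>_pos \<Psi>[OF \<tau>y(1), of y] u_bound[of i] ME by simp
  qed
  ultimately have interior: "x \<in> {0<..<T} \<times> {y\<^sub>0 - \<delta><..<y\<^sub>0 + \<delta>}"
    using \<tau>y by (auto simp: xy abs_le_iff) 
  have "local_max_at (\<lambda>z. u i z - \<phi> z) (\<tau>, y)"
    unfolding local_max_at_def
  proof (rule eventually_mono[OF eventually_nhds_in_open])
    show "open ({0<..<T} \<times> {y\<^sub>0 - \<delta><..<y\<^sub>0 + \<delta>})" by (intro open_Times) auto
    show "(\<tau>, y) \<in> {0<..<T} \<times> {y\<^sub>0 - \<delta><..<y\<^sub>0 + \<delta>}" using interior by (simp add: xy)
    fix z assume "z \<in> {0<..<T} \<times> {y\<^sub>0 - \<delta><..<y\<^sub>0 + \<delta>}"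
    then have "z \<in> S" by (auto simp: S_def)
    then show "u i z - \<phi> z \<le> u i (\<tau>, y) - \<phi> (\<tau>, y)" using x(2) by (simp add: \<Psi>_def xy)
  qed
  from u_test[OF \<phi>_C1(1) this]
  have "f' \<tau> \<le> Q \<tau> (\<lambda>k. u k (\<tau>, y)) i - a * u i (\<tau>, y)"
    unfolding \<phi>_C1(2) .
  moreover have "Q \<tau> (\<lambda>k. u k (\<tau>, y)) i \<le> Q \<tau> (\<lambda>k. c k \<tau> y\<^sub>0) i + K * (5 / 4 * M * E \<tau>)"
    by (intro Q_mono_shift u_bound) (use ME in simp)
  moreover have "a * c i \<tau> y\<^sub>0 \<le> a * u i (\<tau>, y)"
    using \<Psi>_pos \<Psi>[OF \<tau>y(1), of y] By ME a_nonneg by (intro mult_left_mono) auto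
  moreover have "f' \<tau> = Q \<tau> (\<lambda>k. c k \<tau> y\<^sub>0) i - a * c i \<tau> y\<^sub>0 + 2 * (K * (M * E \<tau>))"
    using \<tau>y(1) by (simp add: f'_def r_def max_def)
  moreover have "K * (5 / 4 * M * E \<tau>) = 5 / 4 * (K * (M * E \<tau>))" by simp
  moreover have "K * (M * E \<tau>) > 0" using K_pos ME by simp
  ultimately show False by linarith
qed

lemma comparison:
  assumes "\<tau> \<ge> 0"
  shows "u i (\<tau>, y) \<le> c i \<tau> y"
proof -
  \<comment> \<open>Linear growth is dominated by the exponential, so some finite bound holds to begin with.\<close>
  define M where "M = \<bar>A\<bar> * (1 + 1 / (4 * K)) + 1"
  have M: "M > 0" using K_pos by (simp add: M_def add_nonneg_pos)
  have start: "u i (\<tau>, y) - c i \<tau> y \<le> M * exp (4 * K * \<tau>)" if \<tau>: "\<tau> \<ge> 0" for i \<tau> y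
  proof -
    have "1 + 4 * K * \<tau> \<le> exp (4 * K * \<tau>)" by (rule exp_ge_add_one_self)
    moreover have "0 \<le> 4 * K * \<tau>" using K_pos \<tau> by simp
    ultimately have "4 * K * \<tau> \<le> exp (4 * K * \<tau>)" "1 \<le> exp (4 * K * \<tau>)" by linarith+
    then have "\<tau> \<le> exp (4 * K * \<tau>) / (4 * K)" "1 \<le> exp (4 * K * \<tau>)"
      using K_pos by (simp_all add: pos_le_divide_eq mult_ac)
    moreover have "(1 + 1 / (4 * K)) * exp (4 * K * \<tau>) = exp (4 * K * \<tau>) + exp (4 * K * \<tau>) / (4 * K)"
      by (simp add: distrib_right)
    ultimately have "1 + \<tau> \<le> (1 + 1 / (4 * K)) * exp (4 * K * \<tau>)" by linarith
    then have "\<bar>A\<bar> * (1 + \<tau>) \<le> \<bar>A\<bar> * ((1 + 1 / (4 * K)) * exp (4 * K * \<tau>))" by (rule mult_left_mono) simp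
    moreover have "A * (1 + \<tau>) \<le> \<bar>A\<bar> * (1 + \<tau>)" using \<tau> by (intro mult_right_mono) auto
    moreover have "M * exp (4 * K * \<tau>)
        = \<bar>A\<bar> * ((1 + 1 / (4 * K)) * exp (4 * K * \<tau>)) + exp (4 * K * \<tau>)"
      unfolding M_def by (simp only: distrib_right mult.assoc mult_1)
    ultimately show ?thesis using growth[OF \<tau>, of i y] exp_gt_zero[of "4 * K * \<tau>"] by linarith
  qed
  have iter: "u i (\<tau>, y) - c i \<tau> y \<le> M / 2 ^ k * exp (4 * K * \<tau>)" if "\<tau> \<ge> 0" for k i \<tau> y
    using that
  proof (induction k arbitrary: i \<tau> y)
    case 0 then show ?case using start by simp
  next
    case (Suc k)
    show ?case using halving[OF _ Suc.IH Suc.prems, of i y] M by (simp add: mult.commute)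
  qed
  have "(\<lambda>k::nat. (M * exp (4 * K * \<tau>)) * (1 / 2) ^ k) \<longlonglongrightarrow> (M * exp (4 * K * \<tau>)) * 0"
    by (intro tendsto_mult tendsto_const LIMSEQ_power_zero) simp
  moreover have "u i (\<tau>, y) - c i \<tau> y \<le> (M * exp (4 * K * \<tau>)) * (1 / 2) ^ k" for k
    using iter[OF assms, of i y k] by (simp add: power_one_over)
  ultimately have "u i (\<tau>, y) - c i \<tau> y \<le> (M * exp (4 * K * \<tau>)) * 0" by (intro LIMSEQ_le_const) auto
  then show ?thesis by simp
qed

end

section \<open>Uniqueness and continuity of the speed\<close>

lemma usc_envelope_near_continuous:
  assumes B: "continuous_on UNIV B" and f: "\<And>x. \<bar>f x - B x\<bar> \<le> C"
  shows "\<bar>usc_envelope f x - B x\<bar> \<le> C"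
proof (rule field_le_epsilon)
  fix e :: real assume e: "e > 0"
  have "(B \<longlongrightarrow> B x) (at x)"
    using B unfolding continuous_on_eq_continuous_at[OF open_UNIV] isCont_def by blast
  then have "\<forall>\<^sub>F y in at x. dist (B y) (B x) < e" using e by (rule tendstoD)
  then have ev: "\<forall>\<^sub>F y in nhds x. dist (B y) (B x) < e" using e by (simp add: eventually_nhds_conv_at)
  have near: "B x - (C + e) \<le> f y" "f y \<le> B x + (C + e)" if "dist (B y) (B x) < e" for y
    using that f[of y] unfolding dist_real_def by linarith+
  have lo: "\<forall>\<^sub>F y in nhds x. B x - (C + e) \<le> f y"
    by (rule eventually_mono[OF ev near(1)])
  have up: "\<forall>\<^sub>F y in nhds x. f y \<le> B x + (C + e)"
    by (rule eventually_mono[OF ev near(2)])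
  show "\<bar>usc_envelope f x - B x\<bar> \<le> C + e"
    using usc_envelope_between(1,2)[OF lo up] by (simp add: abs_le_iff)
qed

lemma lsc_envelope_near_continuous:
  assumes B: "continuous_on UNIV B" and f: "\<And>x. \<bar>f x - B x\<bar> \<le> C"
  shows "\<bar>lsc_envelope f x - B x\<bar> \<le> C"
proof -
  have "\<bar>usc_envelope (\<lambda>y. - f y) x - (- B x)\<bar> \<le> C"
  proof (rule usc_envelope_near_continuous)
    show "continuous_on UNIV (\<lambda>x. - B x)" by (intro continuous_intros B)
    show "\<bar>- f x - - B x\<bar> \<le> C" for x using f[of x] by linarith
  qed
  then show ?thesis unfolding lsc_envelope_uminus by linarith
qed

lemma linear_growth_bound:
  fixes d E :: real
  assumes "\<And>\<tau>. 0 \<le> \<tau> \<Longrightarrow> d * \<tau> \<le> E"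
  shows "d \<le> 0"
proof (rule ccontr)
  assume "\<not> d \<le> 0"
  then have d: "d > 0" by simp
  have "E \<ge> 0" using assms[of 0] by simp
  then have "d * ((E + 1) / d) \<le> E" using d by (intro assms) simp
  then show False using d by simp
qed

context chain begin

text \<open>
  The bounds in the definition of a hull profile depend on the index; quasi-periodicity reduces all indices to
  finitely many.
\<close>
lemma hull_profile_near_line:
  assumes p: "p \<ge> 0" and f: "hull_profile n p f"
  obtains C where "\<And>j \<tau> z b. \<bar>f j (\<tau>, z) - line p z (j, b)\<bar> \<le> C"
proof -
  have "\<forall>j. \<exists>C. \<forall>\<tau> z. \<bar>f j (\<tau>, z) - z\<bar> \<le> C" and shift: "\<And>j \<tau> z. f (j + int n) (\<tau>, z) = f j (\<tau>, z + p)"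
    using f unfolding hull_profile_def by blast+
  then obtain C where C: "\<And>j \<tau> z. \<bar>f j (\<tau>, z) - z\<bar> \<le> C j" by metis
  define C' where "C' = (\<Sum>r\<in>{0..<int n}. \<bar>C r\<bar>) + p"
  have "\<bar>f j (\<tau>, z) - line p z (j, b)\<bar> \<le> C'" for j \<tau> z b
  proof -
    define r where "r = j mod int n"
    have r: "0 \<le> r" "r < int n" using n_pos by (simp_all add: r_def)
    \<comment> \<open>Subtracting the slope makes the family \<open>n\<close>-periodic in the index.\<close>
    define g where "g k = f k (\<tau>, line p z (j, b) - p * of_int k / real n)" for k
    have "g (k + int n) = g k" for k
      using n_pos unfolding g_def shift by (simp add: field_simps)
    from integer_multiples_of_period[where g = g, OF this, of r "j div int n"]
    have "g j = g r" by (simp add: r_def)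
    moreover have "g j = f j (\<tau>, z)" by (simp add: g_def line_def)
    moreover have "\<bar>g r - (line p z (j, b) - p * of_int r / real n)\<bar> \<le> \<bar>C r\<bar>"
      unfolding g_def using C[of r] abs_ge_self order_trans by blast
    moreover have "\<bar>C r\<bar> \<le> (\<Sum>r\<in>{0..<int n}. \<bar>C r\<bar>)" using r by (intro member_le_sum) auto
    moreover have "0 \<le> p * of_int r / real n" using p r by simp
    moreover have "p * of_int r / real n \<le> p * 1"
    proof -
      have "of_int r / real n \<le> 1" using r n_pos by (simp add: field_simps)
      from mult_left_mono[OF this p] show ?thesis by simp
    qed
    ultimately show ?thesis unfolding C'_def by (simp add: abs_le_iff) linarith
  qed
  then show thesis using that by blast
qed

text \<open>
  The chains that start from the lines \<open>p y + z\<^sub>0\<close>, in the form required of \<open>c\<close> in the comparison.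
\<close>
definition planar :: "real \<Rightarrow> real \<Rightarrow> int \<times> bool \<Rightarrow> real \<Rightarrow> real \<Rightarrow> real" where
  "planar p z\<^sub>0 i \<tau> y = evol 0 \<tau> (line p (p * y + z\<^sub>0)) i"

lemma planar_start: "planar p z\<^sub>0 i 0 y = line p (p * y) i + z\<^sub>0"
  unfolding planar_def evol_start[OF dominated_line] by (simp add: line_add)

lemma planar_comparison_data:
  assumes p: "p > 0"
  shows "continuous_on {0..} (\<lambda>\<tau>. planar p z\<^sub>0 i \<tau> y)"
    and "\<tau> > 0 \<Longrightarrow> ((\<lambda>\<tau>. planar p z\<^sub>0 i \<tau> y) has_real_derivative (shifted_field \<tau> (\<lambda>k. planar p z\<^sub>0 k \<tau> y) i - \<alpha> * planar p z\<^sub>0 i \<tau> y)) (at \<tau>)"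
    and "continuous_on {0..} (\<lambda>\<tau>. shifted_field \<tau> (\<lambda>k. planar p z\<^sub>0 k \<tau> y) i)"
    and "\<tau> \<ge> 0 \<Longrightarrow> \<bar>planar p z\<^sub>0 i \<tau> y - planar p z\<^sub>0 i \<tau> y'\<bar> \<le> 2 * p * exp (4 * ((2 * Lip * 2 ^ m + \<alpha>) * 2 ^ m) * \<tau>) * \<bar>y - y'\<bar>"
proof -
  have cont: "continuous_on {0..} (\<lambda>\<tau>. planar p z\<^sub>0 i \<tau> y)" for i y
  proof -
    have C: "continuous_on {0..T} (\<lambda>\<tau>. planar p z\<^sub>0 i \<tau> y)" for T
      using continuous_from_evol[OF dominated_line, of 0 p "p * y + z\<^sub>0"] unfolding continuous_from_def planar_def by blast
    show ?thesis
      unfolding continuous_on_eq_continuous_within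
    proof
      fix \<tau> :: real assume \<tau>: "\<tau> \<in> {0..}"
      have "continuous (at \<tau> within {0..\<tau> + 1}) (\<lambda>\<tau>. planar p z\<^sub>0 i \<tau> y)"
        using C[of "\<tau> + 1"] \<tau> by (simp add: continuous_on_eq_continuous_within)
      moreover have "at \<tau> within {0..\<tau> + 1} = at \<tau> within {0..}"
        by (rule at_within_nhd[of _ "{..<\<tau> + 1}"]) auto
      ultimately show "continuous (at \<tau> within {0..}) (\<lambda>\<tau>. planar p z\<^sub>0 i \<tau> y)" by (simp add: continuous_within)
    qed
  qed
  show "continuous_on {0..} (\<lambda>\<tau>. planar p z\<^sub>0 i \<tau> y)" by (rule cont)
  show "continuous_on {0..} (\<lambda>\<tau>. shifted_field \<tau> (\<lambda>k. planar p z\<^sub>0 k \<tau> y) i)" by (rule Q_cont[OF cont])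
  show "((\<lambda>\<tau>. planar p z\<^sub>0 i \<tau> y) has_real_derivative (shifted_field \<tau> (\<lambda>k. planar p z\<^sub>0 k \<tau> y) i - \<alpha> * planar p z\<^sub>0 i \<tau> y)) (at \<tau>)" if "\<tau> > 0"
    using evol_derivative[OF dominated_line that, of p "p * y + z\<^sub>0" i] unfolding planar_def by simp
  show "\<bar>planar p z\<^sub>0 i \<tau> y - planar p z\<^sub>0 i \<tau> y'\<bar> \<le> 2 * p * exp (4 * ((2 * Lip * 2 ^ m + \<alpha>) * 2 ^ m) * \<tau>) * \<bar>y - y'\<bar>" if \<tau>: "\<tau> \<ge> 0"
  proof -
    let ?K = "(2 * Lip * 2 ^ m + \<alpha>) * 2 ^ m"
    have "\<bar>line p (p * y + z\<^sub>0) i - line p (p * y' + z\<^sub>0) i\<bar> \<le> p * \<bar>y - y'\<bar> * 1" for i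
      using p by (auto simp: line_def abs_mult split: prod.splits simp flip: right_diff_distrib)
    from evol_lipschitz[OF dominated_line dominated_line \<tau> tame_1 this]
    have "\<bar>planar p z\<^sub>0 i \<tau> y - planar p z\<^sub>0 i \<tau> y'\<bar> \<le> 2 * (p * \<bar>y - y'\<bar>) * exp (2 * ?K * \<tau>)"
      by (simp add: planar_def)
    also have "\<dots> \<le> 2 * (p * \<bar>y - y'\<bar>) * exp (4 * ?K * \<tau>)"
    proof (rule mult_left_mono)
      have "2 * k * \<tau> \<le> 4 * k * \<tau>" if "k > 0" for k
        using that \<tau> by (intro mult_right_mono) auto
      from this[OF K_pos] show "exp (2 * ?K * \<tau>) \<le> exp (4 * ?K * \<tau>)" by (simp only: exp_le_cancel_iff)
    qed (use p in simp)
    finally show ?thesis by (simp add: mult_ac)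
  qed
qed

text \<open>
  At time \<open>0\<close> the envelopes lie within \<open>C\<close> of lines.  The comparison keeps the upper envelope below the
  evolution of the line raised by \<open>C\<close>, so \<open>l \<le> \<rho>\<close>.  Negating the lower envelope, the field and the classical
  family turns supersolutions into subsolutions and gives the reverse inequality.
\<close>
lemma hull_function_rate:
  assumes p: "p > 0" and drift: "drift p \<rho> D" and hull: "hull_function \<alpha> n F p l h g"
  shows "l = \<rho>"
proof -
  let ?K = "(2 * Lip * 2 ^ m + \<alpha>) * 2 ^ m"
  define w where "w = (\<lambda>(j, b). (\<lambda>(\<tau>, y). (if b then h j else g j) (\<tau>, l * \<tau> + p * y)))"
  define B where "B i = (\<lambda>(\<tau>, y). line p (l * \<tau> + p * y) i)" for i
  have profiles: "hull_profile n p h" "hull_profile n p g" using hull by (auto simp: hull_function_def)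
  obtain C1 where C1: "\<And>j \<tau> z b. \<bar>h j (\<tau>, z) - line p z (j, b)\<bar> \<le> C1"
    using hull_profile_near_line[OF less_imp_le[OF p] profiles(1)] by blast
  obtain C2 where C2: "\<And>j \<tau> z b. \<bar>g j (\<tau>, z) - line p z (j, b)\<bar> \<le> C2"
    using hull_profile_near_line[OF less_imp_le[OF p] profiles(2)] by blast
  define C where "C = max C1 C2"
  have w_near: "\<bar>w i x - B i x\<bar> \<le> C" for i x
    using C1 C2 by (auto simp: w_def B_def C_def le_max_iff_disj split: prod.splits)
  have B_cont: "continuous_on UNIV (B i)" for i
    unfolding B_def line_def split_def by (intro continuous_intros)
  have B_line: "B i (\<tau>, y) = line p (p * y) i + l * \<tau>" for i \<tau> y
    using line_add[of p "p * y" "l * \<tau>"] by (simp add: B_def add.commute)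
  have B0: "B (0, True) (\<tau>, 0) = l * \<tau>" for \<tau> by (simp add: B_def line_def)
  have c_near: "\<bar>planar p z i \<tau> y - (line p (p * y) i + z + \<rho> * \<tau>)\<bar> \<le> D" if "\<tau> \<ge> 0" for \<tau> y z i
  proof -
    have "line p (p * y + z + \<rho> * (\<tau> - 0)) i = line p (p * y) i + z + \<rho> * \<tau>"
      by (simp add: line_add)
    then show ?thesis using drift that unfolding drift_def planar_def by metis
  qed
  have sub: "visc_subsolution \<alpha> n F (\<lambda>j. usc_envelope (w (j, True))) (\<lambda>j. usc_envelope (w (j, False)))"
    and super: "visc_supersolution \<alpha> n F (\<lambda>j. lsc_envelope (w (j, True))) (\<lambda>j. lsc_envelope (w (j, False)))"
    using hull by (simp_all add: hull_function_def visc_solution_def w_def)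
  have upper_near: "\<bar>usc_envelope (w i) x - B i x\<bar> \<le> C" and lower_near: "\<bar>lsc_envelope (w i) x - B i x\<bar> \<le> C" for i x
    using usc_envelope_near_continuous[OF B_cont w_near] lsc_envelope_near_continuous[OF B_cont w_near] by auto
  have shift_mono: "shifted_field t x i \<le> shifted_field t y i + ?K * d" if "\<And>k. x k \<le> y k + d" "d \<ge> 0" for t x y d i
  proof -
    have "shifted_field t x i \<le> shifted_field t (\<lambda>k. y k + d) i" by (rule Q_mono) (rule that)
    moreover have "\<bar>shifted_field t (\<lambda>k. y k + d) i - shifted_field t y i\<bar> \<le> ?K * d" by (rule Q_lip_1) (use that in simp)
    ultimately show ?thesis by linarith
  qed
  have growth: "(l - \<rho>) * \<tau> + G \<le> (\<bar>l - \<rho>\<bar> + \<bar>G\<bar>) * (1 + \<tau>)" "(\<rho> - l) * \<tau> + G \<le> (\<bar>l - \<rho>\<bar> + \<bar>G\<bar>) * (1 + \<tau>)"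
    if "\<tau> \<ge> 0" for \<tau> G
  proof -
    have "(l - \<rho>) * \<tau> \<le> \<bar>l - \<rho>\<bar> * \<tau>" "(\<rho> - l) * \<tau> \<le> \<bar>l - \<rho>\<bar> * \<tau>" using that by (intro mult_right_mono; simp)+
    moreover have "\<bar>G\<bar> * \<tau> \<ge> 0" using that by simp
    ultimately show "(l - \<rho>) * \<tau> + G \<le> (\<bar>l - \<rho>\<bar> + \<bar>G\<bar>) * (1 + \<tau>)" "(\<rho> - l) * \<tau> + G \<le> (\<bar>l - \<rho>\<bar> + \<bar>G\<bar>) * (1 + \<tau>)"
      by (simp_all add: algebra_simps)
  qed
  note cU = planar_comparison_data[OF p, where z\<^sub>0 = C] and cL = planar_comparison_data[OF p, where z\<^sub>0 = "- C"]
  interpret U: viscosity_comparison shifted_field \<alpha> ?K "2 * p" "\<bar>l - \<rho>\<bar> + \<bar>D\<bar>" "\<lambda>i. usc_envelope (w i)"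
    "\<lambda>i \<tau> y. planar p C i \<tau> y"
  proof
    show "\<alpha> \<ge> 0" "?K > 0" using \<alpha>_pos K_pos by simp_all
    show "shifted_field t x i \<le> shifted_field t y i + ?K * d" if "\<And>k. x k \<le> y k + d" "d \<ge> 0" for t x y d i
      by (rule shift_mono[OF that])
    fix i :: "int \<times> bool"
    obtain j b where i: "i = (j, b)" by force
    show "upper_semicontinuous (usc_envelope (w i))"
      using sub unfolding visc_subsolution_def i by (cases b) auto
    show "time_deriv \<phi> \<tau> y \<le> shifted_field \<tau> (\<lambda>k. usc_envelope (w k) (\<tau>, y)) i - \<alpha> * usc_envelope (w i) (\<tau>, y)"
      if "C1_function \<phi>" "local_max_at (\<lambda>x. usc_envelope (w i) x - \<phi> x) (\<tau>, y)" for \<phi> \<tau> y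
      using sub that unfolding visc_subsolution_def i by (cases b) (auto simp: shifted_field_def right_diff_distrib add_diff_eq)
    fix y
    show "continuous_on {0..} (\<lambda>\<tau>. planar p C i \<tau> y)" by (rule cU(1))
    show "continuous_on {0..} (\<lambda>\<tau>. shifted_field \<tau> (\<lambda>k. planar p C k \<tau> y) i)" by (rule cU(3))
    show "usc_envelope (w i) (0, y) \<le> planar p C i 0 y"
      using upper_near[of i "(0, y)"] unfolding B_line planar_start by simp
    fix \<tau> :: real
    show "((\<lambda>\<tau>. planar p C i \<tau> y) has_real_derivative
      shifted_field \<tau> (\<lambda>k. planar p C k \<tau> y) i - \<alpha> * planar p C i \<tau> y) (at \<tau>)" if "\<tau> > 0"
      by (rule cU(2)[OF that])
    assume \<tau>: "\<tau> \<ge> 0"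
    show "\<bar>planar p C i \<tau> y - planar p C i \<tau> y'\<bar> \<le> 2 * p * exp (4 * ?K * \<tau>) * \<bar>y - y'\<bar>" for y'
      by (rule cU(4)[OF \<tau>])
    show "usc_envelope (w i) (\<tau>, y) - planar p C i \<tau> y \<le> (\<bar>l - \<rho>\<bar> + \<bar>D\<bar>) * (1 + \<tau>)"
      using upper_near[of i "(\<tau>, y)"] c_near[OF \<tau>, where y = y and z = C and i = i] growth(1)[OF \<tau>, of D]
      unfolding B_line by (simp add: left_diff_distrib abs_le_iff)
  qed
  have "(l - \<rho>) * \<tau> \<le> 2 * C + D" if \<tau>: "\<tau> \<ge> 0" for \<tau>
    using U.comparison[OF \<tau>, of "(0, True)" 0] upper_near[of "(0, True)" "(\<tau>, 0)"]
      c_near[OF \<tau>, where y = 0 and z = C and i = "(0, True)"]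
    unfolding B0 by (simp add: line_def left_diff_distrib abs_le_iff)
  then have "l \<le> \<rho>" using linear_growth_bound[of "l - \<rho>" "2 * C + D"] by simp
  interpret L: viscosity_comparison "\<lambda>t x i. - shifted_field t (\<lambda>k. - x k) i" \<alpha> ?K "2 * p" "\<bar>l - \<rho>\<bar> + \<bar>D\<bar>"
    "\<lambda>i x. - lsc_envelope (w i) x" "\<lambda>i \<tau> y. - planar p (- C) i \<tau> y"
  proof
    show "\<alpha> \<ge> 0" "?K > 0" using \<alpha>_pos K_pos by simp_all
    show "- shifted_field t (\<lambda>k. - x k) i \<le> - shifted_field t (\<lambda>k. - y k) i + ?K * d" if "\<And>k. x k \<le> y k + d" "d \<ge> 0" for t x y d i
    proof -
      have "- y k \<le> - x k + d" for k using that(1)[of k] by linarith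
      from shift_mono[of "\<lambda>k. - y k" "\<lambda>k. - x k" d t i, OF this that(2)] show ?thesis by simp
    qed
    fix i :: "int \<times> bool"
    obtain j b where i: "i = (j, b)" by force
    have lsc: "lower_semicontinuous (lsc_envelope (w i))"
      using super unfolding visc_supersolution_def i by (cases b) auto
    show "upper_semicontinuous (\<lambda>x. - lsc_envelope (w i) x)"
      unfolding upper_semicontinuous_def
    proof (intro allI impI)
      fix x c assume "- lsc_envelope (w i) x < c"
      then have "- c < lsc_envelope (w i) x" by linarith
      then have "\<forall>\<^sub>F y in nhds x. - c < lsc_envelope (w i) y"
        using lsc unfolding lower_semicontinuous_def by blast
      then show "\<forall>\<^sub>F y in nhds x. - lsc_envelope (w i) y < c" by (rule eventually_mono) linarith
    qed
    show "time_deriv \<phi> \<tau> y \<le> - shifted_field \<tau> (\<lambda>k. - (- lsc_envelope (w k) (\<tau>, y))) i - \<alpha> * - lsc_envelope (w i) (\<tau>, y)"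
      if \<phi>: "C1_function \<phi>" "local_max_at (\<lambda>x. - lsc_envelope (w i) x - \<phi> x) (\<tau>, y)" for \<phi> \<tau> y
    proof -
      have C1: "C1_function (\<lambda>x. - \<phi> x)"
      proof -
        obtain D where D: "\<And>x. (\<phi> has_derivative blinfun_apply (D x)) (at x)" "continuous_on UNIV D"
          using \<phi>(1) by (auto simp: C1_function_def)
        have "((\<lambda>x. - \<phi> x) has_derivative blinfun_apply (- D x)) (at x)" for x
          using has_derivative_minus[OF D(1)] by (simp add: uminus_blinfun.rep_eq)
        then show ?thesis unfolding C1_function_def
          using continuous_on_minus[OF D(2)] by (intro exI[of _ "\<lambda>x. - D x"]) auto
      qed
      have neg: "time_deriv (\<lambda>x. - \<phi> x) \<tau> y = - time_deriv \<phi> \<tau> y"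
        unfolding time_deriv_def[of "\<lambda>x. - \<phi> x"]
        by (rule DERIV_imp_deriv[OF DERIV_minus[OF C1_time_deriv[OF \<phi>(1)]]])
      have "local_min_at (\<lambda>x. lsc_envelope (w i) x - - \<phi> x) (\<tau>, y)"
        using \<phi>(2) unfolding local_max_at_def local_min_at_def by (rule eventually_mono) linarith
      then have "time_deriv (\<lambda>x. - \<phi> x) \<tau> y \<ge> shifted_field \<tau> (\<lambda>k. lsc_envelope (w k) (\<tau>, y)) i - \<alpha> * lsc_envelope (w i) (\<tau>, y)"
        using super C1 unfolding visc_supersolution_def i by (cases b) (auto simp: shifted_field_def right_diff_distrib add_diff_eq)
      then show ?thesis by (simp add: neg)
    qed
    fix y
    show "continuous_on {0..} (\<lambda>\<tau>. - planar p (- C) i \<tau> y)"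
      by (intro continuous_intros cL(1))
    show "continuous_on {0..} (\<lambda>\<tau>. - shifted_field \<tau> (\<lambda>k. - (- planar p (- C) k \<tau> y)) i)"
      using continuous_on_minus[OF cL(3)] by simp
    show "- lsc_envelope (w i) (0, y) \<le> - planar p (- C) i 0 y"
      using lower_near[of i "(0, y)"] unfolding B_line planar_start by simp
    fix \<tau> :: real
    show "((\<lambda>\<tau>. - planar p (- C) i \<tau> y) has_real_derivative
      - shifted_field \<tau> (\<lambda>k. - (- planar p (- C) k \<tau> y)) i - \<alpha> * - planar p (- C) i \<tau> y) (at \<tau>)" if "\<tau> > 0"
      using DERIV_minus[OF cL(2)[OF that, where i = i and y = y]] by simp
    assume \<tau>: "\<tau> \<ge> 0"
    show "\<bar>- planar p (- C) i \<tau> y - - planar p (- C) i \<tau> y'\<bar> \<le> 2 * p * exp (4 * ?K * \<tau>) * \<bar>y - y'\<bar>" for y'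
      using cL(4)[OF \<tau>, where i = i and y = y and y' = y'] by linarith
    show "- lsc_envelope (w i) (\<tau>, y) - - planar p (- C) i \<tau> y \<le> (\<bar>l - \<rho>\<bar> + \<bar>D\<bar>) * (1 + \<tau>)"
      using lower_near[of i "(\<tau>, y)"] c_near[OF \<tau>, where y = y and z = "- C" and i = i] growth(2)[OF \<tau>, of D]
      unfolding B_line by (simp add: left_diff_distrib abs_le_iff)
  qed
  have "(\<rho> - l) * \<tau> \<le> 2 * C + D" if \<tau>: "\<tau> \<ge> 0" for \<tau>
    using L.comparison[OF \<tau>, of "(0, True)" 0] lower_near[of "(0, True)" "(\<tau>, 0)"]
      c_near[OF \<tau>, where y = 0 and z = "- C" and i = "(0, True)"]
    unfolding B0 by (simp add: line_def left_diff_distrib abs_le_iff)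
  then have "\<rho> \<le> l" using linear_growth_bound[of "\<rho> - l" "2 * C + D"] by simp
  with \<open>l \<le> \<rho>\<close> show "l = \<rho>" by simp
qed

lemma hull_function_exists:
  assumes p: "p > 0" and l: "rotation p l"
  shows "\<exists>h g. hull_function \<alpha> n F p l h g"
proof -
  obtain D where "drift p l D"
    using rotation_drift[OF less_imp_le[OF p] l] unfolding drift_def by blast
  from invariant_profile_exists[OF less_imp_le[OF p] this]
  obtain C Z where "profile p C Z" "\<And>q. 0 \<le> q \<Longrightarrow> push l q Z = Z" by blast
  from hull_function_from_invariant_profile[OF p this] show ?thesis by blast
qed

lemma hull_function_unique_rate:
  assumes p: "p > 0" and \<rho>: "rotation p \<rho>" and hull: "hull_function \<alpha> n F p l h g"
  shows "l = \<rho>"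
proof -
  obtain D where "drift p \<rho> D"
    using rotation_drift[OF less_imp_le[OF p] \<rho>] unfolding drift_def by blast
  then show ?thesis by (rule hull_function_rate[OF p _ hull])
qed

lemma effective_hamiltonian_rotation:
  assumes p: "p > 0"
  shows "rotation p (effective_hamiltonian \<alpha> n F p)"
proof -
  obtain l where l: "rotation p l" using rotation_exists[OF less_imp_le[OF p]] .
  have "effective_hamiltonian \<alpha> n F p = l"
    unfolding effective_hamiltonian_def
    using hull_function_exists[OF p l] hull_function_unique_rate[OF p l] by (intro the_equality) blast+
  then show ?thesis using l by simp
qed

lemma width_mono:
  assumes "0 \<le> p" "p \<le> q"
  shows "width p \<le> width q"
proof -
  have "Lip * (2 + (2 + real m) * p) \<le> Lip * (2 + (2 + real m) * q)"
    using assms Lip_nonneg by (intro mult_left_mono add_left_mono) auto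
  then have "force_bound p \<le> force_bound q" by (simp add: force_bound_def)
  then have "force_bound p / \<alpha> \<le> force_bound q / \<alpha>" using \<alpha>_pos by (simp add: divide_right_mono)
  then show ?thesis using assms by (simp add: width_def)
qed

lemma disp_slope_lipschitz:
  assumes "0 \<le> t"
  shows "\<bar>disp p 0 t - disp q 0 t\<bar> \<le> 2 * \<bar>p - q\<bar> * exp (2 * ((2 * Lip * 2 ^ m + \<alpha>) * 2 ^ m) * t)"
proof -
  have "\<bar>evol 0 t (line p 0) (0, True) - evol 0 t (line q 0) (0, True)\<bar>
      \<le> 2 * \<bar>p - q\<bar> * exp (2 * ((2 * Lip * 2 ^ m + \<alpha>) * 2 ^ m) * (t - 0)) * weight (0, True)"
    by (intro evol_lipschitz dominated_line tame_w line_slope_lipschitz assms)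
  then show ?thesis by (simp add: disp_def weight_def)
qed

text \<open>
  At a large fixed time \<open>k\<close> the displacement divided by \<open>k\<close> is Lipschitz in \<open>p\<close> and approximates the speed uniformly for slopes near \<open>p\<close>.
\<close>
lemma rotation_continuous:
  assumes f: "\<And>p. p > 0 \<Longrightarrow> rotation p (f p)"
  shows "continuous_on {0<..} f"
  unfolding continuous_on_iff
proof (intro ballI allI impI)
  fix p e :: real assume "p \<in> {0<..}" and e: "e > 0"
  then have p: "p > 0" by simp
  define W where "W = width (p + 1)"
  obtain k :: nat where k0: "8 * W / e < real k" using reals_Archimedean2 by blast
  have W: "W > 0"
  proof -
    have "force_bound (p + 1) / \<alpha> \<ge> 0" using force_bound_nonneg[of "p + 1"] p \<alpha>_pos by simp
    then show ?thesis using p by (simp add: W_def width_def)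
  qed
  then have k_pos: "real k > 0" using k0 e by (meson divide_pos_pos less_trans mult_pos_pos zero_less_numeral)
  have k: "4 * W < e / 2 * real k" using k0 e by (simp add: field_simps)
  define E where "E = exp (2 * ((2 * Lip * 2 ^ m + \<alpha>) * 2 ^ m) * real k)"
  have E: "E > 0" by (simp add: E_def)
  define d where "d = min 1 (e * real k / (4 * E))"
  have d: "d > 0" using e k_pos E by (simp add: d_def)
  have "dist (f q) (f p) < e" if q: "q \<in> {0<..}" "dist q p < d" for q
  proof -
    have q0: "q > 0" using q by simp
    have qp: "\<bar>q - p\<bar> < 1" "\<bar>q - p\<bar> < e * real k / (4 * E)" using q(2) by (auto simp: dist_real_def d_def)
    have "2 * \<bar>q - p\<bar> * E < e * real k / 2" using qp(2) E by (simp add: field_simps)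
    then have close: "\<bar>disp q 0 k - disp p 0 k\<bar> < e * real k / 2"
      using disp_slope_lipschitz[of "real k" q p] by (simp add: E_def)
    have near: "\<bar>disp r 0 k - f r * real k\<bar> \<le> 2 * W" if r: "r > 0" "r \<le> p + 1" for r
    proof -
      have "\<bar>disp r 0 k - f r * real k\<bar> \<le> 2 * width r" using f[OF r(1)] by (simp add: rotation_def)
      then show ?thesis using width_mono[of r "p + 1"] r unfolding W_def by linarith
    qed
    moreover have "\<bar>disp q 0 k - f q * real k\<bar> \<le> 2 * W" "\<bar>disp p 0 k - f p * real k\<bar> \<le> 2 * W"
      using near[of q] near[of p] q0 qp(1) p by (simp_all add: abs_less_iff)
    ultimately have "\<bar>f q * real k - f p * real k\<bar> < e * real k" using k close by linarith
    then have "\<bar>f q - f p\<bar> * real k < e * real k" using k_pos by (simp add: abs_mult flip: left_diff_distrib)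
    then show ?thesis using k_pos by (simp add: dist_real_def)
  qed
  then show "\<exists>d>0. \<forall>q\<in>{0<..}. dist q p < d \<longrightarrow> dist (f q) (f p) < e" using d by blast
qed

end

theorem theorem1p10:
  fixes n m :: nat and \<alpha>\<^sub>0 :: real
    and F :: "int \<Rightarrow> real \<Rightarrow> (int \<Rightarrow> real) \<Rightarrow> real"
  assumes "n \<ge> 1" and "\<alpha>\<^sub>0 > 0" and "admissible \<alpha>\<^sub>0 n m F"
  shows "(\<forall>p>0. \<exists>!l. \<exists>h g. hull_function \<alpha>\<^sub>0 n F p l h g) \<and>
         continuous_on {0<..} (effective_hamiltonian \<alpha>\<^sub>0 n F)"
proof -
  interpret chain n m \<alpha>\<^sub>0 F using assms by unfold_locales
  have "\<exists>!l. \<exists>h g. hull_function \<alpha>\<^sub>0 n F p l h g" if p: "p > 0" for p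
  proof -
    obtain l where l: "rotation p l" using rotation_exists[OF less_imp_le[OF p]] .
    then show ?thesis
      using hull_function_exists[OF p l] hull_function_unique_rate[OF p l] by blast
  qed
  then show ?thesis using rotation_continuous[OF effective_hamiltonian_rotation] by blast
qed

end
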